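(* Let $K$ be a convex body in $\mathbb{R}^n$ ($n\ge2$) of class $C^2_+$ with centroid at the origin, and let $g(x)=\sqrt{\kappa_K(x)}$ for $x\in\partial K$. Then, with $c_n=2|B_2^{n-1}|^{\frac{2}{n-1}}$, $$\lim_{s\to0^+}c_n\,\frac{|K^{g,s}|-|K|}{s^{\frac{2}{n-1}}}=\mu_K(\partial K).$$
   Context: $K\in C^2_+$ means that $\partial K$ is of class $C^2$ with everywhere strictly positive Gauss curvature $\kappa_K$. $\mu_K$ is the surface area measure on $\partial K$; for a nonnegative integrable $f:\partial K\to\mathbb{R}$, $\mu_f(A)=\int_A f\,d\mu_K$. $[x,K]$ is the convex hull of $\{x\}\cup K$. The illumination surface body is $K^{f,s}=\{x\in\mathbb{R}^n:\mu_f(\partial K\cap\overline{[x,K]\setminus K})\le s\}$. $|\cdot|$ denotes volume; $B_2^{n-1}$ is the Euclidean unit ball of $\mathbb{R}^{n-1}$. *)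

theory Defs
  imports "HOL-Analysis.Analysis"
begin

definition convex_body :: "'a::euclidean_space set \<Rightarrow> bool" where
  "convex_body K \<longleftrightarrow> compact K \<and> convex K \<and> interior K \<noteq> {}"

definition centroid :: "'a::euclidean_space set \<Rightarrow> 'a" where
  "centroid K = (LINT x:K|lborel. x) /\<^sub>R measure lborel K"


subsection \<open>Surface area measure\<close>

text \<open>
  Hausdorff measure with the usual normalisation, for which the \<open>d\<close>-dimensional measure
  agrees with Lebesgue measure on \<open>d\<close>-dimensional flats. Meant for \<open>d \<ge> 1\<close> (for \<open>d = 0\<close> empty
  members of a cover would be charged \<open>0 ^ 0 = 1\<close>). The boundedness condition is needed because
  \<^const>\<open>diameter\<close> is \<open>0\<close> on unbounded sets.
\<close>

definition hausdorff_pre :: "nat \<Rightarrow> real \<Rightarrow> 'a::metric_space set \<Rightarrow> ennreal" where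
  "hausdorff_pre d \<delta> A =
     (INF C \<in> {C :: nat \<Rightarrow> 'a set. A \<subseteq> (\<Union>i. C i) \<and> (\<forall>i. bounded (C i) \<and> diameter (C i) \<le> \<delta>)}.
        \<Sum>i. ennreal (unit_ball_vol (real d) * (diameter (C i) / 2) ^ d))"

definition hausdorff_outer :: "nat \<Rightarrow> 'a::metric_space set \<Rightarrow> ennreal" where
  "hausdorff_outer d A = (SUP \<delta> \<in> {0<..}. hausdorff_pre d \<delta> A)"

text \<open>
  \<^const>\<open>hausdorff_outer\<close> is a metric outer measure, hence countably additive on the Borel sets,
  so that \<^const>\<open>measure_of\<close> does not fall back to the zero measure here.
\<close>

definition hausdorff_measure :: "nat \<Rightarrow> 'a::metric_space measure" where
  "hausdorff_measure d = measure_of UNIV (sets borel) (hausdorff_outer d)"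

definition surface_area_measure :: "(real^'n) set \<Rightarrow> (real^'n) measure" where
  "surface_area_measure K = restrict_space (hausdorff_measure (CARD('n) - 1)) (frontier K)"


subsection \<open>Bodies of class \<open>C\<^sup>2\<^sub>+\<close>\<close>

text \<open>\<open>G\<close> is the gradient and \<open>H\<close> the Hessian matrix of \<open>\<rho>\<close>.\<close>

definition C2_on :: "(real^'n) set \<Rightarrow> (real^'n \<Rightarrow> real) \<Rightarrow> (real^'n \<Rightarrow> real^'n) \<Rightarrow> bool" where
  "C2_on U \<rho> G \<longleftrightarrow>
     (\<exists>H :: real^'n \<Rightarrow> real^'n^'n.
        (\<forall>y\<in>U. (\<rho> has_derivative (\<lambda>v. G y \<bullet> v)) (at y)) \<and>
        (\<forall>y\<in>U. (G has_derivative (\<lambda>v. H y *v v)) (at y)) \<and>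
        continuous_on U H)"

definition C2_hypersurface :: "(real^'n) set \<Rightarrow> bool" where
  "C2_hypersurface S \<longleftrightarrow>
     (\<forall>x\<in>S. \<exists>U \<rho> G. open U \<and> x \<in> U \<and> C2_on U \<rho> G \<and> (\<forall>y\<in>U. G y \<noteq> 0) \<and>
        S \<inter> U = {y\<in>U. \<rho> y = 0})"

definition outer_unit_normal :: "'a::euclidean_space set \<Rightarrow> 'a \<Rightarrow> 'a" where
  "outer_unit_normal K x = (THE u. norm u = 1 \<and> (\<forall>y\<in>K. u \<bullet> (y - x) \<le> 0))"

text \<open>
  The Gauss curvature is the determinant of the Weingarten map, i.e. of the differential
  \<open>D : T \<rightarrow> T\<close> of the outer unit normal \<open>\<nu>\<close> along the boundary, where \<open>T\<close> is the tangent
  hyperplane \<open>\<nu>\<^sup>\<bottom>\<close>. To express it by an \<open>n \<times> n\<close> determinant, \<open>D\<close> is extended by \<open>\<nu> \<mapsto> \<nu>\<close>, which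
  leaves the determinant unchanged. The derivative within the boundary is only determined on \<open>T\<close>;
  it is evaluated only at the orthogonal projection of \<open>v\<close> to \<open>T\<close>.
\<close>

definition gauss_curvature :: "(real^'n) set \<Rightarrow> real^'n \<Rightarrow> real" where
  "gauss_curvature K x =
     (let \<nu> = outer_unit_normal K x;
          D = frechet_derivative (outer_unit_normal K) (at x within frontier K)
      in det (matrix (\<lambda>v. D (v - (v \<bullet> \<nu>) *\<^sub>R \<nu>) + (v \<bullet> \<nu>) *\<^sub>R \<nu>)))"

definition C2_plus :: "(real^'n) set \<Rightarrow> bool" where
  "C2_plus K \<longleftrightarrow> C2_hypersurface (frontier K) \<and> (\<forall>x\<in>frontier K. gauss_curvature K x > 0)"


subsection \<open>Illumination surface bodies\<close>

definition weighted_surface_measure :: "(real^'n) set \<Rightarrow> (real^'n \<Rightarrow> real) \<Rightarrow> (real^'n) measure" where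
  "weighted_surface_measure K f = density (surface_area_measure K) (\<lambda>x. ennreal (f x))"

definition illumination_surface_body ::
    "(real^'n) set \<Rightarrow> (real^'n \<Rightarrow> real) \<Rightarrow> real \<Rightarrow> (real^'n) set" where
  "illumination_surface_body K f s =
     {x. emeasure (weighted_surface_measure K f)
           (frontier K \<inter> closure (convex hull (insert x K) - K)) \<le> ennreal s}"

end

theory Submission
  imports Defs
begin

text \<open>
  Let \<open>x\<close> have distance \<open>h\<close> from \<open>K\<close> and closest point \<open>y\<close>, and let \<open>d = n - 1\<close>. In tangential coordinates at \<open>y\<close> the part
  of the boundary visible from \<open>x\<close> is, up to factors \<open>1 \<plusminus> \<epsilon>\<close>, the ellipsoid in which the second fundamental
  form is at most \<open>2 h\<close>. Its \<open>d\<close>-volume is \<open>|B\<^sub>2\<^sup>d| (2 h)\<^bsup>d/2\<^esup> / \<surd>\<kappa>\<close>, so the weight \<open>\<surd>\<kappa>\<close> cancels the dependence on \<open>y\<close>: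
  the illumination body is, up to such factors, the parallel body at distance
  \<open>h\<^sub>s = (s / |B\<^sub>2\<^sup>d|)\<^bsup>2/d\<^esup> / 2 = s\<^bsup>2/d\<^esup> / c\<close>. The volume of that shell is asymptotically \<open>h\<^sub>s\<close> times the surface
  area. Both estimates are local and are made uniform by compactness of the boundary; the Hausdorff measure of
  boundary pieces is compared with Lebesgue measure through almost isometric maps, namely orthogonal projection to
  the tangent hyperplane and \<open>(z, t) \<mapsto> z + t \<nu> z\<close>.
\<close>

subsection \<open>Hausdorff measure\<close>

text \<open>The constant in the limit is sharp, so Hausdorff and Lebesgue measure must agree without
  loss of a factor. Since covers by arbitrary sets are allowed, this is the isodiametric inequality,
  and that is why Brunn-Minkowski appears. Afterwards no area formula is needed: maps that distort
  distances by factors near 1 change \<open>hausdorff_outer d\<close> by a factor near 1. All local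
  estimates concern pairs of boundary points near a fixed \<open>y0\<close> and use one frame and
  one quadratic form, those at \<open>y0\<close>; finitely many frames therefore serve the whole
  boundary. Curvature enters only as \<open>(det B)\<^sup>2\<close>, where
  \<open>(norm (B *v p))\<^sup>2\<close> is the second fundamental form at \<open>y0\<close>. The
  estimate of the visible measure holds only close to \<open>K\<close>. Farther points are handled
  by monotonicity: moving a point towards \<open>K\<close> shrinks what it sees, so a far point of
  the illumination body would bring along a near one that already sees too much. The same
  monotonicity makes the body star-shaped about a ball, hence Lebesgue measurable.\<close>

text \<open>The distance to later sets may depend on \<open>k\<close>, but only the finitely many
  sets before \<open>R n\<close> matter: the minimum of their distances separates their union from
  \<open>R n\<close>.\<close>

lemma metric_outer_measure_finite_sum:
  fixes \<mu> :: "'a::metric_space set \<Rightarrow> ennreal" and R :: "nat \<Rightarrow> 'a set"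
  assumes oms: "outer_measure_space UNIV \<mu>"
    and add: "\<And>A B e. 0 < e \<Longrightarrow> (\<And>x y. x \<in> A \<Longrightarrow> y \<in> B \<Longrightarrow> e \<le> dist x y) \<Longrightarrow> \<mu> A + \<mu> B \<le> \<mu> (A \<union> B)"
    and sep: "\<And>k. \<exists>e>0. \<forall>j>k. \<forall>x\<in>R k. \<forall>y\<in>R j. e \<le> dist x y"
  shows "(\<Sum>k<n. \<mu> (R k)) \<le> \<mu> (\<Union>k<n. R k)"
proof (induction n)
  case 0 then show ?case by simp
next
  case (Suc n)
  have ex: "\<exists>e>0. \<forall>k<m. \<forall>x\<in>R k. \<forall>y\<in>R n. e \<le> dist x y" if "m \<le> n" for m
    using that
  proof (induction m)
    case 0 then show ?case by (intro exI[of _ 1]) auto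
  next
    case (Suc m)
    then obtain e where e: "e > 0" "\<forall>k<m. \<forall>x\<in>R k. \<forall>y\<in>R n. e \<le> dist x y" by auto
    obtain e' where e': "e' > 0" "\<forall>x\<in>R m. \<forall>y\<in>R n. e' \<le> dist x y"
      using sep[of m] Suc.prems by (metis Suc_le_eq)
    show ?case
      using e e' by (intro exI[of _ "min e e'"]) (auto simp: less_Suc_eq min.coboundedI1 min.coboundedI2)
  qed
  obtain e where e: "e > 0" "\<forall>k<n. \<forall>x\<in>R k. \<forall>y\<in>R n. e \<le> dist x y" using ex[OF order_refl] by blast
  have "(\<Sum>k<Suc n. \<mu> (R k)) \<le> \<mu> (\<Union>k<n. R k) + \<mu> (R n)"
    using Suc by (simp add: add_mono)
  also have "\<dots> \<le> \<mu> ((\<Union>k<n. R k) \<union> R n)"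
    using e by (intro add[of e]) auto
  also have "(\<Union>k<n. R k) \<union> R n = (\<Union>k<Suc n. R k)" by (auto simp: less_Suc_eq)
  finally show ?case .
qed

text \<open>By \<open>caratheodory_lemma\<close> it suffices that every closed \<open>F\<close>
  splits every \<open>A\<close> additively. The points of \<open>A\<close> at distance at least
  \<open>1 / (n + 1)\<close> from \<open>F\<close> are separated from \<open>A \<inter> F\<close>;
  the rest of \<open>A - F\<close> consists of thin rings around \<open>F\<close> whose total
  measure tends to 0.\<close>

theorem metric_outer_measure_space:
  fixes \<mu> :: "'a::metric_space set \<Rightarrow> ennreal"
  assumes oms: "outer_measure_space UNIV \<mu>"
    and add: "\<And>A B e. 0 < e \<Longrightarrow> (\<And>x y. x \<in> A \<Longrightarrow> y \<in> B \<Longrightarrow> e \<le> dist x y) \<Longrightarrow> \<mu> A + \<mu> B \<le> \<mu> (A \<union> B)"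
  shows "measure_space UNIV (sets borel) \<mu>"
proof -
  interpret sigma_algebra "UNIV :: 'a set" "UNIV :: 'a set set"
    using sigma_algebra_Pow[of "UNIV :: 'a set"] by simp
  have pos: "\<mu> {} = 0" and mono: "\<And>A B. A \<subseteq> B \<Longrightarrow> \<mu> A \<le> \<mu> B"
    using oms by (auto simp: outer_measure_space_def positive_def increasing_def)
  have csub: "\<mu> (\<Union>i::nat. A i) \<le> (\<Sum>i. \<mu> (A i))" for A
  proof -
    have "\<mu> (\<Union>i. disjointed A i) \<le> (\<Sum>i. \<mu> (disjointed A i))"
      using oms disjoint_family_disjointed[of A] by (simp add: outer_measure_space_def countably_subadditive_def)
    also have "\<dots> \<le> (\<Sum>i. \<mu> (A i))" by (intro suminf_le mono disjointed_subset) auto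
    finally show ?thesis by (simp add: UN_disjointed_eq)
  qed
  have sub2: "\<mu> (A \<union> B) \<le> \<mu> A + \<mu> B" for A B
  proof -
    have "\<mu> (\<Union>i::nat. if i = 0 then A else if i = 1 then B else {})
        \<le> (\<Sum>i::nat. \<mu> (if i = 0 then A else if i = 1 then B else {}))" by (rule csub)
    also have "\<dots> = (\<Sum>i\<in>{0,1::nat}. \<mu> (if i = 0 then A else if i = 1 then B else {}))"
      by (rule suminf_finite) (auto simp: pos)
    also have "(\<Union>i::nat. if i = 0 then A else if i = 1 then B else {}) = A \<union> B"
      by (auto split: if_splits)
    finally show ?thesis by simp
  qed
  have closed_lambda: "F \<in> lambda_system UNIV UNIV \<mu>" if "closed F" for F
  proof (cases "F = {}")
    case True then show ?thesis by (simp add: lambda_system_def pos)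
  next
    case False
    have key: "\<mu> (A \<inter> F) + \<mu> (A - F) \<le> \<mu> A" if fin: "\<mu> A \<noteq> top" for A
    proof -
      define d where "d x = infdist x F" for x
      define An where "An n = {x\<in>A. 1 / real (n+1) \<le> d x}" for n
      define R where "R k = {x\<in>A. 1 / real (k+2) \<le> d x \<and> d x < 1 / real (k+1)}" for k
      have dpos: "0 < d x" if "x \<notin> F" for x
        using \<open>closed F\<close> False that by (simp add: d_def infdist_pos_not_in_closed)
      \<comment> \<open>Neighbouring rings touch, but rings of the same parity have a full ring
        between them, so metric additivity applies to every second ring.\<close>
      have R_sub: "(\<Sum>k<n. \<mu> (R (2*k+i))) \<le> \<mu> A" for n i
      proof -
        have "(\<Sum>k<n. \<mu> (R (2*k+i))) \<le> \<mu> (\<Union>k<n. R (2*k+i))"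
        proof (rule metric_outer_measure_finite_sum[OF oms add, where R="\<lambda>k. R (2*k+i)"])
          fix k
          define e where "e = 1 / real (2*k+i+2) - 1 / real (2*k+i+3)"
          have "1 / real (2*k+i+3) < 1 / real (2*k+i+2)" by (intro divide_strict_left_mono) auto
          then have "e > 0" by (simp add: e_def)
          moreover have "e \<le> dist x y" if "j > k" "x \<in> R (2*k+i)" "y \<in> R (2*j+i)" for j x y
          proof -
            have "d y < 1 / real (2*j+i+1)" "1 / real (2*k+i+2) \<le> d x"
              using that by (auto simp: R_def)
            moreover have "1 / real (2*j+i+1) \<le> 1 / real (2*k+i+3)"
              using that by (intro divide_left_mono) auto
            moreover have "d x \<le> d y + dist x y"
              unfolding d_def by (rule infdist_triangle)
            ultimately show ?thesis by (simp add: e_def)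
          qed
          ultimately show "\<exists>e>0. \<forall>j>k. \<forall>x\<in>R (2*k+i). \<forall>y\<in>R (2*j+i). e \<le> dist x y" by blast
        qed auto
        also have "\<dots> \<le> \<mu> A" by (rule mono) (auto simp: R_def)
        finally show ?thesis .
      qed
      have split: "(\<Sum>k<2*n. \<mu> (R k)) = (\<Sum>k<n. \<mu> (R (2*k+0))) + (\<Sum>k<n. \<mu> (R (2*k+1)))" for n
        by (induction n) (auto simp: algebra_simps)
      have "(\<Sum>k<n. \<mu> (R k)) \<le> 2 * \<mu> A" for n
      proof -
        have "(\<Sum>k<n. \<mu> (R k)) \<le> (\<Sum>k<2*n. \<mu> (R k))" by (rule sum_mono2) auto
        also have "\<dots> \<le> \<mu> A + \<mu> A" unfolding split by (intro add_mono R_sub)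
        finally show ?thesis by (simp add: mult_2)
      qed
      then have "(\<Sum>k. \<mu> (R k)) \<le> 2 * \<mu> A" by (intro suminf_le_const) auto
      then have sumfin: "(\<Sum>k. \<mu> (R k)) < top"
        using fin by (metis ennreal_mult_less_top less_top order_le_less_trans ennreal_numeral_less_top)
      have Rfin: "\<mu> (R k) \<noteq> top" for k
        using ennreal_suminf_lessD[OF sumfin, of k] by auto
      define r where "r k = enn2real (\<mu> (R k))" for k
      have r: "\<mu> (R k) = ennreal (r k)" "r k \<ge> 0" for k
        using Rfin by (auto simp: r_def less_top)
      have summ: "summable r"
        using sumfin r by (simp add: summable_suminf_not_top less_top)
      have tail: "(\<lambda>n. \<Sum>k. r (k + n)) \<longlonglongrightarrow> 0"
        using summ by (rule suminf_exist_split2)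
      have le: "\<mu> (A \<inter> F) + \<mu> (A - F) \<le> \<mu> A + ennreal (\<Sum>k. r (k + n))" for n
      proof -
        have "A - F \<subseteq> An n \<union> (\<Union>k. R (k + n))"
        proof
          fix x assume x: "x \<in> A - F"
          show "x \<in> An n \<union> (\<Union>k. R (k + n))"
          proof (cases "1 / real (n+1) \<le> d x")
            case True then show ?thesis using x by (auto simp: An_def)
          next
            case less: False
            have "\<exists>m. 1 / real (m+1) \<le> d x" using dpos[of x] x
              by (metis Diff_iff One_nat_def Suc_eq_plus1 less_imp_le nat_approx_posE)
            then have L: "1 / real ((LEAST m. 1 / real (m+1) \<le> d x)+1) \<le> d x" by (rule LeastI_ex)
            define m where "m = (LEAST m. 1 / real (m+1) \<le> d x)"
            have "m > n"
            proof (rule ccontr)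
              assume "\<not> m > n"
              then have "1 / real (n+1) \<le> 1 / real (m+1)" by (intro divide_left_mono) auto
              then show False using L less by (simp add: m_def)
            qed
            then obtain k where k: "m = Suc (k + n)" by (metis add.commute less_imp_Suc_add)
            have "\<not> 1 / real ((k+n)+1) \<le> d x"
              using not_less_Least[of "k+n" "\<lambda>m. 1 / real (m+1) \<le> d x"] k by (auto simp: m_def)
            moreover have "1 / real (Suc (k + n) + 1) \<le> d x" using L by (simp only: m_def[symmetric] k)
            ultimately have "x \<in> R (k + n)" using x by (simp add: R_def add_ac)
            then show ?thesis by auto
          qed
        qed
        then have "\<mu> (A - F) \<le> \<mu> (An n \<union> (\<Union>k. R (k + n)))" by (rule mono)
        also have "\<dots> \<le> \<mu> (An n) + (\<Sum>k. \<mu> (R (k + n)))"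
          using sub2[of "An n" "\<Union>k. R (k + n)"] csub[of "\<lambda>k. R (k+n)"] by (meson add_left_mono order_trans)
        also have "(\<Sum>k. \<mu> (R (k + n))) = ennreal (\<Sum>k. r (k + n))"
          unfolding r(1) using r(2) summ by (intro suminf_ennreal2) (auto simp: summable_iff_shift)
        finally have 1: "\<mu> (A - F) \<le> \<mu> (An n) + ennreal (\<Sum>k. r (k + n))" .
        have "\<mu> (A \<inter> F) + \<mu> (An n) \<le> \<mu> (A \<inter> F \<union> An n)"
        proof (rule add[of "1 / real (n+1)"])
          fix x y assume "x \<in> A \<inter> F" "y \<in> An n"
          then show "1 / real (n+1) \<le> dist x y"
            using infdist_le[of x F y] by (auto simp: An_def d_def dist_commute)
        qed auto
        also have "\<dots> \<le> \<mu> A" by (rule mono) (auto simp: An_def)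
        finally have "\<mu> (A \<inter> F) + \<mu> (An n) + ennreal (\<Sum>k. r (k + n)) \<le> \<mu> A + ennreal (\<Sum>k. r (k + n))"
          by (rule add_right_mono)
        moreover have "\<mu> (A \<inter> F) + \<mu> (A - F) \<le> \<mu> (A \<inter> F) + \<mu> (An n) + ennreal (\<Sum>k. r (k + n))"
          using add_left_mono[OF 1] by (simp add: add.assoc)
        ultimately show ?thesis by (rule order_trans[rotated])
      qed
      have "(\<lambda>n. \<mu> A + ennreal (\<Sum>k. r (k + n))) \<longlonglongrightarrow> \<mu> A + ennreal 0"
        by (intro tendsto_add tendsto_const tendsto_ennrealI tail)
      then show ?thesis using le by (intro LIMSEQ_le_const[where X="\<lambda>n. \<mu> A + ennreal (\<Sum>k. r (k + n))"]) auto
    qed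
    have "\<mu> (F \<inter> A) + \<mu> ((UNIV - F) \<inter> A) = \<mu> A" for A
    proof (rule antisym)
      have "(UNIV - F) \<inter> A = A - F" by auto
      then show "\<mu> (F \<inter> A) + \<mu> ((UNIV - F) \<inter> A) \<le> \<mu> A"
        using key[of A] by (cases "\<mu> A = top") (auto simp: Int_commute)
      show "\<mu> A \<le> \<mu> (F \<inter> A) + \<mu> ((UNIV - F) \<inter> A)"
        using sub2[of "F \<inter> A" "(UNIV - F) \<inter> A"] by (simp add: Int_Un_distrib2[symmetric])
    qed
    then show ?thesis by (simp add: lambda_system_def)
  qed
  have ms: "measure_space UNIV (lambda_system UNIV UNIV \<mu>) \<mu>"
    by (rule caratheodory_lemma[OF oms])
  then interpret L: sigma_algebra UNIV "lambda_system UNIV UNIV \<mu>"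
    by (simp add: measure_space_def)
  have "sets (borel :: 'a measure) \<subseteq> lambda_system UNIV UNIV \<mu>"
  proof -
    have "sets (borel :: 'a measure) = sigma_sets UNIV (Collect closed)"
      by (simp add: borel_eq_closed)
    also have "\<dots> \<subseteq> lambda_system UNIV UNIV \<mu>"
      using closed_lambda by (intro L.sigma_sets_subset) auto
    finally show ?thesis .
  qed
  moreover have "sigma_algebra UNIV (sets (borel :: 'a measure))"
    using sets.sigma_algebra_axioms[of "borel :: 'a measure"] by simp
  ultimately show ?thesis using measure_down[OF ms] by blast
qed

section \<open>Hausdorff outer measure as a metric outer measure\<close>

lemma hausdorff_pre_le:
  assumes "A \<subseteq> (\<Union>i. C i)" "\<And>i. bounded (C i)" "\<And>i. diameter (C i) \<le> \<delta>"
  shows "hausdorff_pre d \<delta> A \<le> (\<Sum>i. ennreal (unit_ball_vol (real d) * (diameter (C i) / 2) ^ d))"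
  unfolding hausdorff_pre_def using assms by (intro INF_lower) auto

lemma hausdorff_pre_mono: "A \<subseteq> B \<Longrightarrow> hausdorff_pre d \<delta> A \<le> hausdorff_pre d \<delta> B"
  unfolding hausdorff_pre_def by (intro INF_superset_mono) auto

lemma hausdorff_pre_antimono: "\<delta> \<le> \<delta>' \<Longrightarrow> hausdorff_pre d \<delta>' A \<le> hausdorff_pre d \<delta> A"
  unfolding hausdorff_pre_def by (intro INF_superset_mono) (auto intro: order_trans)

lemma hausdorff_pre_empty: "d \<ge> 1 \<Longrightarrow> \<delta> > 0 \<Longrightarrow> hausdorff_pre d \<delta> {} = 0"
  using hausdorff_pre_le[of "{}" "\<lambda>_. {}" \<delta> d] by (simp add: power_0_left)

lemma hausdorff_pre_close:
  assumes "hausdorff_pre d \<delta> A < e"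
  obtains C where "A \<subseteq> (\<Union>i. C i)" "\<And>i. bounded (C i)" "\<And>i. diameter (C i) \<le> \<delta>"
    "(\<Sum>i. ennreal (unit_ball_vol (real d) * (diameter (C i) / 2) ^ d)) < e"
  using assms unfolding hausdorff_pre_def INF_less_iff by auto

text \<open>Near-optimal covers of the \<open>A n\<close>, with errors
  \<open>e / 2 ^ (n + 1)\<close>, are merged into a single sequence by
  \<open>prod_decode\<close>.\<close>

lemma hausdorff_pre_countable_subadditive:
  "hausdorff_pre d \<delta> (\<Union>i::nat. A i) \<le> (\<Sum>i. hausdorff_pre d \<delta> (A i))"
proof (rule ennreal_le_epsilon)
  fix e :: real assume e: "0 < e" and fin: "(\<Sum>i. hausdorff_pre d \<delta> (A i)) < top"
  let ?f = "\<lambda>C. ennreal (unit_ball_vol (real d) * (diameter C / 2) ^ d)"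
  have "hausdorff_pre d \<delta> (A n) < hausdorff_pre d \<delta> (A n) + e * (1/2)^Suc n" for n
    using fin e by (auto simp add: less_top dest!: ennreal_suminf_lessD)
  then have "\<exists>C. A n \<subseteq> (\<Union>i. C i) \<and> (\<forall>i. bounded (C i) \<and> diameter (C i) \<le> \<delta>) \<and>
      (\<Sum>i. ?f (C i)) < hausdorff_pre d \<delta> (A n) + e * (1/2)^Suc n" for n
    by (metis hausdorff_pre_close)
  then obtain B where B: "\<And>n. A n \<subseteq> (\<Union>i. B n i)" "\<And>n i. bounded (B n i)" "\<And>n i. diameter (B n i) \<le> \<delta>"
      "\<And>n. (\<Sum>i. ?f (B n i)) < hausdorff_pre d \<delta> (A n) + e * (1/2)^Suc n"
    by metis
  define C where "C = case_prod B o prod_decode"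
  have "(\<Union>i. A i) \<subseteq> (\<Union>i. C i)"
    using B(1) by (auto simp add: C_def subset_eq) (metis prod.case prod_encode_inverse)
  then have "hausdorff_pre d \<delta> (\<Union>i. A i) \<le> (\<Sum>i. ?f (C i))"
    using B by (intro hausdorff_pre_le) (auto simp: C_def split: prod.split)
  also have "\<dots> = (\<Sum>n. \<Sum>i. ?f (B n i))"
    unfolding C_def comp_def
    by (rule suminf_ennreal_2dimen[of _ "\<lambda>(n, i). ?f (B n i)", unfolded case_prod_conv, symmetric, THEN sym, THEN trans[rotated]])
       (auto simp: case_prod_unfold)
  also have "\<dots> \<le> (\<Sum>n. hausdorff_pre d \<delta> (A n) + e * (1/2) ^ Suc n)"
    using B(4) by (intro suminf_le) (auto intro: less_imp_le)
  also have "... = (\<Sum>n. hausdorff_pre d \<delta> (A n)) + (\<Sum>n. ennreal e * ennreal ((1/2) ^ Suc n))"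
    using \<open>0 < e\<close> by (subst suminf_add[symmetric])
                     (auto simp del: ennreal_suminf_cmult simp add: ennreal_mult[symmetric])
  also have "\<dots> = (\<Sum>n. hausdorff_pre d \<delta> (A n)) + e"
    unfolding ennreal_suminf_cmult
    by (subst suminf_ennreal_eq[OF zero_le_power power_half_series]) auto
  finally show "hausdorff_pre d \<delta> (\<Union>i. A i) \<le> (\<Sum>n. hausdorff_pre d \<delta> (A n)) + e" .
qed

lemma hausdorff_pre_le_outer: "\<delta> > 0 \<Longrightarrow> hausdorff_pre d \<delta> A \<le> hausdorff_outer d A"
  unfolding hausdorff_outer_def by (intro SUP_upper) auto

lemma hausdorff_outer_mono: "A \<subseteq> B \<Longrightarrow> hausdorff_outer d A \<le> hausdorff_outer d B"
  unfolding hausdorff_outer_def by (intro SUP_mono' hausdorff_pre_mono)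

lemma hausdorff_outer_empty: "d \<ge> 1 \<Longrightarrow> hausdorff_outer d {} = 0"
  unfolding hausdorff_outer_def
  by (intro antisym SUP_least) (auto simp: hausdorff_pre_empty)

lemma hausdorff_outer_countable_subadditive:
  "hausdorff_outer d (\<Union>i::nat. A i) \<le> (\<Sum>i. hausdorff_outer d (A i))"
  unfolding hausdorff_outer_def[of d "\<Union>i. A i"]
proof (rule SUP_least)
  fix \<delta> :: real assume "\<delta> \<in> {0<..}"
  then show "hausdorff_pre d \<delta> (\<Union>i. A i) \<le> (\<Sum>i. hausdorff_outer d (A i))"
    by (intro order_trans[OF hausdorff_pre_countable_subadditive] suminf_le hausdorff_pre_le_outer) auto
qed

text \<open>A monotone sequence replaces the supremum over all scales, so that two suprema can be
  added; the starting scale \<open>e\<close> is free and can be kept below a given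
  separation.\<close>

lemma hausdorff_outer_eq_SUP:
  assumes "e > 0"
  shows "hausdorff_outer d A = (SUP n. hausdorff_pre d (e / real (Suc n)) A)"
  unfolding hausdorff_outer_def
proof (rule antisym)
  show "(SUP \<delta>\<in>{0<..}. hausdorff_pre d \<delta> A) \<le> (SUP n. hausdorff_pre d (e / real (Suc n)) A)"
  proof (rule SUP_least)
    fix \<delta> :: real assume "\<delta> \<in> {0<..}"
    then obtain n where "1 / real (Suc n) < \<delta> / e" using assms nat_approx_posE[of "\<delta>/e"] by auto
    then have "e / real (Suc n) \<le> \<delta>" using assms by (simp add: field_simps)
    then have "hausdorff_pre d \<delta> A \<le> hausdorff_pre d (e / real (Suc n)) A" by (rule hausdorff_pre_antimono)
    then show "hausdorff_pre d \<delta> A \<le> (SUP n. hausdorff_pre d (e / real (Suc n)) A)"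
      by (rule SUP_upper2[rotated]) auto
  qed
  show "(SUP n. hausdorff_pre d (e / real (Suc n)) A) \<le> (SUP \<delta>\<in>{0<..}. hausdorff_pre d \<delta> A)"
    using assms by (intro SUP_least SUP_upper2[OF _ order_refl]) auto
qed

text \<open>A set of diameter below \<open>e\<close> cannot meet both \<open>A\<close> and
  \<open>B\<close>, so every fine cover of the union splits into a cover of \<open>A\<close> and one
  of \<open>B\<close>.\<close>

lemma hausdorff_outer_metric_additive:
  assumes d: "d \<ge> 1" and e: "0 < e" and sep: "\<And>x y. x \<in> A \<Longrightarrow> y \<in> B \<Longrightarrow> e \<le> dist x y"
  shows "hausdorff_outer d A + hausdorff_outer d B \<le> hausdorff_outer d (A \<union> B)"
proof -
  let ?f = "\<lambda>C. ennreal (unit_ball_vol (real d) * (diameter C / 2) ^ d)"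
  have pre: "hausdorff_pre d \<delta> A + hausdorff_pre d \<delta> B \<le> hausdorff_pre d \<delta> (A \<union> B)" if \<delta>: "0 < \<delta>" "\<delta> < e" for \<delta>
    unfolding hausdorff_pre_def[of d \<delta> "A \<union> B"]
  proof (rule INF_greatest, clarify)
    fix C :: "nat \<Rightarrow> 'a set" assume C: "A \<union> B \<subseteq> (\<Union>i. C i)" "\<forall>i. bounded (C i) \<and> diameter (C i) \<le> \<delta>"
    \<comment> \<open>Sets that miss \<open>A\<close> are replaced by the empty set. It costs 0
      because \<open>d \<ge> 1\<close>, so the two new costs add up to at most the old one.\<close>
    let ?CA = "\<lambda>i. if C i \<inter> A = {} then {} else C i"
    let ?CB = "\<lambda>i. if C i \<inter> B = {} then {} else C i"
    have disj: "C i \<inter> A = {} \<or> C i \<inter> B = {}" for i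
    proof (rule ccontr)
      assume "\<not> ?thesis"
      then obtain x y where xy: "x \<in> C i" "x \<in> A" "y \<in> C i" "y \<in> B" by auto
      then have "dist x y \<le> \<delta>" using C(2) diameter_bounded_bound[of "C i" x y] by (meson order_trans)
      then show False using sep[of x y] xy \<delta> by auto
    qed
    have cov: "S \<subseteq> (\<Union>i. if C i \<inter> S = {} then {} else C i)" if S: "S \<subseteq> A \<union> B" for S
    proof
      fix x assume x: "x \<in> S"
      then obtain i where "x \<in> C i" using C(1) S by blast
      with x show "x \<in> (\<Union>i. if C i \<inter> S = {} then {} else C i)" by (intro UN_I[of i]) auto
    qed
    have "hausdorff_pre d \<delta> A + hausdorff_pre d \<delta> B \<le> (\<Sum>i. ?f (?CA i)) + (\<Sum>i. ?f (?CB i))"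
      using C \<delta> by (intro add_mono hausdorff_pre_le cov) auto
    also have "\<dots> = (\<Sum>i. ?f (?CA i) + ?f (?CB i))" by (intro suminf_add) auto
    also have "\<dots> \<le> (\<Sum>i. ?f (C i))"
      using disj d by (intro suminf_le) (auto simp: power_0_left)
    finally show "hausdorff_pre d \<delta> A + hausdorff_pre d \<delta> B \<le> (\<Sum>i. ?f (C i))" .
  qed
  have e2: "e/2 > 0" using e by simp
  have inc: "incseq (\<lambda>n. hausdorff_pre d (e / 2 / real (Suc n)) S)" for S :: "'a set"
    using e by (auto intro!: incseq_SucI hausdorff_pre_antimono simp: field_simps)
  have "hausdorff_outer d A + hausdorff_outer d B
      = (SUP n. hausdorff_pre d (e / 2 / real (Suc n)) A + hausdorff_pre d (e / 2 / real (Suc n)) B)"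
    unfolding hausdorff_outer_eq_SUP[OF e2, of d A] hausdorff_outer_eq_SUP[OF e2, of d B]
    by (rule ennreal_SUP_add[symmetric]) (rule inc)+
  also have "\<dots> \<le> (SUP n. hausdorff_pre d (e / 2 / real (Suc n)) (A \<union> B))"
  proof (intro SUP_mono' pre)
    show "e / 2 / real (Suc n) < e" for n
      using e by (simp add: field_simps add_strict_increasing)
  qed (use e in auto)
  also have "\<dots> = hausdorff_outer d (A \<union> B)" using hausdorff_outer_eq_SUP[OF e2, of d "A \<union> B"] by simp
  finally show ?thesis .
qed

lemma outer_measure_space_hausdorff: "d \<ge> 1 \<Longrightarrow> outer_measure_space UNIV (hausdorff_outer d)"
  by (auto simp: outer_measure_space_def positive_def increasing_def countably_subadditive_def
      hausdorff_outer_empty hausdorff_outer_mono hausdorff_outer_countable_subadditive)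

lemma sets_hausdorff_measure [simp, measurable_cong]: "sets (hausdorff_measure d) = sets borel"
  unfolding hausdorff_measure_def using sets.sigma_sets_eq[of "borel :: 'a measure"] by simp

lemma space_hausdorff_measure [simp]: "space (hausdorff_measure d) = UNIV"
  by (simp add: hausdorff_measure_def)

lemma emeasure_hausdorff_measure:
  assumes "d \<ge> 1" "A \<in> sets borel"
  shows "emeasure (hausdorff_measure d) A = hausdorff_outer d A"
proof -
  have "measure_space UNIV (sets (borel :: 'a measure)) (hausdorff_outer d)"
    using assms(1) by (intro metric_outer_measure_space outer_measure_space_hausdorff hausdorff_outer_metric_additive)
  then show ?thesis
    unfolding hausdorff_measure_def measure_space_def using assms(2)
    by (intro emeasure_measure_of_sigma) auto
qed

text \<open>Covers at scale \<open>\<delta> / L\<close> are carried to covers at scale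
  \<open>\<delta>\<close>, and each cost grows by at most \<open>L ^ d\<close>. Every later
  comparison of Hausdorff measures through a map rests on this.\<close>

theorem hausdorff_outer_lipschitz_image:
  fixes f :: "'a::metric_space \<Rightarrow> 'b::metric_space"
  assumes L: "L > 0" and lip: "\<And>x y. x \<in> A \<Longrightarrow> y \<in> A \<Longrightarrow> dist (f x) (f y) \<le> L * dist x y"
  shows "hausdorff_outer d (f ` A) \<le> ennreal (L ^ d) * hausdorff_outer d A"
  unfolding hausdorff_outer_def[of d "f ` A"]
proof (rule SUP_least)
  fix \<delta> :: real assume "\<delta> \<in> {0<..}"
  then have \<delta>: "\<delta> > 0" by simp
  let ?f = "\<lambda>D. ennreal (unit_ball_vol (real d) * (D / 2) ^ d)"
  have "hausdorff_pre d \<delta> (f ` A) \<le> ennreal (L ^ d) * hausdorff_pre d (\<delta> / L) A"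
  proof (rule ennreal_le_epsilon)
    fix e :: real assume e: "0 < e" and "ennreal (L ^ d) * hausdorff_pre d (\<delta> / L) A < top"
    then have fin: "hausdorff_pre d (\<delta> / L) A < top"
      using L by (auto simp: ennreal_mult_less_top)
    have Ld: "L ^ d > 0" using L by simp
    have "hausdorff_pre d (\<delta> / L) A < hausdorff_pre d (\<delta> / L) A + ennreal (e / L ^ d)"
      using fin e Ld by (auto simp: less_top)
    then obtain C where C: "A \<subseteq> (\<Union>i. C i)" "\<And>i. bounded (C i)" "\<And>i. diameter (C i) \<le> \<delta> / L"
      "(\<Sum>i. ?f (diameter (C i))) < hausdorff_pre d (\<delta> / L) A + ennreal (e / L ^ d)"
      using hausdorff_pre_close by blast
    \<comment> \<open>The covering sets are cut down to \<open>A\<close>, since the Lipschitz bound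
      holds only there.\<close>
    have dist: "dist x y \<le> L * diameter (C i)" if xy: "x \<in> f ` (A \<inter> C i)" "y \<in> f ` (A \<inter> C i)" for x y i
    proof -
      obtain u v where uv: "u \<in> A" "u \<in> C i" "v \<in> A" "v \<in> C i" "x = f u" "y = f v" using xy by auto
      then have "dist u v \<le> diameter (C i)" using C(2) by (intro diameter_bounded_bound) auto
      then have "L * dist u v \<le> L * diameter (C i)" using L by simp
      then show ?thesis using lip[OF uv(1,3)] uv by simp
    qed
    have bd: "bounded (f ` (A \<inter> C i))" for i
      unfolding bounded_any_center[of _ "SOME x. x \<in> f ` (A \<inter> C i)"]
      by (cases "A \<inter> C i = {}") (auto intro!: exI[of _ "L * diameter (C i)"] dist intro: someI)
    have di: "diameter (f ` (A \<inter> C i)) \<le> L * diameter (C i)" for i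
    proof (cases "A \<inter> C i = {}")
      case True then show ?thesis using L C(2)[of i] by (simp add: diameter_ge_0)
    next
      case False
      then have "diameter (f ` (A \<inter> C i)) = (SUP (x, y) \<in> f ` (A \<inter> C i) \<times> f ` (A \<inter> C i). dist x y)"
        by (simp add: diameter_def)
      also have "\<dots> \<le> L * diameter (C i)" using False by (intro cSUP_least) (use dist[of _ i] in auto)
      finally show ?thesis .
    qed
    have "hausdorff_pre d \<delta> (f ` A) \<le> (\<Sum>i. ?f (diameter (f ` (A \<inter> C i))))"
    proof (rule hausdorff_pre_le)
      show "f ` A \<subseteq> (\<Union>i. f ` (A \<inter> C i))" using C(1) by blast
      fix i
      have "L * diameter (C i) \<le> \<delta>" using C(3)[of i] L by (simp add: field_simps)
      then show "diameter (f ` (A \<inter> C i)) \<le> \<delta>" using di[of i] by linarith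
    qed (rule bd)
    also have "\<dots> \<le> (\<Sum>i. ennreal (L ^ d) * ?f (diameter (C i)))"
    proof (intro suminf_le)
      fix i
      have "(diameter (f ` (A \<inter> C i)) / 2) ^ d \<le> (L * diameter (C i) / 2) ^ d"
        using di[of i] bd[of i] by (intro power_mono) (auto simp: diameter_ge_0)
      also have "\<dots> = L ^ d * (diameter (C i) / 2) ^ d" by (simp add: power_mult_distrib power_divide)
      finally have "unit_ball_vol (real d) * (diameter (f ` (A \<inter> C i)) / 2) ^ d
          \<le> L ^ d * (unit_ball_vol (real d) * (diameter (C i) / 2) ^ d)"
        by (simp add: mult.left_commute mult_left_mono)
      then show "?f (diameter (f ` (A \<inter> C i))) \<le> ennreal (L ^ d) * ?f (diameter (C i))"
        using L C(2)[of i] by (subst ennreal_mult[symmetric]) (auto intro!: ennreal_leI mult_nonneg_nonneg simp: diameter_ge_0)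
    qed auto
    also have "\<dots> = ennreal (L ^ d) * (\<Sum>i. ?f (diameter (C i)))" by simp
    also have "\<dots> \<le> ennreal (L ^ d) * (hausdorff_pre d (\<delta> / L) A + ennreal (e / L ^ d))"
      by (intro mult_left_mono less_imp_le[OF C(4)]) auto
    also have "\<dots> = ennreal (L ^ d) * hausdorff_pre d (\<delta> / L) A + ennreal e"
      using Ld e L by (simp add: distrib_left ennreal_mult[symmetric])
    finally show "hausdorff_pre d \<delta> (f ` A) \<le> ennreal (L ^ d) * hausdorff_pre d (\<delta> / L) A + ennreal e" .
  qed
  also have "\<dots> \<le> ennreal (L ^ d) * hausdorff_outer d A"
    using \<delta> L by (intro mult_left_mono hausdorff_pre_le_outer) auto
  finally show "hausdorff_pre d \<delta> (f ` A) \<le> ennreal (L ^ d) * hausdorff_outer d A" .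
qed

subsection \<open>The Brunn--Minkowski and isodiametric inequalities\<close>

text \<open>Empty members are excluded so that every member has positive volume and
  \<open>card\<close> can serve as the induction measure.\<close>

definition open_box_family :: "'a::euclidean_space set set \<Rightarrow> bool" where
  "open_box_family \<A> \<longleftrightarrow> finite \<A> \<and> disjoint \<A> \<and> (\<forall>X\<in>\<A>. X \<noteq> {} \<and> (\<exists>a b. X = box a b))"

lemma open_box_family_Union:
  assumes "open_box_family \<A>"
  shows "open (\<Union>\<A>)" "bounded (\<Union>\<A>)" "\<Union>\<A> \<in> lmeasurable"
proof -
  show 1: "open (\<Union>\<A>)" using assms by (auto simp: open_box_family_def open_box intro!: open_Union)
  have "bounded X" if "X \<in> \<A>" for X
    using assms that unfolding open_box_family_def by (metis bounded_box)
  then show 2: "bounded (\<Union>\<A>)" using assms by (intro bounded_Union) (auto simp: open_box_family_def)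
  show "\<Union>\<A> \<in> lmeasurable" by (rule lmeasurable_open[OF 2 1])
qed

text \<open>\<open>H\<close> will be an open half-space bounded by a coordinate hyperplane. A box
  disjoint from it drops out of the family, which is the strict decrease that the induction
  needs.\<close>

lemma open_box_family_Int:
  assumes fam: "open_box_family \<A>" and H: "\<And>a b. \<exists>c d. box a b \<inter> H = box c d"
  defines "\<B> \<equiv> (\<lambda>X. X \<inter> H) ` \<A> - {{}}"
  shows "open_box_family \<B>" "\<Union>\<B> = \<Union>\<A> \<inter> H" "card \<B> \<le> card \<A>"
    "\<And>X. X \<in> \<A> \<Longrightarrow> X \<inter> H = {} \<Longrightarrow> card \<B> < card \<A>"
proof -
  have fin: "finite \<A>" and disj: "disjoint \<A>" and bx: "\<And>X. X \<in> \<A> \<Longrightarrow> \<exists>a b. X = box a b"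
    using fam by (auto simp: open_box_family_def)
  have "disjoint \<B>"
    unfolding pairwise_def
  proof (intro ballI impI)
    fix P Q assume "P \<in> \<B>" "Q \<in> \<B>" "P \<noteq> Q"
    then obtain X Y where XY: "X \<in> \<A>" "Y \<in> \<A>" "P = X \<inter> H" "Q = Y \<inter> H" "X \<noteq> Y" by (auto simp: \<B>_def)
    then have "disjnt X Y" using disj by (auto simp: pairwise_def)
    then show "disjnt P Q" using XY by (auto simp: disjnt_def)
  qed
  then show "open_box_family \<B>"
    unfolding open_box_family_def using fin
  proof (intro conjI ballI)
    fix X assume "X \<in> \<B>"
    then obtain Y where "Y \<in> \<A>" "X = Y \<inter> H" by (auto simp: \<B>_def)
    then show "\<exists>a b. X = box a b" using bx[of Y] H by metis
  qed (auto simp: \<B>_def)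
  show "\<Union>\<B> = \<Union>\<A> \<inter> H" by (auto simp: \<B>_def)
  have "card \<B> \<le> card ((\<lambda>X. X \<inter> H) ` \<A>)" unfolding \<B>_def using fin by (intro card_mono) auto
  also have "\<dots> \<le> card \<A>" by (rule card_image_le[OF fin])
  finally show "card \<B> \<le> card \<A>" .
  fix X assume X: "X \<in> \<A>" "X \<inter> H = {}"
  have "card \<B> \<le> card ((\<lambda>X. X \<inter> H) ` (\<A> - {X}))"
    using fin X(2) by (intro card_mono) (auto simp: \<B>_def)
  also have "\<dots> \<le> card (\<A> - {X})" using fin by (intro card_image_le) auto
  also have "\<dots> < card \<A>" using fin X(1) by (intro card_Diff1_less)
  finally show "card \<B> < card \<A>" .
qed

lemma box_Int_halfspace:
  fixes i :: "'a::euclidean_space"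
  assumes i: "i \<in> Basis"
  shows "\<exists>c d. box a b \<inter> {x. x \<bullet> i < t} = box c d" "\<exists>c d. box a b \<inter> {x. t < x \<bullet> i} = box c d"
proof -
  have "box a b \<inter> {x. x \<bullet> i < t} = box a (\<Sum>j\<in>Basis. (if j = i then min (b \<bullet> i) t else b \<bullet> j) *\<^sub>R j)"
    using i by (auto simp: mem_box split: if_splits)
  then show "\<exists>c d. box a b \<inter> {x. x \<bullet> i < t} = box c d" by blast
  have "box a b \<inter> {x. t < x \<bullet> i} = box (\<Sum>j\<in>Basis. (if j = i then max (a \<bullet> i) t else a \<bullet> j) *\<^sub>R j) b"
    using i by (auto simp: mem_box split: if_splits)
  then show "\<exists>c d. box a b \<inter> {x. t < x \<bullet> i} = box c d" by blast
qed

lemma measure_split_hyperplane: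
  fixes i :: "'a::euclidean_space"
  assumes "B \<in> lmeasurable" "i \<in> Basis"
  shows "measure lebesgue B = measure lebesgue (B \<inter> {x. x \<bullet> i < t}) + measure lebesgue (B \<inter> {x. t < x \<bullet> i})"
proof -
  have m: "B \<inter> {x. x \<bullet> i < t} \<in> lmeasurable" "B \<inter> {x. t < x \<bullet> i} \<in> lmeasurable"
    using assms(1) by (auto intro!: fmeasurable_Int_fmeasurable borel_open open_halfspace_component_lt open_halfspace_component_gt
        lebesgue_measurable_vimage_borel)
  have "measure lebesgue (B \<inter> {x. x \<bullet> i < t}) + measure lebesgue (B \<inter> {x. t < x \<bullet> i})
      = measure lebesgue (B \<inter> {x. x \<bullet> i < t} \<union> B \<inter> {x. t < x \<bullet> i})"
  proof -
    have "B \<inter> {x. x \<bullet> i < t} \<inter> (B \<inter> {x. t < x \<bullet> i}) = {}" by auto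
    then show ?thesis using measure_Un3[OF m] by simp
  qed
  also have "\<dots> = measure lebesgue B"
  proof (rule measure_negligible_symdiff)
    show "B \<in> lmeasurable" by fact
    have "negligible {x. i \<bullet> x = t}" using assms(2) by (intro negligible_hyperplane) auto
    then show "negligible ((B - (B \<inter> {x. x \<bullet> i < t} \<union> B \<inter> {x. t < x \<bullet> i})) \<union> ((B \<inter> {x. x \<bullet> i < t} \<union> B \<inter> {x. t < x \<bullet> i}) - B))"
      by (rule negligible_subset) (auto simp: inner_commute)
  qed
  finally show ?thesis by simp
qed

text \<open>Intermediate value theorem for the volume below height \<open>t\<close>. It is
  continuous because an increment lies in a thin slab of a fixed cube, whose content tends to
  0.\<close>

lemma halfspace_measure_fraction:
  fixes i :: "'a::euclidean_space"
  assumes B: "B \<in> lmeasurable" "bounded B" and i: "i \<in> Basis" and l: "0 \<le> l" "l \<le> 1"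
  obtains t where "measure lebesgue (B \<inter> {x. x \<bullet> i < t}) = l * measure lebesgue B"
proof -
  define f where "f t = measure lebesgue (B \<inter> {x. x \<bullet> i < t})" for t
  have m: "B \<inter> {x. x \<bullet> i < t} \<in> lmeasurable" for t
    using B(1) by (auto intro!: fmeasurable_Int_fmeasurable borel_open open_halfspace_component_lt)
  obtain a where a: "B \<subseteq> cbox (-a) a" using bounded_subset_cbox_symmetric[OF B(2)] by blast
  have mono: "f s \<le> f t" if "s \<le> t" for s t
    unfolding f_def using that m by (intro measure_mono_fmeasurable) auto
  have cont: "continuous_on UNIV f"
  proof (rule continuous_at_imp_continuous_on, clarify, unfold continuous_at_eps_delta, intro allI impI)
    fix s e :: real assume "e > 0"
    then obtain d where d: "d > 0" "measure lborel (cbox (-a) a \<inter> {x. \<bar>x \<bullet> i - s\<bar> \<le> d}) < e"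
      using content_doublesplit[OF _ i] by metis
    have D: "cbox (-a) a \<inter> {x. \<bar>x \<bullet> i - s\<bar> \<le> d} \<in> lmeasurable"
      by (simp add: interval_doublesplit[OF i])
    have "f t - f u < e" if "u \<le> t" "s - d \<le> u" "t \<le> s + d" for u t
    proof -
      have "f t \<le> measure lebesgue ((B \<inter> {x. x \<bullet> i < u}) \<union> (cbox (-a) a \<inter> {x. \<bar>x \<bullet> i - s\<bar> \<le> d}))"
        unfolding f_def using m D a that by (intro measure_mono_fmeasurable fmeasurable.Un) auto
      also have "\<dots> \<le> f u + measure lebesgue (cbox (-a) a \<inter> {x. \<bar>x \<bullet> i - s\<bar> \<le> d})"
        unfolding f_def using m D by (intro measure_Un_le) auto
      also have "measure lebesgue (cbox (-a) a \<inter> {x. \<bar>x \<bullet> i - s\<bar> \<le> d}) < e"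
        using d(2) by (simp add: interval_doublesplit[OF i])
      finally show ?thesis by simp
    qed note * = this
    have "\<bar>f t - f s\<bar> < e" if "\<bar>t - s\<bar> < d" for t
      using *[of s t] *[of t s] mono[of s t] mono[of t s] that d(1) by (cases "s \<le> t") auto
    then show "\<exists>d>0. \<forall>x'. dist x' s < d \<longrightarrow> dist (f x') (f s) < e" using d(1) by (auto simp: dist_real_def)
  qed
  have lo: "f (- (a \<bullet> i)) = 0"
  proof -
    have "B \<inter> {x. x \<bullet> i < - (a \<bullet> i)} = {}" using a i by (force simp: mem_box)
    then show ?thesis by (simp add: f_def)
  qed
  have hi: "f (a \<bullet> i + 1) = measure lebesgue B"
  proof -
    have "B \<inter> {x. x \<bullet> i < a \<bullet> i + 1} = B" using a i by (force simp: mem_box)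
    then show ?thesis by (simp add: f_def)
  qed
  have "\<exists>t. f t = l * measure lebesgue B"
  proof (cases "B = {}")
    case True then show ?thesis by (auto simp: f_def)
  next
    case False
    then have "-(a \<bullet> i) \<le> a \<bullet> i + 1" using a i by (force simp: mem_box)
    moreover have "l * measure lebesgue B \<le> measure lebesgue B" using l by (simp add: mult_left_le_one_le)
    ultimately show ?thesis
      using IVT'[of f "-(a \<bullet> i)" "l * measure lebesgue B" "a \<bullet> i + 1"] lo hi l continuous_on_subset[OF cont]
      by auto
  qed
  then show ?thesis using that by (auto simp: f_def)
qed

lemma open_sums_lmeasurable:
  fixes A B :: "'a::euclidean_space set"
  assumes "open A" "bounded A" "bounded B"
  shows "(\<Union>x\<in>A. \<Union>y\<in>B. {x + y}) \<in> lmeasurable"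
  using assms by (intro lmeasurable_open open_sums bounded_sums) auto

lemma sqrt_prod: "sqrt (\<Prod>i\<in>I. f i) = (\<Prod>i\<in>I. sqrt (f i))"
  by (induction I rule: infinite_finite_induct) (auto simp: real_sqrt_mult)

text \<open>Coordinate by coordinate this is the inequality between arithmetic and geometric mean of
  two side lengths. The product form is weaker than superadditivity of the \<open>DIM('a)\<close>-th
  roots, but it agrees with it when both volumes are equal, as they are for \<open>S\<close> and
  \<open>- S\<close>.\<close>

lemma brunn_minkowski_box:
  fixes a b c d :: "'a::euclidean_space"
  assumes "box a b \<noteq> {}" "box c d \<noteq> {}"
  shows "2 ^ DIM('a) * sqrt (measure lebesgue (box a b) * measure lebesgue (box c d))
     \<le> measure lebesgue (\<Union>x\<in>box a b. \<Union>y\<in>box c d. {x + y})"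
proof -
  have ab: "a \<bullet> i < b \<bullet> i" "c \<bullet> i < d \<bullet> i" if "i \<in> Basis" for i using assms that by (auto simp: box_ne_empty)
  have sub: "box (a + c) (b + d) \<subseteq> (\<Union>x\<in>box a b. \<Union>y\<in>box c d. {x + y})"
  proof
    fix z assume z: "z \<in> box (a + c) (b + d)"
    \<comment> \<open>\<open>l i\<close> is the relative position of \<open>z\<close> in the
      \<open>i\<close>-th side of the sum box; each summand takes the same relative position in its
      own side.\<close>
    define l where "l i = (z \<bullet> i - a \<bullet> i - c \<bullet> i) / (b \<bullet> i + d \<bullet> i - a \<bullet> i - c \<bullet> i)" for i
    define x where "x = (\<Sum>i\<in>Basis. (a \<bullet> i + l i * (b \<bullet> i - a \<bullet> i)) *\<^sub>R i)"
    have l: "0 < l i" "l i < 1" if "i \<in> Basis" for i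
      using z ab[OF that] that by (auto simp: l_def mem_box inner_add_left field_simps)
    have xi: "x \<bullet> i = a \<bullet> i + l i * (b \<bullet> i - a \<bullet> i)" if "i \<in> Basis" for i using that by (simp add: x_def)
    have zi: "z \<bullet> i - x \<bullet> i = c \<bullet> i + l i * (d \<bullet> i - c \<bullet> i)" if "i \<in> Basis" for i
    proof -
      have "l i * (b \<bullet> i + d \<bullet> i - a \<bullet> i - c \<bullet> i) = z \<bullet> i - a \<bullet> i - c \<bullet> i"
        using ab[OF that] by (simp add: l_def)
      then show ?thesis unfolding xi[OF that] by (simp add: algebra_simps)
    qed
    have mid: "u < u + s * (v - u)" "u + s * (v - u) < v" if "u < v" "0 < s" "s < 1" for u v s :: real
    proof -
      show "u < u + s * (v - u)" using that by simp
      have "s * (v - u) < 1 * (v - u)" using that by (intro mult_strict_right_mono) auto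
      then show "u + s * (v - u) < v" by simp
    qed
    have "x \<in> box a b" using xi mid ab l by (auto simp: mem_box)
    moreover have "z - x \<in> box c d" using zi mid ab l by (auto simp: mem_box inner_diff_left)
    ultimately show "z \<in> (\<Union>x\<in>box a b. \<Union>y\<in>box c d. {x + y})"
      by (intro UN_I[of x] UN_I[of "z - x"]) auto
  qed
  have "measure lebesgue (box a b) * measure lebesgue (box c d) = (\<Prod>i\<in>Basis. ((b - a) \<bullet> i) * ((d - c) \<bullet> i))"
    using ab by (simp add: measure_lborel_box_eq less_imp_le prod.distrib)
  then have "sqrt (measure lebesgue (box a b) * measure lebesgue (box c d)) = (\<Prod>i\<in>Basis. sqrt (((b - a) \<bullet> i) * ((d - c) \<bullet> i)))"
    by (simp only: sqrt_prod)
  then have "2 ^ DIM('a) * sqrt (measure lebesgue (box a b) * measure lebesgue (box c d))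
      = (\<Prod>i\<in>(Basis::'a set). 2 * sqrt (((b - a) \<bullet> i) * ((d - c) \<bullet> i)))"
    by (simp add: prod.distrib)
  also have "\<dots> \<le> (\<Prod>i\<in>Basis. ((b + d) - (a + c)) \<bullet> i)"
  proof (rule prod_mono)
    fix i :: 'a assume i: "i \<in> Basis"
    have "sqrt (((b - a) \<bullet> i) * ((d - c) \<bullet> i)) \<le> ((b - a) \<bullet> i + (d - c) \<bullet> i) / 2"
      using ab[OF i] by (intro arith_geo_mean_sqrt) (auto simp: inner_diff_left)
    then show "0 \<le> 2 * sqrt (((b - a) \<bullet> i) * ((d - c) \<bullet> i)) \<and>
         2 * sqrt (((b - a) \<bullet> i) * ((d - c) \<bullet> i)) \<le> ((b + d) - (a + c)) \<bullet> i"
      using ab[OF i] by (auto simp: inner_diff_left inner_add_left intro!: mult_nonneg_nonneg)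
  qed
  also have "\<dots> = measure lebesgue (box (a + c) (b + d))"
    using ab by (simp add: measure_lborel_box_eq less_imp_le inner_add_left add_mono)
  also have "\<dots> \<le> measure lebesgue (\<Union>x\<in>box a b. \<Union>y\<in>box c d. {x + y})"
    using sub by (intro measure_mono_fmeasurable open_sums_lmeasurable) (auto simp: open_box)
  finally show ?thesis .
qed

text \<open>Because both unions are cut in the same proportion \<open>l\<close>, the two new square
  roots are \<open>l\<close> and \<open>1 - l\<close> times the old one and nothing is lost. Sums of
  matching halves lie on opposite sides of the hyperplane at height \<open>t + s\<close>, so their
  volumes add.\<close>

lemma brunn_minkowski_step:
  fixes \<A> \<B> :: "'a::euclidean_space set set"
  assumes \<A>: "open_box_family \<A>" and \<B>: "open_box_family \<B>" "\<B> \<noteq> {}" and card: "card \<A> \<ge> 2"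
    and IH: "\<And>\<A>' \<B>' :: 'a set set. open_box_family \<A>' \<Longrightarrow> open_box_family \<B>' \<Longrightarrow> \<A>' \<noteq> {} \<Longrightarrow> \<B>' \<noteq> {} \<Longrightarrow>
       card \<A>' + card \<B>' < card \<A> + card \<B> \<Longrightarrow>
       2 ^ DIM('a) * sqrt (measure lebesgue (\<Union>\<A>') * measure lebesgue (\<Union>\<B>'))
         \<le> measure lebesgue (\<Union>x\<in>\<Union>\<A>'. \<Union>y\<in>\<Union>\<B>'. {x + y})"
  shows "2 ^ DIM('a) * sqrt (measure lebesgue (\<Union>\<A>) * measure lebesgue (\<Union>\<B>))
         \<le> measure lebesgue (\<Union>x\<in>\<Union>\<A>. \<Union>y\<in>\<Union>\<B>. {x + y})"
proof -
  obtain P Q where PQ: "P \<in> \<A>" "Q \<in> \<A>" "P \<noteq> Q"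
  proof -
    have "finite \<A>" using \<A> by (simp add: open_box_family_def)
    moreover have "\<not> card \<A> \<le> Suc 0" using card by simp
    ultimately show ?thesis using that by (auto simp: card_le_Suc0_iff_eq)
  qed
  \<comment> \<open>Disjoint nonempty open boxes are separated by a coordinate hyperplane. Each half
    of the family loses the box on the other side, so both halves have fewer members.\<close>
  have "\<exists>i\<in>Basis. \<exists>t. \<exists>X\<in>\<A>. \<exists>Y\<in>\<A>. X \<subseteq> {x. x \<bullet> i < t} \<and> Y \<subseteq> {x. t < x \<bullet> i}"
  proof -
    obtain a b c d where ab: "P = box a b" "Q = box c d" "P \<noteq> {}" "Q \<noteq> {}"
      using \<A> PQ unfolding open_box_family_def by metis
    have "P \<inter> Q = {}" using \<A> PQ by (auto simp: open_box_family_def pairwise_def disjnt_def)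
    then obtain i where i: "i \<in> Basis" "b \<bullet> i \<le> c \<bullet> i \<or> d \<bullet> i \<le> a \<bullet> i"
      using ab by (auto simp: disjoint_interval box_ne_empty not_le[symmetric])
    from i(2) show ?thesis
    proof
      assume "b \<bullet> i \<le> c \<bullet> i"
      then have "P \<subseteq> {x. x \<bullet> i < b \<bullet> i}" "Q \<subseteq> {x. b \<bullet> i < x \<bullet> i}"
        unfolding ab using i(1) by (force simp: mem_box)+
      then show ?thesis using PQ i(1) by blast
    next
      assume "d \<bullet> i \<le> a \<bullet> i"
      then have "Q \<subseteq> {x. x \<bullet> i < d \<bullet> i}" "P \<subseteq> {x. d \<bullet> i < x \<bullet> i}"
        unfolding ab using i(1) by (force simp: mem_box)+
      then show ?thesis using PQ i(1) by blast
    qed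
  qed
  then obtain i t X Y where i: "i \<in> Basis" and XY: "X \<in> \<A>" "Y \<in> \<A>" "X \<subseteq> {x. x \<bullet> i < t}" "Y \<subseteq> {x. t < x \<bullet> i}"
    by blast
  let ?m = "measure lebesgue"
  let ?L = "\<lambda>t. {x. x \<bullet> i < t}" and ?R = "\<lambda>t. {x. t < x \<bullet> i}"
  let ?S = "\<lambda>A B. \<Union>x\<in>A. \<Union>y\<in>B. {x + y::'a}"
  define A where "A = \<Union>\<A>"
  define B where "B = \<Union>\<B>"
  note opA = open_box_family_Union[OF \<A>, folded A_def] and opB = open_box_family_Union[OF \<B>(1), folded B_def]
  have pos: "?m Z > 0" if "Z \<in> lmeasurable" "open W" "W \<noteq> {}" "W \<subseteq> Z" for W Z :: "'a set"
  proof -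
    have "\<not> negligible Z" using that negligible_subset open_not_negligible by blast
    then show ?thesis using that(1) by (simp add: negligible_iff_measure zero_less_measure_iff)
  qed
  have ne: "X \<noteq> {}" "Y \<noteq> {}" "open X" "open Y"
    using XY \<A> open_box unfolding open_box_family_def by metis+
  have LR: "open (?L u)" "open (?R u)" for u
    by (auto simp: open_halfspace_component_lt open_halfspace_component_gt)
  have hm: "Z \<inter> ?L u \<in> lmeasurable" "Z \<inter> ?R u \<in> lmeasurable" if "Z \<in> lmeasurable" for Z u
    using that LR by (auto intro!: fmeasurable_Int_fmeasurable borel_open)
  have mA: "?m A = ?m (A \<inter> ?L t) + ?m (A \<inter> ?R t)" by (rule measure_split_hyperplane[OF opA(3) i])
  have posA: "?m (A \<inter> ?L t) > 0" "?m (A \<inter> ?R t) > 0"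
  proof -
    show "?m (A \<inter> ?L t) > 0" by (rule pos[OF hm(1)[OF opA(3)] ne(3,1)]) (use XY in \<open>auto simp: A_def\<close>)
    show "?m (A \<inter> ?R t) > 0" by (rule pos[OF hm(2)[OF opA(3)] ne(4,2)]) (use XY in \<open>auto simp: A_def\<close>)
  qed
  obtain W where "W \<in> \<B>" using \<B>(2) by auto
  then have posB: "?m B > 0"
    using \<B>(1) open_box unfolding open_box_family_def
    by (intro pos[OF opB(3), of W]) (auto simp: B_def)
  define l where "l = ?m (A \<inter> ?L t) / ?m A"
  have l: "0 < l" "l < 1" using mA posA by (auto simp: l_def)
  obtain s where s: "?m (B \<inter> ?L s) = l * ?m B"
    using halfspace_measure_fraction[OF opB(3,2) i, of l] l by auto
  have s': "?m (B \<inter> ?R s) = (1 - l) * ?m B"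
    using measure_split_hyperplane[OF opB(3) i, of s] s by (simp add: algebra_simps)
  have lA: "?m (A \<inter> ?L t) = l * ?m A" "?m (A \<inter> ?R t) = (1 - l) * ?m A"
    using mA posA by (auto simp: l_def field_simps)
  note fL = open_box_family_Int[OF \<A> box_Int_halfspace(1)[OF i, of _ _ t]]
  note fR = open_box_family_Int[OF \<A> box_Int_halfspace(2)[OF i, of _ _ t]]
  note gL = open_box_family_Int[OF \<B>(1) box_Int_halfspace(1)[OF i, of _ _ s]]
  note gR = open_box_family_Int[OF \<B>(1) box_Int_halfspace(2)[OF i, of _ _ s]]
  have IL: "2 ^ DIM('a) * sqrt (?m (A \<inter> ?L t) * ?m (B \<inter> ?L s)) \<le> ?m (?S (A \<inter> ?L t) (B \<inter> ?L s))"
  proof -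
    have "card ((\<lambda>X. X \<inter> ?L t) ` \<A> - {{}}) < card \<A>"
      by (rule fL(4)[OF XY(2)]) (use XY in auto)
    then have "card ((\<lambda>X. X \<inter> ?L t) ` \<A> - {{}}) + card ((\<lambda>X. X \<inter> ?L s) ` \<B> - {{}}) < card \<A> + card \<B>"
      using gL(3) by linarith
    moreover have "(\<lambda>X. X \<inter> ?L t) ` \<A> - {{}} \<noteq> {}" "(\<lambda>X. X \<inter> ?L s) ` \<B> - {{}} \<noteq> {}"
    proof -
      have "\<Union>((\<lambda>X. X \<inter> ?L t) ` \<A> - {{}}) \<noteq> {}" "\<Union>((\<lambda>X. X \<inter> ?L s) ` \<B> - {{}}) \<noteq> {}"
        unfolding fL(2) gL(2) using posA(1) s l(1) posB unfolding A_def B_def by (metis measure_empty less_irrefl mult_pos_pos)+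
      then show "(\<lambda>X. X \<inter> ?L t) ` \<A> - {{}} \<noteq> {}" "(\<lambda>X. X \<inter> ?L s) ` \<B> - {{}} \<noteq> {}" by (metis Union_empty)+
    qed
    ultimately show ?thesis using IH[OF fL(1) gL(1)] unfolding fL(2) gL(2) A_def B_def by blast
  qed
  have IR: "2 ^ DIM('a) * sqrt (?m (A \<inter> ?R t) * ?m (B \<inter> ?R s)) \<le> ?m (?S (A \<inter> ?R t) (B \<inter> ?R s))"
  proof -
    have "card ((\<lambda>X. X \<inter> ?R t) ` \<A> - {{}}) < card \<A>"
      by (rule fR(4)[OF XY(1)]) (use XY in auto)
    then have "card ((\<lambda>X. X \<inter> ?R t) ` \<A> - {{}}) + card ((\<lambda>X. X \<inter> ?R s) ` \<B> - {{}}) < card \<A> + card \<B>"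
      using gR(3) by linarith
    moreover have "(\<lambda>X. X \<inter> ?R t) ` \<A> - {{}} \<noteq> {}" "(\<lambda>X. X \<inter> ?R s) ` \<B> - {{}} \<noteq> {}"
    proof -
      have "1 - l > 0" using l by simp
      then have "\<Union>((\<lambda>X. X \<inter> ?R t) ` \<A> - {{}}) \<noteq> {}" "\<Union>((\<lambda>X. X \<inter> ?R s) ` \<B> - {{}}) \<noteq> {}"
        unfolding fR(2) gR(2) using posA(2) s' posB unfolding A_def B_def by (metis measure_empty less_irrefl mult_pos_pos)+
      then show "(\<lambda>X. X \<inter> ?R t) ` \<A> - {{}} \<noteq> {}" "(\<lambda>X. X \<inter> ?R s) ` \<B> - {{}} \<noteq> {}" by (metis Union_empty)+
    qed
    ultimately show ?thesis using IH[OF fR(1) gR(1)] unfolding fR(2) gR(2) A_def B_def by blast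
  qed
  have SL: "?S (A \<inter> ?L t) (B \<inter> ?L s) \<in> lmeasurable" "?S (A \<inter> ?R t) (B \<inter> ?R s) \<in> lmeasurable"
    by (intro open_sums_lmeasurable open_Int opA LR bounded_subset[OF opA(2)] bounded_subset[OF opB(2)] Int_lower1)+
  have "2 ^ DIM('a) * sqrt (?m A * ?m B)
      = 2 ^ DIM('a) * sqrt (?m (A \<inter> ?L t) * ?m (B \<inter> ?L s)) + 2 ^ DIM('a) * sqrt (?m (A \<inter> ?R t) * ?m (B \<inter> ?R s))"
  proof -
    have 1: "sqrt (?m (A \<inter> ?L t) * ?m (B \<inter> ?L s)) = l * sqrt (?m A * ?m B)"
      unfolding lA s using l by (simp add: real_sqrt_mult)
    have 2: "sqrt (?m (A \<inter> ?R t) * ?m (B \<inter> ?R s)) = (1 - l) * sqrt (?m A * ?m B)"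
      unfolding lA s' using l by (simp add: real_sqrt_mult)
    show ?thesis unfolding 1 2 by (simp add: algebra_simps)
  qed
  also have "\<dots> \<le> ?m (?S (A \<inter> ?L t) (B \<inter> ?L s)) + ?m (?S (A \<inter> ?R t) (B \<inter> ?R s))"
    using IL IR by (rule add_mono)
  also have "\<dots> = ?m (?S (A \<inter> ?L t) (B \<inter> ?L s) \<union> ?S (A \<inter> ?R t) (B \<inter> ?R s))"
  proof (rule measure_Un3[THEN trans, symmetric])
    have "?S (A \<inter> ?L t) (B \<inter> ?L s) \<inter> ?S (A \<inter> ?R t) (B \<inter> ?R s) = {}"
    proof -
      have "z \<bullet> i < t + s" if "z \<in> ?S (A \<inter> ?L t) (B \<inter> ?L s)" for z using that by (auto simp: inner_add_left)
      moreover have "z \<bullet> i > t + s" if "z \<in> ?S (A \<inter> ?R t) (B \<inter> ?R s)" for z using that by (auto simp: inner_add_left)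
      ultimately show ?thesis by (meson disjoint_iff less_asym)
    qed
    then show "?m (?S (A \<inter> ?L t) (B \<inter> ?L s)) + ?m (?S (A \<inter> ?R t) (B \<inter> ?R s)) - ?m (?S (A \<inter> ?L t) (B \<inter> ?L s) \<inter> ?S (A \<inter> ?R t) (B \<inter> ?R s))
      = ?m (?S (A \<inter> ?L t) (B \<inter> ?L s)) + ?m (?S (A \<inter> ?R t) (B \<inter> ?R s))" by simp
  qed (rule SL)+
  also have "\<dots> \<le> ?m (?S A B)"
    using SL opA opB by (intro measure_mono_fmeasurable open_sums_lmeasurable) auto
  finally show ?thesis unfolding A_def B_def .
qed

text \<open>Hadwiger and Ohmann's argument: a hyperplane separates two members of one family, a parallel
  one divides the other family in the same proportion, and both pairs of halves have fewer members.\<close>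

theorem brunn_minkowski_open_box_family:
  fixes \<A> \<B> :: "'a::euclidean_space set set"
  assumes "open_box_family \<A>" "open_box_family \<B>" "\<A> \<noteq> {}" "\<B> \<noteq> {}"
  shows "2 ^ DIM('a) * sqrt (measure lebesgue (\<Union>\<A>) * measure lebesgue (\<Union>\<B>))
         \<le> measure lebesgue (\<Union>x\<in>\<Union>\<A>. \<Union>y\<in>\<Union>\<B>. {x + y})"
  using assms
proof (induction "card \<A> + card \<B>" arbitrary: \<A> \<B> rule: less_induct)
  case less
  have fin: "finite \<A>" "finite \<B>" using less.prems by (auto simp: open_box_family_def)
  have swap: "(\<Union>x\<in>A. \<Union>y\<in>B. {x + y}) = (\<Union>x\<in>B. \<Union>y\<in>A. {x + y})" for A B :: "'a set"
    by (auto; metis add.commute)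
  consider "card \<A> \<ge> 2" | "card \<B> \<ge> 2" | "card \<A> = 1" "card \<B> = 1"
    using fin less.prems by (metis One_nat_def Suc_1 card_0_eq le_SucE not_less_eq_eq zero_less_Suc le_zero_eq nat_le_linear)
  then show ?case
  proof cases
    case 1
    show ?thesis by (rule brunn_minkowski_step[OF less.prems(1,2,4) 1 less.hyps]) auto
  next
    case 2
    have "2 ^ DIM('a) * sqrt (measure lebesgue (\<Union>\<B>) * measure lebesgue (\<Union>\<A>))
         \<le> measure lebesgue (\<Union>x\<in>\<Union>\<B>. \<Union>y\<in>\<Union>\<A>. {x + y})"
      by (rule brunn_minkowski_step[OF less.prems(2,1,3) 2]) (rule less.hyps, auto)
    then show ?thesis by (subst swap) (simp add: mult.commute)
  next
    case 3
    then obtain X Y where XY: "\<A> = {X}" "\<B> = {Y}" by (auto simp: card_1_singleton_iff)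
    then obtain a b c d where "X = box a b" "Y = box c d" "X \<noteq> {}" "Y \<noteq> {}"
      using less.prems(1,2) unfolding open_box_family_def by auto
    then show ?thesis using brunn_minkowski_box[of a b c d] XY by simp
  qed
qed

section \<open>The isodiametric inequality\<close>

text \<open>Brunn-Minkowski for \<open>S\<close> and \<open>- S\<close>, which have equal volume,
  bounds \<open>2 ^ DIM('a)\<close> times the volume of \<open>S\<close> by that of the difference
  set, and this set lies in the ball of radius \<open>diameter S\<close>. Unions of boxes within
  distance \<open>e\<close> of points of \<open>S\<close> stand in for \<open>S\<close>, which
  enlarges the radius to \<open>diameter S + 2 * e\<close>.\<close>

theorem isodiametric_inequality:
  fixes S :: "'a::euclidean_space set"
  assumes S: "compact S"
  shows "measure lebesgue S \<le> unit_ball_vol DIM('a) * (diameter S / 2) ^ DIM('a)"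
proof -
  let ?m = "measure lebesgue"
  let ?D = "diameter S"
  have bd: "bounded S" using S compact_imp_bounded by blast
  have D0: "?D \<ge> 0" using bd by (rule diameter_ge_0)
  obtain a where a: "S \<subseteq> box (-a) a" using bounded_subset_box_symmetric[OF bd] by blast
  define b where "b = a + (\<Sum>i\<in>Basis. (\<bar>a \<bullet> i\<bar> + 1) *\<^sub>R i)"
  have bb: "S \<subseteq> cbox (-b) b" "box (-b) b \<noteq> {}"
  proof -
    have bi: "b \<bullet> i = a \<bullet> i + \<bar>a \<bullet> i\<bar> + 1" if "i \<in> Basis" for i using that by (simp add: b_def inner_add_left)
    show "box (-b) b \<noteq> {}" using bi by (auto simp: box_ne_empty)
    have "box (-a) a \<subseteq> cbox (-b) b" using bi by (intro subsetI) (force simp: mem_box)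
    then show "S \<subseteq> cbox (-b) b" using a by blast
  qed
  have step: "?m S \<le> unit_ball_vol DIM('a) * ((?D + 2 * e) / 2) ^ DIM('a)" if e: "e > 0" for e
  proof -
    have "gauge (\<lambda>x. ball x e)" using e by (auto simp: gauge_def)
    from covering_lemma[OF bb this]
    obtain \<D> where \<D>: "countable \<D>" "\<Union>\<D> \<subseteq> cbox (-b) b"
      "\<And>K. K \<in> \<D> \<Longrightarrow> interior K \<noteq> {} \<and> (\<exists>c d. K = cbox c d)"
      "pairwise (\<lambda>A B. interior A \<inter> interior B = {}) \<D>"
      "\<And>K. K \<in> \<D> \<Longrightarrow> \<exists>x \<in> S \<inter> K. K \<subseteq> ball x e" "S \<subseteq> \<Union>\<D>"
      by metis
    \<comment> \<open>Brunn-Minkowski is at hand for finite families only; the bound does not depend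
      on \<open>F\<close>, so it passes to the countable union.\<close>
    have bound: "?m (\<Union>F) \<le> unit_ball_vol DIM('a) * ((?D + 2 * e) / 2) ^ DIM('a)" if F: "F \<subseteq> \<D>" "finite F" for F
    proof (cases "F = {}")
      case True then show ?thesis using D0 e by simp
    next
      case False
      define \<A> where "\<A> = interior ` F"
      define \<B> where "\<B> = (`) uminus ` \<A>"
      have fam: "open_box_family \<A>"
        unfolding open_box_family_def
      proof (intro conjI ballI)
        show "finite \<A>" using F by (simp add: \<A>_def)
        show "disjoint \<A>"
          unfolding \<A>_def pairwise_def
        proof (intro ballI impI)
          fix P Q assume "P \<in> interior ` F" "Q \<in> interior ` F" "P \<noteq> Q"
          then obtain X Y where XY: "X \<in> F" "Y \<in> F" "P = interior X" "Q = interior Y" "X \<noteq> Y" by auto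
          then have "interior X \<inter> interior Y = {}" using \<D>(4) F(1) by (auto simp: pairwise_def)
          then show "disjnt P Q" using XY by (simp add: disjnt_def)
        qed
        fix X assume "X \<in> \<A>"
        then obtain K where K: "K \<in> F" "X = interior K" by (auto simp: \<A>_def)
        then show "X \<noteq> {}" using \<D>(3) F by blast
        obtain c d where "K = cbox c d" using \<D>(3) K F by blast
        then show "\<exists>a b. X = box a b" using K by (auto simp: interior_cbox)
      qed
      have fam': "open_box_family \<B>"
        unfolding open_box_family_def
      proof (intro conjI ballI)
        show "finite \<B>" using fam by (simp add: \<B>_def open_box_family_def)
        show "disjoint \<B>"
          unfolding pairwise_def
        proof (intro ballI impI)
          fix P Q assume "P \<in> \<B>" "Q \<in> \<B>" "P \<noteq> Q"
          then obtain X Y where XY: "X \<in> \<A>" "Y \<in> \<A>" "P = uminus ` X" "Q = uminus ` Y" "X \<noteq> Y" by (auto simp: \<B>_def)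
          then have "X \<inter> Y = {}" using fam by (auto simp: open_box_family_def pairwise_def disjnt_def)
          then show "disjnt P Q" using XY by (auto simp: disjnt_def)
        qed
        fix X assume "X \<in> \<B>"
        then obtain Y where Y: "Y \<in> \<A>" "X = uminus ` Y" by (auto simp: \<B>_def)
        then obtain c d where X: "X = uminus ` box c d" "box c d \<noteq> {}"
          using fam unfolding open_box_family_def by metis
        then show "X \<noteq> {}" by simp
        have "uminus ` box c d = box (-d) (-c)"
          by (auto simp: mem_box intro!: image_eqI[of _ uminus "- _"]) (auto simp: mem_box)
        then show "\<exists>a b. X = box a b" using X by blast
      qed
      define T where "T = \<Union>\<A>"
      have T': "\<Union>\<B> = uminus ` T" by (auto simp: \<B>_def T_def)
      have mT': "?m (uminus ` T) = ?m T"
        using measure_lebesgue_affine[of "-1" 0 T] by (simp add: image_comp comp_def)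
      \<comment> \<open>Passing to interiors makes the boxes open and disjoint; it costs only their
        boundaries, a negligible set.\<close>
      have FT: "?m (\<Union>F) \<le> ?m T"
      proof -
        have neg: "negligible (\<Union>K\<in>F. K - interior K)"
        proof (rule negligible_Union, use F in simp, clarify)
          fix K assume "K \<in> F"
          then obtain c d where "K = cbox c d" using \<D>(3) F by blast
          then show "negligible (K - interior K)" using negligible_frontier_interval[of c d] by (simp add: interior_cbox)
        qed
        have T: "T \<in> lmeasurable" unfolding T_def by (rule open_box_family_Union(3)[OF fam])
        have "\<Union>F \<in> lmeasurable" using F \<D>(3) by (intro fmeasurable.finite_Union) (use lmeasurable_cbox in blast)+
        then have "?m (\<Union>F) \<le> ?m (T \<union> (\<Union>K\<in>F. K - interior K))"
          using T neg by (intro measure_mono_fmeasurable fmeasurable.Un) (auto simp: T_def \<A>_def negligible_iff_measure)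
        also have "\<dots> \<le> ?m T + ?m (\<Union>K\<in>F. K - interior K)"
          using T neg by (intro measure_Un_le) (auto simp: negligible_iff_measure)
        finally show ?thesis using neg by (simp add: negligible_iff_measure)
      qed
      have "2 ^ DIM('a) * sqrt (?m T * ?m T) \<le> ?m (\<Union>x\<in>T. \<Union>y\<in>uminus ` T. {x + y})"
        using brunn_minkowski_open_box_family[OF fam fam'] False mT' unfolding T'[symmetric]
        unfolding T_def by (simp add: \<A>_def \<B>_def)
      also have "\<dots> \<le> ?m (cball (0::'a) (?D + 2 * e))"
      proof (intro measure_mono_fmeasurable)
        show "(\<Union>x\<in>T. \<Union>y\<in>uminus ` T. {x + y}) \<subseteq> cball 0 (?D + 2 * e)"
        proof -
          have "norm (x - y) \<le> ?D + 2 * e" if "x \<in> T" "y \<in> T" for x y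
        proof -
          obtain K L where KL: "K \<in> F" "x \<in> interior K" "L \<in> F" "y \<in> interior L"
            using \<open>x \<in> T\<close> \<open>y \<in> T\<close> unfolding T_def \<A>_def by blast
          obtain p where p: "p \<in> S" "K \<subseteq> ball p e" using \<D>(5)[of K] KL F by auto
          obtain q where q: "q \<in> S" "L \<subseteq> ball q e" using \<D>(5)[of L] KL F by auto
          have xy: "dist p x < e" "dist q y < e"
            using p q KL interior_subset[of K] interior_subset[of L] by auto
          have "dist p q \<le> ?D" using bd p q by (intro diameter_bounded_bound)
          moreover have "dist x y \<le> dist x p + dist p y" "dist p y \<le> dist p q + dist q y" by (rule dist_triangle)+
          ultimately show "norm (x - y) \<le> ?D + 2 * e" using xy by (simp add: dist_norm dist_commute norm_minus_commute)
        qed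
        then show ?thesis by auto
        qed
        show "(\<Union>x\<in>T. \<Union>y\<in>uminus ` T. {x + y}) \<in> sets lebesgue"
          using open_box_family_Union[OF fam] open_box_family_Union[OF fam']
          unfolding T'[symmetric] by (intro fmeasurableD open_sums_lmeasurable) (auto simp: T_def)
      qed auto
      also have "\<dots> = unit_ball_vol DIM('a) * (?D + 2 * e) ^ DIM('a)"
        using D0 e by (simp add: content_cball)
      finally have "2 ^ DIM('a) * ?m T \<le> unit_ball_vol DIM('a) * (?D + 2 * e) ^ DIM('a)" by simp
      then have "?m T \<le> unit_ball_vol DIM('a) * ((?D + 2 * e) / 2) ^ DIM('a)"
        by (simp add: power_divide field_simps)
      then show ?thesis using FT by simp
    qed
    have cm: "K \<in> lmeasurable" if "K \<in> \<D>" for K using \<D>(3)[OF that] by auto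
    note U = measure_Union_bound[OF \<D>(1) cm bound] fmeasurable_Union_bound[OF \<D>(1) cm bound]
    have "?m S \<le> ?m (\<Union>\<D>)"
      using S \<D>(6) by (intro measure_mono_fmeasurable U) (auto simp: lmeasurable_compact fmeasurableD)
    also have "\<dots> \<le> unit_ball_vol DIM('a) * ((?D + 2 * e) / 2) ^ DIM('a)" by (rule U)
    finally show ?thesis .
  qed
  have "((\<lambda>e. unit_ball_vol DIM('a) * ((?D + 2 * e) / 2) ^ DIM('a)) \<longlongrightarrow>
      unit_ball_vol DIM('a) * ((?D + 2 * 0) / 2) ^ DIM('a)) (at_right 0)"
    by (intro tendsto_intros) auto
  then show ?thesis
    by (intro tendsto_lowerbound[of "\<lambda>e. unit_ball_vol DIM('a) * ((?D + 2 * e) / 2) ^ DIM('a)" _ "at_right 0"])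
       (auto simp: eventually_at_filter intro!: always_eventually step)
qed

subsection \<open>Hausdorff and Lebesgue measure\<close>

text \<open>Covers in the definition are sequences. A countable family, finite or not, is numbered
  by \<open>to_nat_on\<close> and padded with empty sets, which are free because
  \<open>d \<ge> 1\<close>.\<close>

lemma hausdorff_pre_countable_cover:
  assumes d: "d \<ge> 1" and \<delta>: "\<delta> > 0" and I: "countable I" and A: "A \<subseteq> (\<Union>i\<in>I. C i)"
    and C: "\<And>i. i \<in> I \<Longrightarrow> bounded (C i)" "\<And>i. i \<in> I \<Longrightarrow> diameter (C i) \<le> \<delta>"
  shows "hausdorff_pre d \<delta> A
     \<le> (\<integral>\<^sup>+ i. ennreal (unit_ball_vol (real d) * (diameter (C i) / 2) ^ d) \<partial>count_space I)"
proof -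
  let ?f = "\<lambda>C. ennreal (unit_ball_vol (real d) * (diameter C / 2) ^ d)"
  define J where "J = to_nat_on I ` I"
  define C' where "C' n = (if n \<in> J then C (from_nat_into I n) else {})" for n
  have bij: "bij_betw (to_nat_on I) I J" using I by (auto simp: J_def bij_betw_def)
  have inv: "from_nat_into I (to_nat_on I i) = i" if "i \<in> I" for i using I that by simp
  have "hausdorff_pre d \<delta> A \<le> (\<Sum>n. ?f (C' n))"
  proof (rule hausdorff_pre_le)
    show "A \<subseteq> (\<Union>n. C' n)"
    proof
      fix x assume "x \<in> A"
      then obtain i where "i \<in> I" "x \<in> C i" using A by blast
      then show "x \<in> (\<Union>n. C' n)" using inv by (intro UN_I[of "to_nat_on I i"]) (auto simp: C'_def J_def)
    qed
    show "bounded (C' n)" "diameter (C' n) \<le> \<delta>" for n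
      using C inv \<delta> by (auto simp: C'_def J_def)
  qed
  also have "\<dots> = (\<integral>\<^sup>+ n. ?f (C' n) \<partial>count_space UNIV)" by (simp add: nn_integral_count_space_nat)
  also have "\<dots> = (\<integral>\<^sup>+ n. ?f (C' n) * indicator J n \<partial>count_space UNIV)"
    using d by (intro nn_integral_cong) (auto simp: C'_def power_0_left split: split_indicator)
  also have "\<dots> = (\<integral>\<^sup>+ n. ?f (C' n) \<partial>count_space J)"
    by (simp add: nn_integral_count_space_indicator)
  also have "\<dots> = (\<integral>\<^sup>+ i. ?f (C' (to_nat_on I i)) \<partial>count_space I)"
    by (rule nn_integral_bij_count_space[OF bij, symmetric])
  also have "\<dots> = (\<integral>\<^sup>+ i. ?f (C i) \<partial>count_space I)"
    using inv by (intro nn_integral_cong) (auto simp: C'_def J_def)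
  finally show ?thesis .
qed

lemma nn_integral_disjoint_cballs:
  fixes a :: "'i \<Rightarrow> 'a::euclidean_space"
  assumes I: "countable I" and r: "\<And>i. i \<in> I \<Longrightarrow> 0 < r i"
    and disj: "pairwise (\<lambda>i j. disjnt (cball (a i) (r i)) (cball (a j) (r j))) I"
    and U: "U \<in> sets borel" "\<And>i. i \<in> I \<Longrightarrow> cball (a i) (r i) \<subseteq> U"
  shows "(\<integral>\<^sup>+ i. ennreal (unit_ball_vol (real DIM('a)) * r i ^ DIM('a)) \<partial>count_space I) \<le> emeasure lborel U"
proof -
  have "(\<integral>\<^sup>+ i. ennreal (unit_ball_vol (real DIM('a)) * r i ^ DIM('a)) \<partial>count_space I)
      = (\<integral>\<^sup>+ i. emeasure lborel (cball (a i) (r i)) \<partial>count_space I)"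
    using r by (intro nn_integral_cong) (auto simp: emeasure_cball less_imp_le)
  also have "\<dots> = emeasure lborel (\<Union>i\<in>I. cball (a i) (r i))"
    using disj I by (intro emeasure_UN_countable[symmetric]) (auto simp: disjoint_family_on_def pairwise_def disjnt_def)
  also have "\<dots> \<le> emeasure lborel U" using U by (intro emeasure_mono) auto
  finally show ?thesis .
qed

text \<open>Vitali's covering lemma: disjoint balls inside an open \<open>U\<close> of small measure
  cover \<open>N\<close> once their radii are multiplied by 5. The enlargement costs
  \<open>5 ^ DIM('a)\<close>, hence the bound \<open>e / 5 ^ DIM('a)\<close> for \<open>U\<close>;
  the radii stay below \<open>\<delta> / 10\<close> because an enlarged ball has diameter
  \<open>10 * r\<close>.\<close>

lemma hausdorff_pre_negligible:
  fixes N :: "'a::euclidean_space set"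
  assumes N: "negligible N" and \<delta>: "\<delta> > 0"
  shows "hausdorff_pre DIM('a) \<delta> N = 0"
proof -
  have le: "hausdorff_pre DIM('a) \<delta> N \<le> 0 + ennreal e" if e: "e > 0" for e
  proof -
    have "e / 5 ^ DIM('a) > 0" using e by simp
    then obtain U where U: "open U" "N \<subseteq> U" "emeasure lebesgue (U - N) < ennreal (e / 5 ^ DIM('a))"
      using N sets_lebesgue_outer_open[of N] negligible_imp_sets by metis
    have UN: "N \<in> sets lebesgue" "U - N \<in> sets lebesgue" "U \<in> sets lborel"
      using U N by (auto simp: negligible_imp_sets borel_open)
    have "emeasure lebesgue (N \<union> (U - N)) \<le> emeasure lebesgue N + emeasure lebesgue (U - N)"
      using UN by (intro emeasure_subadditive)
    moreover have "emeasure lebesgue N = 0"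
      using N by (auto simp only: negligible_iff_null_sets null_setsD1)
    moreover have "N \<union> (U - N) = U" using U by auto
    moreover have "emeasure lebesgue U = emeasure lborel U" using UN by simp
    ultimately have mU: "emeasure lborel U \<le> ennreal (e / 5 ^ DIM('a))"
      using U(3) by (metis add_0 less_imp_le order_trans)
    have "\<exists>r. 0 < r \<and> r \<le> \<delta> / 10 \<and> cball x r \<subseteq> U" if "x \<in> N" for x
    proof -
      have "x \<in> U" using U(2) that by blast
      then obtain r where "r > 0" "cball x r \<subseteq> U" using U(1) open_contains_cball[of U] by blast
      then show ?thesis using \<delta> by (intro exI[of _ "min r (\<delta> / 10)"]) auto
    qed
    then obtain r where r: "\<And>x. x \<in> N \<Longrightarrow> 0 < r x \<and> r x \<le> \<delta> / 10 \<and> cball x (r x) \<subseteq> U" by metis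
    have cov: "N \<subseteq> (\<Union>x\<in>N. cball x (r x))"
    proof
      fix x assume "x \<in> N"
      then show "x \<in> (\<Union>x\<in>N. cball x (r x))" using r[of x] by (intro UN_I[of x]) auto
    qed
    obtain I where I: "countable I" "I \<subseteq> N" "pairwise (\<lambda>i j. disjnt (cball i (r i)) (cball j (r j))) I"
      "N \<subseteq> (\<Union>i\<in>I. cball i (5 * r i))"
    proof -
      have rr: "0 < r i \<and> r i \<le> \<delta> / 10" if "i \<in> N" for i using r[OF that] by simp
      show ?thesis by (rule Vitali_covering_lemma_cballs[OF cov rr]) (assumption, rule that)
    qed
    have "hausdorff_pre DIM('a) \<delta> N
       \<le> (\<integral>\<^sup>+ i. ennreal (unit_ball_vol (real DIM('a)) * (diameter (cball i (5 * r i)) / 2) ^ DIM('a)) \<partial>count_space I)"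
      by (rule hausdorff_pre_countable_cover[OF _ \<delta> I(1,4)]) (use I(2) r in \<open>force simp: Suc_le_eq\<close>)+
    also have "\<dots> = (\<integral>\<^sup>+ i. ennreal (5 ^ DIM('a)) * ennreal (unit_ball_vol (real DIM('a)) * r i ^ DIM('a)) \<partial>count_space I)"
    proof (intro nn_integral_cong)
      fix i assume "i \<in> space (count_space I)"
      then have "0 < r i" using I r by auto
      then show "ennreal (unit_ball_vol (real DIM('a)) * (diameter (cball i (5 * r i)) / 2) ^ DIM('a))
        = ennreal (5 ^ DIM('a)) * ennreal (unit_ball_vol (real DIM('a)) * r i ^ DIM('a))"
        by (simp add: ennreal_mult[symmetric] power_mult_distrib mult.left_commute)
    qed
    also have "\<dots> = ennreal (5 ^ DIM('a)) * (\<integral>\<^sup>+ i. ennreal (unit_ball_vol (real DIM('a)) * r i ^ DIM('a)) \<partial>count_space I)"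
      by (rule nn_integral_cmult) auto
    also have "\<dots> \<le> ennreal (5 ^ DIM('a)) * emeasure lborel U"
      using I r U by (intro mult_left_mono nn_integral_disjoint_cballs[where a="\<lambda>i. i"]) auto
    also have "\<dots> \<le> ennreal (5 ^ DIM('a)) * ennreal (e / 5 ^ DIM('a))"
      using mU by (intro mult_left_mono) auto
    also have "\<dots> = ennreal e" using e by (simp add: ennreal_mult[symmetric])
    finally show ?thesis by simp
  qed
  have "hausdorff_pre DIM('a) \<delta> N \<le> 0" by (rule ennreal_le_epsilon) (rule le)
  then show ?thesis by simp
qed

lemma hausdorff_pre_Un_le: "d \<ge> 1 \<Longrightarrow> \<delta> > 0 \<Longrightarrow> hausdorff_pre d \<delta> (A \<union> B) \<le> hausdorff_pre d \<delta> A + hausdorff_pre d \<delta> B"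
proof -
  assume d: "d \<ge> 1" "\<delta> > 0"
  let ?E = "\<lambda>i::nat. if i = 0 then A else if i = 1 then B else {}"
  have "(\<Union>i. ?E i) = A \<union> B" by (auto split: if_splits)
  then have "hausdorff_pre d \<delta> (A \<union> B) \<le> (\<Sum>i. hausdorff_pre d \<delta> (?E i))"
    using hausdorff_pre_countable_subadditive[of d \<delta> ?E] by simp
  also have "\<dots> = (\<Sum>i\<in>{0,1}. hausdorff_pre d \<delta> (?E i))"
    by (rule suminf_finite) (use hausdorff_pre_empty[OF d] in auto)
  finally show ?thesis by simp
qed

text \<open>By Vitali's covering theorem small disjoint balls fill \<open>U\<close> up to a
  negligible set, and for a ball the cost in the definition of \<open>hausdorff_pre\<close> is
  exactly its volume.\<close>

lemma hausdorff_pre_open_le: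
  fixes U :: "'a::euclidean_space set"
  assumes U: "open U" and \<delta>: "\<delta> > 0"
  shows "hausdorff_pre DIM('a) \<delta> U \<le> emeasure lborel U"
proof -
  define K where "K = {(x, r). x \<in> U \<and> 0 < r \<and> r \<le> \<delta> / 2 \<and> cball x r \<subseteq> U}"
  have r: "0 < snd i" "snd i \<le> \<delta> / 2" "cball (fst i) (snd i) \<subseteq> U" if "i \<in> K" for i using that by (auto simp: K_def)
  have fine: "\<exists>i. i \<in> K \<and> x \<in> cball (fst i) (snd i) \<and> snd i < d" if "x \<in> U" "0 < d" for x d
  proof -
    obtain r where r: "r > 0" "cball x r \<subseteq> U" using U \<open>x \<in> U\<close> open_contains_cball[of U] by blast
    define r' where "r' = min r (min (d / 2) (\<delta> / 2))"
    have "r' > 0" "r' \<le> \<delta> / 2" "r' < d" "r' \<le> r" using r that \<delta> by (auto simp: r'_def)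
    moreover have "cball x r' \<subseteq> U" using r \<open>r' \<le> r\<close> by auto
    ultimately show ?thesis using that by (intro exI[of _ "(x, r')"]) (auto simp: K_def)
  qed
  obtain I where I: "countable I" "I \<subseteq> K"
     "pairwise (\<lambda>i j. disjnt (cball (fst i) (snd i)) (cball (fst j) (snd j))) I"
     "negligible(U - (\<Union>i \<in> I. cball (fst i) (snd i)))"
    by (rule Vitali_covering_theorem_cballs[of K snd U fst, OF r(1) fine])
  have rI: "0 < snd i" "snd i \<le> \<delta> / 2" "cball (fst i) (snd i) \<subseteq> U" if "i \<in> I" for i
    using r that I(2) by blast+
  let ?B = "\<Union>i \<in> I. cball (fst i) (snd i)"
  have d1: "DIM('a) \<ge> 1" by (simp add: Suc_le_eq)
  have "hausdorff_pre DIM('a) \<delta> U \<le> hausdorff_pre DIM('a) \<delta> (?B \<union> (U - ?B))" by (rule hausdorff_pre_mono) auto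
  also have "\<dots> \<le> hausdorff_pre DIM('a) \<delta> ?B + hausdorff_pre DIM('a) \<delta> (U - ?B)"
    by (rule hausdorff_pre_Un_le[OF d1 \<delta>])
  also have "hausdorff_pre DIM('a) \<delta> (U - ?B) = 0" by (rule hausdorff_pre_negligible[OF I(4) \<delta>])
  also have "hausdorff_pre DIM('a) \<delta> ?B
       \<le> (\<integral>\<^sup>+ i. ennreal (unit_ball_vol (real DIM('a)) * (diameter (cball (fst i) (snd i)) / 2) ^ DIM('a)) \<partial>count_space I)"
  proof (rule hausdorff_pre_countable_cover[OF d1 \<delta> I(1)])
    show "diameter (cball (fst i) (snd i)) \<le> \<delta>" if "i \<in> I" for i using rI[OF that] \<delta> by simp
  qed auto
  also have "\<dots> = (\<integral>\<^sup>+ i. ennreal (unit_ball_vol (real DIM('a)) * snd i ^ DIM('a)) \<partial>count_space I)"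
  proof (intro nn_integral_cong)
    fix i assume "i \<in> space (count_space I)"
    then have "0 < snd i" using rI(1)[of i] by simp
    then show "ennreal (unit_ball_vol (real DIM('a)) * (diameter (cball (fst i) (snd i)) / 2) ^ DIM('a))
        = ennreal (unit_ball_vol (real DIM('a)) * snd i ^ DIM('a))" by simp
  qed
  also have "\<dots> \<le> emeasure lborel U"
    using U by (intro nn_integral_disjoint_cballs[where a=fst] I(1,3) rI) auto
  finally show ?thesis by simp
qed

text \<open>The upper bound passes from open sets to \<open>A\<close> by outer regularity. The lower
  bound is the isodiametric inequality applied to the members of a cover.\<close>

theorem hausdorff_outer_eq_lborel:
  fixes A :: "'a::euclidean_space set"
  assumes A: "A \<in> sets borel"
  shows "hausdorff_outer DIM('a) A = emeasure lborel A"
proof (rule antisym)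
  show "hausdorff_outer DIM('a) A \<le> emeasure lborel A"
    unfolding hausdorff_outer_def
  proof (rule SUP_least)
    fix \<delta> :: real assume "\<delta> \<in> {0<..}"
    then have \<delta>: "\<delta> > 0" by simp
    show "hausdorff_pre DIM('a) \<delta> A \<le> emeasure lborel A"
    proof (rule ennreal_le_epsilon)
      fix e :: real assume e: "0 < e"
      have AL: "A \<in> sets lebesgue" using A by simp
      obtain U where U: "open U" "A \<subseteq> U" "emeasure lebesgue (U - A) < e"
        by (rule sets_lebesgue_outer_open[OF AL e])
      have "U - A \<in> sets borel" using A U(1) by (simp add: borel_open sets.Diff)
      then have UA: "emeasure lborel (U - A) < e" using U(3) by simp
      have "hausdorff_pre DIM('a) \<delta> A \<le> hausdorff_pre DIM('a) \<delta> U" by (rule hausdorff_pre_mono[OF U(2)])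
      also have "\<dots> \<le> emeasure lborel U" by (rule hausdorff_pre_open_le[OF U(1) \<delta>])
      also have "\<dots> \<le> emeasure lborel A + emeasure lborel (U - A)"
        using A U emeasure_subadditive[of A lborel "U - A"] by (simp add: Un_absorb1)
      also have "\<dots> \<le> emeasure lborel A + e" using UA by (intro add_left_mono) simp
      finally show "hausdorff_pre DIM('a) \<delta> A \<le> emeasure lborel A + e" .
    qed
  qed
  \<comment> \<open>The isodiametric inequality is valid at every scale, so \<delta> = 1 suffices.
    Closures make the covering sets compact without changing their diameters.\<close>
  have "emeasure lborel A \<le> hausdorff_pre DIM('a) 1 A"
    unfolding hausdorff_pre_def
  proof (rule INF_greatest, clarify)
    fix C :: "nat \<Rightarrow> 'a set" assume C: "A \<subseteq> (\<Union>i. C i)" "\<forall>i. bounded (C i) \<and> diameter (C i) \<le> 1"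
    have "emeasure lborel A \<le> emeasure lborel (\<Union>i. closure (C i))"
      using C(1) closure_subset by (intro emeasure_mono) (auto, blast)
    also have "\<dots> \<le> (\<Sum>i. emeasure lborel (closure (C i)))"
      by (rule emeasure_subadditive_countably) auto
    also have "\<dots> \<le> (\<Sum>i. ennreal (unit_ball_vol (real DIM('a)) * (diameter (C i) / 2) ^ DIM('a)))"
    proof (intro suminf_le)
      fix i
      have cc: "compact (closure (C i))" using C(2) by (simp add: compact_closure)
      then have "emeasure lborel (closure (C i)) = ennreal (measure lborel (closure (C i)))"
        by (intro emeasure_eq_ennreal_measure) (use emeasure_compact_finite[OF cc] in auto)
      also have "measure lborel (closure (C i)) = measure lebesgue (closure (C i))" by simp
      also have "ennreal \<dots> \<le> ennreal (unit_ball_vol (real DIM('a)) * (diameter (C i) / 2) ^ DIM('a))"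
        using isodiametric_inequality[OF cc] C(2) by (intro ennreal_leI) (simp add: diameter_closure)
      finally show "emeasure lborel (closure (C i)) \<le> ennreal (unit_ball_vol (real DIM('a)) * (diameter (C i) / 2) ^ DIM('a))" .
    qed auto
    finally show "emeasure lborel A \<le> (\<Sum>i. ennreal (unit_ball_vol (real DIM('a)) * (diameter (C i) / 2) ^ DIM('a)))" .
  qed
  also have "\<dots> \<le> hausdorff_outer DIM('a) A" by (rule hausdorff_pre_le_outer) simp
  finally show "emeasure lborel A \<le> hausdorff_outer DIM('a) A" .
qed

subsection \<open>Level sets of \<open>C\<^sup>2\<close> functions\<close>

text \<open>To first order \<rho> is positive at \<open>z + t *\<^sub>R (v + c *\<^sub>R g)\<close>
  and negative at \<open>z + t *\<^sub>R (v - c *\<^sub>R g)\<close>, so it vanishes in between.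
  With \<open>c = \<epsilon> / norm g\<close> the zero lies within \<open>\<epsilon> * t\<close> of
  the tangent line. This replaces the implicit function theorem.\<close>

lemma zero_set_tangent:
  fixes \<rho> :: "'a::euclidean_space \<Rightarrow> real"
  assumes U: "open U" "z \<in> U" and cont: "continuous_on U \<rho>"
    and der: "(\<rho> has_derivative (\<lambda>v. g \<bullet> v)) (at z)"
    and "\<rho> z = 0" "g \<noteq> 0" "g \<bullet> v = 0" "\<epsilon> > 0"
  obtains t0 where "t0 > 0" "\<And>t. 0 < t \<Longrightarrow> t < t0 \<Longrightarrow> \<exists>y\<in>U. \<rho> y = 0 \<and> norm (y - (z + t *\<^sub>R v)) \<le> \<epsilon> * t"
proof -
  define c where "c = \<epsilon> / norm g"
  have c: "c > 0" "c * norm g = \<epsilon>" using assms by (auto simp: c_def)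
  have gg: "g \<bullet> g > 0" using \<open>g \<noteq> 0\<close> by simp
  have line: "DERIV (\<lambda>t. \<rho> (z + t *\<^sub>R w)) 0 :> g \<bullet> w" for w
  proof -
    have "((\<lambda>t. \<rho> (z + t *\<^sub>R w)) has_derivative (\<lambda>t. g \<bullet> (t *\<^sub>R w))) (at 0)"
      by (rule has_derivative_compose[of "\<lambda>t. z + t *\<^sub>R w" _ 0 UNIV \<rho>])
         (use der in \<open>auto intro!: derivative_eq_intros\<close>)
    moreover have "(\<lambda>t. g \<bullet> (t *\<^sub>R w)) = (*) (g \<bullet> w)" by (auto simp: fun_eq_iff)
    ultimately show ?thesis by (simp only: has_field_derivative_def)
  qed
  have "g \<bullet> (v + c *\<^sub>R g) > 0" "g \<bullet> (v - c *\<^sub>R g) < 0"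
    using assms c gg by (auto simp: inner_add_right inner_diff_right)
  then obtain d1 d2 where d: "d1 > 0" "\<And>h. h > 0 \<Longrightarrow> h < d1 \<Longrightarrow> \<rho> (z + h *\<^sub>R (v + c *\<^sub>R g)) > 0"
      "d2 > 0" "\<And>h. h > 0 \<Longrightarrow> h < d2 \<Longrightarrow> \<rho> (z + h *\<^sub>R (v - c *\<^sub>R g)) < 0"
    using DERIV_pos_inc_right[OF line, of "v + c *\<^sub>R g"] DERIV_neg_dec_right[OF line, of "v - c *\<^sub>R g"] \<open>\<rho> z = 0\<close>
    by (metis add_0 scaleR_zero_left add.right_neutral)
  obtain r where r: "r > 0" "ball z r \<subseteq> U" using U open_contains_ball by blast
  define R where "R = norm v + \<epsilon> + 1"
  have R: "R > 0" using \<open>\<epsilon> > 0\<close> by (simp add: R_def add_nonneg_pos)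
  define t0 where "t0 = min (min d1 d2) (r / R)"
  have "\<exists>y\<in>U. \<rho> y = 0 \<and> norm (y - (z + t *\<^sub>R v)) \<le> \<epsilon> * t" if t: "0 < t" "t < t0" for t
  proof -
    define p where "p s = z + t *\<^sub>R (v + (s * c) *\<^sub>R g)" for s
    have pU: "p s \<in> U" if "-1 \<le> s" "s \<le> 1" for s
    proof -
      have "norm (p s - z) = t * norm (v + (s * c) *\<^sub>R g)" using t by (simp add: p_def)
      also have "\<dots> \<le> t * (norm v + \<bar>s\<bar> * \<epsilon>)"
        using t c norm_triangle_ineq[of v "(s * c) *\<^sub>R g"] by (intro mult_left_mono) (auto simp: abs_mult mult.assoc)
      also have "\<dots> \<le> t * R"
      proof -
        have "\<bar>s\<bar> * \<epsilon> \<le> 1 * \<epsilon>" using that \<open>\<epsilon> > 0\<close> by (intro mult_right_mono) auto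
        then show ?thesis using t by (intro mult_left_mono) (auto simp: R_def)
      qed
      also have "\<dots> < r" using t R by (simp add: t0_def field_simps)
      finally show ?thesis using r by (auto simp: dist_norm norm_minus_commute)
    qed
    have "continuous_on {-1..1} (\<lambda>s. \<rho> (p s))"
      by (rule continuous_on_compose2[OF cont]) (use pU in \<open>auto simp: p_def intro!: continuous_intros\<close>)
    moreover have "\<rho> (p (-1)) < 0" using d(4)[of t] t by (simp add: p_def t0_def)
    moreover have "\<rho> (p 1) > 0" using d(2)[of t] t by (simp add: p_def t0_def)
    ultimately obtain s where s: "-1 \<le> s" "s \<le> 1" "\<rho> (p s) = 0"
      using IVT'[of "\<lambda>s. \<rho> (p s)" "-1" 0 1] by auto
    have "norm (p s - (z + t *\<^sub>R v)) = \<bar>s\<bar> * (\<epsilon> * t)"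
      using t c by (simp add: p_def algebra_simps abs_mult)
    also have "\<dots> \<le> 1 * (\<epsilon> * t)" using s t \<open>\<epsilon> > 0\<close> by (intro mult_right_mono) auto
    finally show ?thesis using s pU by auto
  qed
  moreover have "t0 > 0" using d r R by (simp add: t0_def)
  ultimately show ?thesis using that by blast
qed

text \<open>The difference of two derivatives is linear and of smaller order than
  \<open>y - x\<close> along \<open>S\<close>; it is evaluated at points of \<open>S\<close> that
  approximate \<open>x + t *\<^sub>R v\<close>. Off the tangent directions a derivative within a
  hypersurface is an arbitrary choice.\<close>

lemma has_derivative_within_unique_tangent:
  fixes f :: "'a::real_normed_vector \<Rightarrow> 'b::real_normed_vector"
  assumes D1: "(f has_derivative D1) (at x within S)" and D2: "(f has_derivative D2) (at x within S)"
    and tan: "\<And>\<epsilon>::real. \<epsilon> > 0 \<Longrightarrow> \<exists>t0>0. \<forall>t. 0 < t \<and> t < t0 \<longrightarrow> (\<exists>y\<in>S. norm (y - (x + t *\<^sub>R v)) \<le> \<epsilon> * t)"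
  shows "D1 v = D2 v"
proof -
  define D where "D h = D1 h - D2 h" for h
  have "((\<lambda>y. f y - f y) has_derivative D) (at x within S)"
    unfolding D_def[abs_def] by (rule has_derivative_diff[OF D1 D2])
  then have bl: "bounded_linear D" and small: "\<And>e. e > 0 \<Longrightarrow> \<exists>d>0. \<forall>y\<in>S. norm (y - x) < d \<longrightarrow> norm (D (y - x)) \<le> e * norm (y - x)"
    unfolding has_derivative_within_alt by auto
  interpret D: bounded_linear D by fact
  obtain B where B: "B > 0" "\<And>h. norm (D h) \<le> norm h * B" using D.pos_bounded by blast
  have est: "norm (D v) \<le> e * (norm v + 1 + B)" if e: "0 < e" "e \<le> 1" for e
  proof -
    obtain d where d: "d > 0" "\<And>y. y \<in> S \<Longrightarrow> norm (y - x) < d \<Longrightarrow> norm (D (y - x)) \<le> e * norm (y - x)"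
      using small[OF e(1)] by blast
    obtain t0 where t0: "t0 > 0" "\<And>t. 0 < t \<Longrightarrow> t < t0 \<Longrightarrow> (\<exists>y\<in>S. norm (y - (x + t *\<^sub>R v)) \<le> e * t)"
      using tan[OF e(1)] by blast
    define t where "t = min (t0 / 2) (d / (2 * (norm v + 1)))"
    have nv: "norm v + 1 > 0" by (simp add: add_nonneg_pos)
    have t: "0 < t" "t < t0" using t0 d nv by (auto simp: t_def)
    have td: "t * (norm v + 1) < d"
    proof -
      have "t * (norm v + 1) \<le> d / (2 * (norm v + 1)) * (norm v + 1)"
        using nv by (intro mult_right_mono) (auto simp: t_def)
      also have "\<dots> = d / 2" using nv by (simp add: field_simps)
      finally show ?thesis using d by simp
    qed
    obtain y where y: "y \<in> S" "norm (y - (x + t *\<^sub>R v)) \<le> e * t" using t0(2)[OF t] by blast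
    define r where "r = y - (x + t *\<^sub>R v)"
    have yx: "y - x = t *\<^sub>R v + r" by (simp add: r_def)
    have r: "norm r \<le> e * t" using y by (simp add: r_def)
    have "norm (y - x) \<le> t * norm v + e * t" unfolding yx using r t norm_triangle_ineq[of "t *\<^sub>R v" r] by simp
    also have "\<dots> \<le> t * norm v + 1 * t" using e t by simp
    finally have yx': "norm (y - x) \<le> t * (norm v + 1)" by (simp add: algebra_simps)
    have "t * norm (D v) = norm (D (y - x) - D r)"
      unfolding yx using t by (simp add: D.add D.scaleR)
    also have "\<dots> \<le> norm (D (y - x)) + norm (D r)" by (rule norm_triangle_ineq4)
    also have "\<dots> \<le> e * norm (y - x) + norm r * B"
      using d(2)[OF y(1)] yx' td B by (intro add_mono) auto
    also have "\<dots> \<le> e * (t * (norm v + 1)) + (e * t) * B"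
      using yx' r e B by (intro add_mono mult_left_mono mult_right_mono) auto
    also have "\<dots> = t * (e * (norm v + 1 + B))" by (simp add: algebra_simps)
    finally show ?thesis using t by simp
  qed
  have "((\<lambda>e. e * (norm v + 1 + B)) \<longlongrightarrow> 0 * (norm v + 1 + B)) (at_right 0)"
    by (intro tendsto_intros)
  moreover have "\<forall>\<^sub>F e in at_right 0. norm (D v) \<le> e * (norm v + 1 + B)"
    using eventually_at_right_real[OF zero_less_one] by (rule eventually_mono) (auto intro: est)
  ultimately have "norm (D v) \<le> 0" by (intro tendsto_lowerbound[where F="at_right 0"]) auto
  then show ?thesis by (simp add: D_def)
qed

section \<open>Second-order expansion with the Hessian frozen at one point\<close>

lemma norm_matrix_vector_mult_le:
  fixes A :: "real^'n^'m"
  shows "norm (A *v v) \<le> norm A * norm v"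
proof -
  have "norm (A *v v) = L2_set (\<lambda>i. norm ((A *v v) $ i)) UNIV" by (rule norm_vec_def)
  also have "\<dots> \<le> L2_set (\<lambda>i. norm (A $ i) * norm v) UNIV"
    by (intro L2_set_mono) (auto simp: matrix_mult_dot Cauchy_Schwarz_ineq2)
  also have "\<dots> = L2_set (\<lambda>i. norm (A $ i)) UNIV * norm v"
    by (simp add: L2_set_left_distrib)
  also have "L2_set (\<lambda>i. norm (A $ i)) UNIV = norm A" by (simp add: norm_vec_def)
  finally show ?thesis .
qed

text \<open>Mean value inequality for \<open>f - L\<close>. Strict differentiability is needed
  because later both points move while the linear map stays the one at \<open>y0\<close>.\<close>

lemma strict_derivative_bound:
  fixes f :: "'a::euclidean_space \<Rightarrow> 'b::euclidean_space"
  assumes der: "\<And>y. y \<in> ball y0 \<delta> \<Longrightarrow> (f has_derivative f' y) (at y)"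
    and close: "\<And>y v. y \<in> ball y0 \<delta> \<Longrightarrow> norm (f' y v - L v) \<le> \<epsilon> * norm v"
    and lin: "linear L" and ab: "a \<in> ball y0 \<delta>" "b \<in> ball y0 \<delta>"
  shows "norm (f a - f b - L (a - b)) \<le> \<epsilon> * norm (a - b)"
proof -
  have bL: "bounded_linear L" using lin by (simp add: linear_conv_bounded_linear)
  have "norm ((\<lambda>x. f x - L x) a - (\<lambda>x. f x - L x) b) \<le> \<epsilon> * norm (a - b)"
  proof (rule differentiable_bound[of "ball y0 \<delta>" _ "\<lambda>y v. f' y v - L v"])
    fix y assume y: "y \<in> ball y0 \<delta>"
    show "((\<lambda>x. f x - L x) has_derivative (\<lambda>v. f' y v - L v)) (at y within ball y0 \<delta>)"
      by (intro has_derivative_diff has_derivative_at_withinI[OF der[OF y]]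
          has_derivative_at_withinI[OF bounded_linear_imp_has_derivative[OF bL]])
    show "onorm (\<lambda>v. f' y v - L v) \<le> \<epsilon>" using close[OF y] by (intro onorm_le) (auto simp: mult.commute)
  qed (use ab in auto)
  then show ?thesis using lin by (simp add: linear_diff algebra_simps)
qed

text \<open>Fixes a Hessian, whose existence alone is asserted by \<open>C2_on\<close>.\<close>

locale C2_function =
  fixes U :: "(real^'n) set" and \<rho> :: "real^'n \<Rightarrow> real" and G :: "real^'n \<Rightarrow> real^'n" and H :: "real^'n \<Rightarrow> real^'n^'n"
  assumes U: "open U"
    and der: "y \<in> U \<Longrightarrow> (\<rho> has_derivative (\<lambda>v. G y \<bullet> v)) (at y)"
    and der2: "y \<in> U \<Longrightarrow> (G has_derivative (\<lambda>v. H y *v v)) (at y)"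
    and contH: "continuous_on U H"
begin

lemma contG: "continuous_on U G"
  using der2 by (meson continuous_at_imp_continuous_on has_derivative_continuous)

lemma cont\<rho>: "continuous_on U \<rho>"
  using der by (meson continuous_at_imp_continuous_on has_derivative_continuous)

lemma strict_G:
  assumes "y0 \<in> U" "\<epsilon> > 0"
  obtains \<delta> where "\<delta> > 0" "ball y0 \<delta> \<subseteq> U"
    "\<And>a b. a \<in> ball y0 \<delta> \<Longrightarrow> b \<in> ball y0 \<delta> \<Longrightarrow> norm (G a - G b - H y0 *v (a - b)) \<le> \<epsilon> * norm (a - b)"
proof -
  obtain d where d: "d > 0" "\<And>y. y \<in> U \<Longrightarrow> dist y y0 < d \<Longrightarrow> dist (H y) (H y0) < \<epsilon>"
    using contH assms unfolding continuous_on_iff by blast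
  obtain r where r: "r > 0" "ball y0 r \<subseteq> U" using U assms open_contains_ball by blast
  define \<delta> where "\<delta> = min d r"
  have sub: "ball y0 \<delta> \<subseteq> U" using r by (auto simp: \<delta>_def)
  show ?thesis
  proof (rule that[OF _ sub])
    fix a b assume "a \<in> ball y0 \<delta>" "b \<in> ball y0 \<delta>"
    then show "norm (G a - G b - H y0 *v (a - b)) \<le> \<epsilon> * norm (a - b)"
    proof (intro strict_derivative_bound)
      fix y v assume y: "y \<in> ball y0 \<delta>"
      then show "(G has_derivative (\<lambda>v. H y *v v)) (at y)" using sub der2 by blast
      have "norm (H y *v v - H y0 *v v) = norm ((H y - H y0) *v v)" by (simp add: matrix_vector_mult_diff_rdistrib)
      also have "\<dots> \<le> norm (H y - H y0) * norm v" by (rule norm_matrix_vector_mult_le)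
      also have "\<dots> \<le> \<epsilon> * norm v"
        using d(2)[of y] y sub by (intro mult_right_mono) (auto simp: \<delta>_def dist_norm norm_minus_commute)
      finally show "norm (H y *v v - H y0 *v v) \<le> \<epsilon> * norm v" .
    qed auto
  qed (use d r in \<open>auto simp: \<delta>_def\<close>)
qed

lemma strict_\<rho>:
  assumes "y0 \<in> U" "\<epsilon> > 0"
  obtains \<delta> where "\<delta> > 0" "ball y0 \<delta> \<subseteq> U"
    "\<And>a b. a \<in> ball y0 \<delta> \<Longrightarrow> b \<in> ball y0 \<delta> \<Longrightarrow> \<bar>\<rho> a - \<rho> b - G y0 \<bullet> (a - b)\<bar> \<le> \<epsilon> * norm (a - b)"
proof -
  obtain d where d: "d > 0" "\<And>y. y \<in> U \<Longrightarrow> dist y y0 < d \<Longrightarrow> dist (G y) (G y0) < \<epsilon>"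
    using contG assms unfolding continuous_on_iff by blast
  obtain r where r: "r > 0" "ball y0 r \<subseteq> U" using U assms open_contains_ball by blast
  define \<delta> where "\<delta> = min d r"
  have sub: "ball y0 \<delta> \<subseteq> U" using r by (auto simp: \<delta>_def)
  show ?thesis
  proof (rule that[OF _ sub])
    fix a b assume "a \<in> ball y0 \<delta>" "b \<in> ball y0 \<delta>"
    then have "norm (\<rho> a - \<rho> b - G y0 \<bullet> (a - b)) \<le> \<epsilon> * norm (a - b)"
    proof (intro strict_derivative_bound)
      fix y v assume y: "y \<in> ball y0 \<delta>"
      then show "(\<rho> has_derivative (\<lambda>v. G y \<bullet> v)) (at y)" using sub der by blast
      have "norm (G y \<bullet> v - G y0 \<bullet> v) = \<bar>(G y - G y0) \<bullet> v\<bar>" by (simp add: inner_diff_left)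
      also have "\<dots> \<le> norm (G y - G y0) * norm v" by (rule Cauchy_Schwarz_ineq2)
      also have "\<dots> \<le> \<epsilon> * norm v"
        using d(2)[of y] y sub by (intro mult_right_mono) (auto simp: \<delta>_def dist_norm norm_minus_commute)
      finally show "norm (G y \<bullet> v - G y0 \<bullet> v) \<le> \<epsilon> * norm v" .
    qed (auto simp: linear_iff inner_add_right)
    then show "\<bar>\<rho> a - \<rho> b - G y0 \<bullet> (a - b)\<bar> \<le> \<epsilon> * norm (a - b)" by simp
  qed (use d r in \<open>auto simp: \<delta>_def\<close>)
qed

lemma DERIV_line:
  assumes "x + s *\<^sub>R v \<in> U"
  shows "DERIV (\<lambda>s. \<rho> (x + s *\<^sub>R v)) s :> G (x + s *\<^sub>R v) \<bullet> v"
proof -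
  have "((\<lambda>s. \<rho> (x + s *\<^sub>R v)) has_derivative (\<lambda>t. G (x + s *\<^sub>R v) \<bullet> (t *\<^sub>R v))) (at s)"
    by (rule has_derivative_compose[of "\<lambda>t. x + t *\<^sub>R v" _ s UNIV \<rho>])
       (use der[OF assms] in \<open>auto intro!: derivative_eq_intros\<close>)
  moreover have "(\<lambda>t. G (x + s *\<^sub>R v) \<bullet> (t *\<^sub>R v)) = (*) (G (x + s *\<^sub>R v) \<bullet> v)" by (auto simp: fun_eq_iff)
  ultimately show ?thesis by (simp only: has_field_derivative_def)
qed

text \<open>Along \<open>v\<close> the mean value theorem turns the second difference over the
  parallelogram with sides \<open>t *\<^sub>R v\<close> and \<open>t *\<^sub>R w\<close> into a
  difference of gradients at two points that differ by \<open>t *\<^sub>R w\<close>.\<close>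

lemma second_difference_bound:
  assumes \<delta>: "ball y0 \<delta> \<subseteq> U"
    "\<And>a b. a \<in> ball y0 \<delta> \<Longrightarrow> b \<in> ball y0 \<delta> \<Longrightarrow> norm (G a - G b - H y0 *v (a - b)) \<le> e * norm (a - b)"
    and t: "0 < t" "t * (norm v + norm w) < \<delta>"
  shows "\<bar>(\<rho> (y0 + t *\<^sub>R v + t *\<^sub>R w) - \<rho> (y0 + t *\<^sub>R v)) - (\<rho> (y0 + t *\<^sub>R w) - \<rho> y0) - t\<^sup>2 * ((H y0 *v w) \<bullet> v)\<bar>
     \<le> t\<^sup>2 * (e * norm w * norm v)"
proof -
  have inb: "y0 + s *\<^sub>R v \<in> ball y0 \<delta>" "y0 + t *\<^sub>R w + s *\<^sub>R v \<in> ball y0 \<delta>" if "0 \<le> s" "s \<le> t" for s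
  proof -
    have "norm (s *\<^sub>R v) \<le> t * norm v" using that by (simp add: mult_right_mono)
    moreover have "t * norm v + t * norm w < \<delta>" using t by (simp add: distrib_left)
    moreover have "norm (t *\<^sub>R w + s *\<^sub>R v) \<le> norm (t *\<^sub>R w) + norm (s *\<^sub>R v)" by (rule norm_triangle_ineq)
    moreover have "0 \<le> t * norm w" using t by simp
    moreover have "norm (t *\<^sub>R w) = t * norm w" using t by simp
    ultimately have "norm (s *\<^sub>R v) < \<delta>" "norm (t *\<^sub>R w + s *\<^sub>R v) < \<delta>" by linarith+
    then show "y0 + s *\<^sub>R v \<in> ball y0 \<delta>" "y0 + t *\<^sub>R w + s *\<^sub>R v \<in> ball y0 \<delta>"
      by (auto simp: dist_norm norm_minus_commute algebra_simps)
  qed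
  define f where "f s = \<rho> (y0 + t *\<^sub>R w + s *\<^sub>R v) - \<rho> (y0 + s *\<^sub>R v)" for s
  have "DERIV f s :> (G (y0 + t *\<^sub>R w + s *\<^sub>R v) - G (y0 + s *\<^sub>R v)) \<bullet> v" if "0 \<le> s" "s \<le> t" for s
    unfolding f_def inner_diff_left using inb[OF that] \<delta>(1) by (intro DERIV_diff DERIV_line) auto
  then obtain s where s: "0 < s" "s < t" "f t - f 0 = (t - 0) * ((G (y0 + t *\<^sub>R w + s *\<^sub>R v) - G (y0 + s *\<^sub>R v)) \<bullet> v)"
    using MVT2[OF t(1), of f "\<lambda>s. (G (y0 + t *\<^sub>R w + s *\<^sub>R v) - G (y0 + s *\<^sub>R v)) \<bullet> v"] by blast
  have "norm (G (y0 + t *\<^sub>R w + s *\<^sub>R v) - G (y0 + s *\<^sub>R v) - H y0 *v (t *\<^sub>R w)) \<le> e * norm (t *\<^sub>R w)"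
    using \<delta>(2)[OF inb(2) inb(1), of s s] s by simp
  then have 1: "norm (G (y0 + t *\<^sub>R w + s *\<^sub>R v) - G (y0 + s *\<^sub>R v) - t *\<^sub>R (H y0 *v w)) \<le> e * t * norm w"
    using t by (simp add: matrix_vector_mult_scaleR mult.assoc)
  have "f t - f 0 - t\<^sup>2 * ((H y0 *v w) \<bullet> v) = t * ((G (y0 + t *\<^sub>R w + s *\<^sub>R v) - G (y0 + s *\<^sub>R v) - t *\<^sub>R (H y0 *v w)) \<bullet> v)"
    unfolding s by (simp add: inner_diff_left algebra_simps power2_eq_square)
  then have "\<bar>f t - f 0 - t\<^sup>2 * ((H y0 *v w) \<bullet> v)\<bar> = t * \<bar>(G (y0 + t *\<^sub>R w + s *\<^sub>R v) - G (y0 + s *\<^sub>R v) - t *\<^sub>R (H y0 *v w)) \<bullet> v\<bar>"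
    using t by (simp add: abs_mult)
  also have "\<dots> \<le> t * (e * t * norm w * norm v)"
    using t 1 by (intro mult_left_mono order_trans[OF Cauchy_Schwarz_ineq2] mult_right_mono) auto
  finally show ?thesis by (simp add: f_def algebra_simps power2_eq_square)
qed

text \<open>The second difference is symmetric in \<open>v\<close> and \<open>w\<close>, while
  \<open>second_difference_bound\<close> identifies it with either of the two values up to an error
  \<open>e * t\<^sup>2\<close>.\<close>

lemma Hessian_symmetric:
  assumes y0: "y0 \<in> U"
  shows "(H y0 *v w) \<bullet> v = (H y0 *v v) \<bullet> w"
proof -
  have est: "\<bar>(H y0 *v w) \<bullet> v - (H y0 *v v) \<bullet> w\<bar> \<le> e * (2 * norm v * norm w)" if e: "e > 0" for e
  proof -
    obtain \<delta> where \<delta>: "\<delta> > 0" "ball y0 \<delta> \<subseteq> U"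
      "\<And>a b. a \<in> ball y0 \<delta> \<Longrightarrow> b \<in> ball y0 \<delta> \<Longrightarrow> norm (G a - G b - H y0 *v (a - b)) \<le> e * norm (a - b)"
      using strict_G[OF y0 e] by metis
    define R where "R = norm v + norm w + 1"
    have R: "R > 0" by (simp add: R_def add_nonneg_pos)
    define t where "t = \<delta> / (2 * R)"
    have t0: "t > 0" using \<delta> R by (simp add: t_def)
    have "t * (norm v + norm w) \<le> t * R" using t0 by (intro mult_left_mono) (auto simp: R_def)
    also have "\<dots> < \<delta>" using \<delta> R by (simp add: t_def)
    finally have t: "t * (norm v + norm w) < \<delta>" "t * (norm w + norm v) < \<delta>" by (auto simp: add.commute)
    let ?\<Delta> = "\<rho> (y0 + t *\<^sub>R v + t *\<^sub>R w) - \<rho> (y0 + t *\<^sub>R v) - (\<rho> (y0 + t *\<^sub>R w) - \<rho> y0)"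
    have 1: "\<bar>?\<Delta> - t\<^sup>2 * ((H y0 *v w) \<bullet> v)\<bar> \<le> t\<^sup>2 * (e * norm w * norm v)"
      by (rule second_difference_bound[OF \<delta>(2,3) t0 t(1)])
    have "\<bar>(\<rho> (y0 + t *\<^sub>R w + t *\<^sub>R v) - \<rho> (y0 + t *\<^sub>R w)) - (\<rho> (y0 + t *\<^sub>R v) - \<rho> y0) - t\<^sup>2 * ((H y0 *v v) \<bullet> w)\<bar>
        \<le> t\<^sup>2 * (e * norm v * norm w)"
      by (rule second_difference_bound[OF \<delta>(2,3) t0 t(2)])
    moreover have "y0 + t *\<^sub>R w + t *\<^sub>R v = y0 + t *\<^sub>R v + t *\<^sub>R w" by (simp add: add_ac)
    ultimately have 2: "\<bar>?\<Delta> - t\<^sup>2 * ((H y0 *v v) \<bullet> w)\<bar> \<le> t\<^sup>2 * (e * norm w * norm v)"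
      by (simp add: algebra_simps)
    have "t\<^sup>2 * \<bar>(H y0 *v w) \<bullet> v - (H y0 *v v) \<bullet> w\<bar> = \<bar>t\<^sup>2 * ((H y0 *v w) \<bullet> v) - t\<^sup>2 * ((H y0 *v v) \<bullet> w)\<bar>"
      using t0 by (simp add: right_diff_distrib[symmetric] abs_mult del: right_diff_distrib)
    also have "\<dots> \<le> t\<^sup>2 * (e * norm w * norm v) + t\<^sup>2 * (e * norm w * norm v)" using 1 2 by linarith
    also have "\<dots> = t\<^sup>2 * (e * (2 * norm v * norm w))" by (simp add: algebra_simps)
    finally show ?thesis using t0 by simp
  qed
  have "((\<lambda>e. e * (2 * norm v * norm w)) \<longlongrightarrow> 0 * (2 * norm v * norm w)) (at_right 0)"
    by (intro tendsto_intros)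
  moreover have "\<forall>\<^sub>F e in at_right 0. \<bar>(H y0 *v w) \<bullet> v - (H y0 *v v) \<bullet> w\<bar> \<le> e * (2 * norm v * norm w)"
    using eventually_at_right_less[of 0] by (rule eventually_mono) (auto intro: est)
  ultimately have "\<bar>(H y0 *v w) \<bullet> v - (H y0 *v v) \<bullet> w\<bar> \<le> 0" by (intro tendsto_lowerbound[where F="at_right 0"]) auto
  then show ?thesis by simp
qed

text \<open>Taylor expansion from \<open>a\<close> to \<open>b\<close>: as \<rho> has equal values,
  the first-order term must balance the quadratic one. The gradient is taken at the moving point
  \<open>a\<close>, because it will become the normal there, but the Hessian stays at
  \<open>y0\<close>.\<close>

lemma level_set_quadratic:
  assumes y0: "y0 \<in> U" and e: "e > 0"
  obtains \<delta> where "\<delta> > 0" "ball y0 \<delta> \<subseteq> U"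
    "\<And>a b. a \<in> ball y0 \<delta> \<Longrightarrow> b \<in> ball y0 \<delta> \<Longrightarrow> \<rho> a = \<rho> b \<Longrightarrow>
       \<bar>G a \<bullet> (a - b) - (a - b) \<bullet> (H y0 *v (a - b)) / 2\<bar> \<le> e * (norm (a - b))\<^sup>2"
proof -
  obtain \<delta> where \<delta>: "\<delta> > 0" "ball y0 \<delta> \<subseteq> U"
      "\<And>a b. a \<in> ball y0 \<delta> \<Longrightarrow> b \<in> ball y0 \<delta> \<Longrightarrow> norm (G a - G b - H y0 *v (a - b)) \<le> e * norm (a - b)"
    using strict_G[OF y0 e] by metis
  have "\<bar>G a \<bullet> (a - b) - (a - b) \<bullet> (H y0 *v (a - b)) / 2\<bar> \<le> e * (norm (a - b))\<^sup>2"
    if ab: "a \<in> ball y0 \<delta>" "b \<in> ball y0 \<delta>" "\<rho> a = \<rho> b" for a b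
  proof -
    define w where "w = b - a"
    \<comment> \<open>The derivative of \<open>f\<close> is the error in the first-order expansion
      of \<open>G\<close> along the segment, so one mean value step yields the second-order
      remainder.\<close>
    define f where "f s = \<rho> (a + s *\<^sub>R w) - s * (G a \<bullet> w) - s\<^sup>2 / 2 * (w \<bullet> (H y0 *v w))" for s
    have inb: "a + s *\<^sub>R w \<in> ball y0 \<delta>" if "0 \<le> s" "s \<le> 1" for s
    proof -
      have "a + s *\<^sub>R w = (1 - s) *\<^sub>R a + s *\<^sub>R b" by (simp add: w_def algebra_simps)
      then show ?thesis using convexD[OF convex_ball ab(1,2), of "1 - s" s] that by simp
    qed
    have "DERIV f s :> G (a + s *\<^sub>R w) \<bullet> w - G a \<bullet> w - s * (w \<bullet> (H y0 *v w))" if "0 \<le> s" "s \<le> 1" for s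
      unfolding f_def using inb[OF that] \<delta>(2)
      by (auto intro!: derivative_eq_intros DERIV_line)
    then obtain s where s: "0 < s" "s < 1" "f 1 - f 0 = (1 - 0) * (G (a + s *\<^sub>R w) \<bullet> w - G a \<bullet> w - s * (w \<bullet> (H y0 *v w)))"
      using MVT2[OF zero_less_one, of f "\<lambda>s. G (a + s *\<^sub>R w) \<bullet> w - G a \<bullet> w - s * (w \<bullet> (H y0 *v w))"] by blast
    have "norm (G (a + s *\<^sub>R w) - G a - H y0 *v (s *\<^sub>R w)) \<le> e * norm (s *\<^sub>R w)"
      using \<delta>(3)[OF inb[of s] ab(1)] s by simp
    also have "\<dots> \<le> e * norm w" using s e by (simp add: mult_left_le_one_le)
    finally have 1: "norm (G (a + s *\<^sub>R w) - G a - s *\<^sub>R (H y0 *v w)) \<le> e * norm w"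
      by (simp add: matrix_vector_mult_scaleR)
    have "f 1 - f 0 = (G (a + s *\<^sub>R w) - G a - s *\<^sub>R (H y0 *v w)) \<bullet> w"
      unfolding s by (simp add: inner_diff_left) (simp add: inner_commute)
    then have "\<bar>f 1 - f 0\<bar> \<le> e * norm w * norm w"
      using 1 by (simp only:) (intro order_trans[OF Cauchy_Schwarz_ineq2] mult_right_mono; auto)
    moreover have "f 1 - f 0 = G a \<bullet> (a - b) - (a - b) \<bullet> (H y0 *v (a - b)) / 2"
    proof -
      have "a + w = b" "a - b = - w" by (auto simp: w_def)
      moreover have "H y0 *v (- w) = - (H y0 *v w)"
        by (metis matrix_vector_mult_scaleR scaleR_minus1_left)
      ultimately show ?thesis using ab(3) by (simp add: f_def)
    qed
    ultimately show ?thesis by (simp add: w_def norm_minus_commute power2_eq_square)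
  qed
  then show ?thesis using that \<delta>(1,2) by blast
qed

end

section \<open>Positive definite matrices\<close>

text \<open>A vector on which the form vanishes is a minimum of the form; testing it in the
  direction \<open>A *v v\<close> forces \<open>A *v v = 0\<close>.\<close>

lemma psd_nonsingular_pos_def:
  fixes A :: "real^'n^'n"
  assumes sym: "transpose A = A" and psd: "\<And>v. 0 \<le> v \<bullet> (A *v v)" and det: "det A \<noteq> 0" and v: "v \<noteq> 0"
  shows "0 < v \<bullet> (A *v v)"
proof (rule ccontr)
  assume "\<not> ?thesis"
  then have v0: "v \<bullet> (A *v v) = 0" using psd[of v] by simp
  have symm: "x \<bullet> (A *v y) = y \<bullet> (A *v x)" for x y
    by (metis sym dot_lmul_matrix inner_commute transpose_matrix_vector)
  define w where "w = A *v v"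
  define p where "p = w \<bullet> w"
  define q where "q = w \<bullet> (A *v w)"
  have q: "q \<ge> 0" using psd by (simp add: q_def)
  have eq: "(v + t *\<^sub>R w) \<bullet> (A *v (v + t *\<^sub>R w)) = 2 * t * p + t\<^sup>2 * q" for t
    using v0 symm[of v w]
    by (simp add: matrix_vector_right_distrib matrix_vector_mult_scaleR inner_add_left inner_add_right p_def q_def
        w_def[symmetric] power2_eq_square algebra_simps)
  \<comment> \<open>Close to the minimiser \<open>- p / q\<close>; adding 1 avoids a vanishing
    denominator.\<close>
  define t where "t = - p / (q + 1)"
  have "0 \<le> 2 * t * p + t\<^sup>2 * q" using psd[of "v + t *\<^sub>R w"] by (simp only: eq)
  also have "\<dots> = - (p / (q + 1))\<^sup>2 * (q + 2)"
    using q by (simp add: t_def field_simps power2_eq_square add_nonneg_eq_0_iff)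
  finally have "(p / (q + 1))\<^sup>2 * (q + 2) \<le> 0" by simp
  then have "p = 0" using q by (auto simp: mult_le_0_iff)
  then have "A *v v = 0" by (simp add: p_def w_def)
  then show False using det v by (metis invertible_det_nz matrix_left_invertible_ker invertible_def)
qed

text \<open>Gram-Schmidt for the inner product given by \<open>A\<close> yields a basis whose matrix
  \<open>X\<close> satisfies \<open>transpose X ** A ** X = mat 1\<close>. Then
  \<open>transpose X ** A\<close> is the inverse of \<open>X\<close> and is the required
  factor.\<close>

lemma pos_def_factorization:
  fixes A :: "real^'m^'m"
  assumes sym: "transpose A = A" and pd: "\<And>v. v \<noteq> 0 \<Longrightarrow> 0 < v \<bullet> (A *v v)"
  obtains B :: "real^'m^'m" where "transpose B ** B = A"
proof -
  define a where "a x y = x \<bullet> (A *v y)" for x y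
  have ac: "a x y = a y x" for x y
    unfolding a_def by (metis sym dot_lmul_matrix inner_commute transpose_matrix_vector)
  have lin: "a x (y + z) = a x y + a x z" "a x (c *\<^sub>R y) = c * a x y" "a x (y - z) = a x y - a x z" for x y z c
    by (auto simp: a_def matrix_vector_right_distrib matrix_vector_mult_scaleR inner_add_right
        matrix_vector_mult_diff_distrib inner_diff_right)
  have sumr: "a x (\<Sum>b\<in>S. f b) = (\<Sum>b\<in>S. a x (f b))" if "finite S" for x S and f :: "real^'m \<Rightarrow> real^'m"
  proof -
    have z0: "a x 0 = 0" by (simp add: a_def)
    show ?thesis using that by (induction S rule: finite_induct) (auto simp: lin z0)
  qed
  have "k \<le> CARD('m) \<Longrightarrow> \<exists>S. finite S \<and> card S = k \<and> (\<forall>x\<in>S. \<forall>y\<in>S. a x y = (if x = y then 1 else 0))" for k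
  proof (induction k)
    case 0 then show ?case by (intro exI[of _ "{}"]) auto
  next
    case (Suc k)
    then obtain S where S: "finite S" "card S = k" "\<And>x y. x \<in> S \<Longrightarrow> y \<in> S \<Longrightarrow> a x y = (if x = y then 1 else 0)" by auto
    have "dim S < dim (UNIV :: (real^'m) set)" using S Suc.prems dim_le_card'[OF S(1)] by simp
    then have "span S \<noteq> UNIV" by (metis dim_span less_irrefl)
    then obtain v where v: "v \<notin> span S" by auto
    define w where "w = v - (\<Sum>b\<in>S. a b v *\<^sub>R b)"
    have sp: "(\<Sum>b\<in>S. a b v *\<^sub>R b) \<in> span S" by (intro span_sum span_scale span_base)
    have w: "w \<notin> span S"
    proof
      assume "w \<in> span S"
      then have "w + (\<Sum>b\<in>S. a b v *\<^sub>R b) \<in> span S" using sp by (rule span_add)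
      then show False using v by (simp add: w_def)
    qed
    then have "w \<noteq> 0" using span_0 by metis
    then have c: "a w w > 0" using pd by (simp add: a_def)
    have aw: "a b w = 0" if "b \<in> S" for b
    proof -
      have "a b w = a b v - (\<Sum>b'\<in>S. a b' v * a b b')"
        by (simp add: w_def lin sumr[OF S(1)])
      also have "(\<Sum>b'\<in>S. a b' v * a b b') = (\<Sum>b'\<in>S. if b' = b then a b v else 0)"
        using S(3) that by (intro sum.cong) auto
      also have "\<dots> = a b v" using S(1) that by simp
      finally show ?thesis by simp
    qed
    define u where "u = (1 / sqrt (a w w)) *\<^sub>R w"
    have auu: "a u u = 1"
    proof -
      have "a u u = (1 / sqrt (a w w)) * ((1 / sqrt (a w w)) * a w w)"
        unfolding u_def lin(2) by (subst ac) (simp only: lin(2))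
      then show ?thesis using c by (simp add: field_simps)
    qed
    have au: "a b u = 0" "a u b = 0" if "b \<in> S" for b
      using aw[OF that] ac[of u b] by (auto simp: u_def lin(2))
    have "u \<notin> span S"
    proof
      assume "u \<in> span S"
      then have "sqrt (a w w) *\<^sub>R u \<in> span S" by (rule span_scale)
      then show False using w c by (simp add: u_def)
    qed
    then have "u \<notin> S" using span_base by blast
    then show ?case using S auu au by (intro exI[of _ "insert u S"]) auto
  qed
  from this[OF order_refl] obtain S where S: "finite S" "card S = CARD('m)"
    "\<And>x y. x \<in> S \<Longrightarrow> y \<in> S \<Longrightarrow> a x y = (if x = y then 1 else 0)" by auto
  obtain h where h: "bij_betw h (UNIV :: 'm set) S"
    using finite_same_card_bij[of "UNIV :: 'm set" S] S by auto
  define X :: "real^'m^'m" where "X = (\<chi> i j. h j $ i)"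
  have "(transpose X ** A) ** X = mat 1"
  proof -
    have "((transpose X ** A) ** X) $ i $ j = a (h i) (h j)" for i j
    proof -
      have "((transpose X ** A) ** X) $ i $ j = (\<Sum>l\<in>UNIV. (\<Sum>k\<in>UNIV. h i $ k * A $ k $ l) * h j $ l)"
        by (simp add: matrix_matrix_mult_def transpose_def X_def)
      also have "\<dots> = (\<Sum>l\<in>UNIV. \<Sum>k\<in>UNIV. h i $ k * (A $ k $ l * h j $ l))"
        by (simp add: sum_distrib_right mult.assoc)
      also have "\<dots> = (\<Sum>k\<in>UNIV. \<Sum>l\<in>UNIV. h i $ k * (A $ k $ l * h j $ l))" by (rule sum.swap)
      also have "\<dots> = a (h i) (h j)"
        by (simp add: a_def inner_vec_def matrix_vector_mult_def sum_distrib_left)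
      finally show ?thesis .
    qed
    moreover have "a (h i) (h j) = (if i = j then 1 else 0)" for i j
      using S(3)[of "h i" "h j"] h by (auto simp: bij_betw_def inj_on_def)
    ultimately show ?thesis by (simp add: vec_eq_iff mat_def)
  qed
  then have inv: "X ** (transpose X ** A) = mat 1" by (simp add: matrix_left_right_inverse)
  have "transpose (transpose X ** A) ** (transpose X ** A) = transpose A ** (X ** (transpose X ** A))"
    by (simp add: matrix_transpose_mul matrix_mul_assoc)
  then have "transpose (transpose X ** A) ** (transpose X ** A) = A" by (simp add: inv sym)
  then show ?thesis by (rule that)
qed

section \<open>Lebesgue measure under isometries and linear maps\<close>

text \<open>Source and target may be different types of the same dimension. Hausdorff measure sees
  only distances, so it links the two Lebesgue measures.\<close>

lemma emeasure_isometric_image: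
  fixes f :: "'a::euclidean_space \<Rightarrow> 'b::euclidean_space"
  assumes dim: "DIM('a) = DIM('b)" and S: "S \<in> sets borel" and fS: "f ` S \<in> sets borel"
    and iso: "\<And>x y. x \<in> S \<Longrightarrow> y \<in> S \<Longrightarrow> dist (f x) (f y) = dist x y"
  shows "emeasure lborel (f ` S) = emeasure lborel S"
proof -
  have inj: "inj_on f S" by (rule inj_onI) (metis iso dist_eq_0_iff)
  have "hausdorff_outer DIM('b) (f ` S) \<le> ennreal (1 ^ DIM('b)) * hausdorff_outer DIM('b) S"
    by (rule hausdorff_outer_lipschitz_image) (auto simp: iso)
  moreover have "hausdorff_outer DIM('b) (inv_into S f ` f ` S) \<le> ennreal (1 ^ DIM('b)) * hausdorff_outer DIM('b) (f ` S)"
    by (rule hausdorff_outer_lipschitz_image) (auto simp: iso inv_into_f_f[OF inj])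
  moreover have "inv_into S f ` f ` S = S" using inj by (simp add: inv_into_image_cancel)
  ultimately have "hausdorff_outer DIM('b) (f ` S) = hausdorff_outer DIM('a) S" by (simp add: dim)
  then show ?thesis by (simp only: hausdorff_outer_eq_lborel[OF S] hausdorff_outer_eq_lborel[OF fS])
qed

lemma measure_isometric_image:
  fixes f :: "'a::euclidean_space \<Rightarrow> 'b::euclidean_space"
  assumes dim: "DIM('a) = DIM('b)" and S: "compact S"
    and iso: "\<And>x y. x \<in> S \<Longrightarrow> y \<in> S \<Longrightarrow> dist (f x) (f y) = dist x y"
  shows "measure lebesgue (f ` S) = measure lebesgue S"
proof -
  have "1-lipschitz_on S f" using iso by (auto simp: lipschitz_on_def)
  then have "compact (f ` S)" by (intro compact_continuous_image lipschitz_on_continuous_on S)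
  then have "f ` S \<in> sets borel" "S \<in> sets borel" using S by (auto simp: borel_compact)
  then show ?thesis using emeasure_isometric_image[OF dim _ _ iso] by (simp add: measure_def)
qed

text \<open>The determinant formula for images under linear maps is available only for well-ordered index types.
  The type \<open>'a rank\<close> is a well-ordered copy of the finite type \<open>'a\<close>.\<close>

typedef ('a::finite) rank = "{..<CARD('a)}"
  by (rule exI[of _ 0]) simp

instantiation rank :: (finite) linorder
begin
definition less_eq_rank :: "'a rank \<Rightarrow> 'a rank \<Rightarrow> bool" where "less_eq_rank x y \<longleftrightarrow> Rep_rank x \<le> Rep_rank y"
definition less_rank :: "'a rank \<Rightarrow> 'a rank \<Rightarrow> bool" where "less_rank x y \<longleftrightarrow> Rep_rank x < Rep_rank y"
instance by standard (auto simp: less_eq_rank_def less_rank_def Rep_rank_inject)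
end

instance rank :: (finite) wellorder
proof
  fix Q :: "'a rank \<Rightarrow> bool" and a
  assume step: "\<And>x. (\<And>y. y < x \<Longrightarrow> Q y) \<Longrightarrow> Q x"
  have "\<forall>a. Rep_rank a = n \<longrightarrow> Q a" for n
  proof (induction n rule: less_induct)
    case (less n)
    show ?case
    proof (intro allI impI)
      fix a :: "'a rank" assume a: "Rep_rank a = n"
      show "Q a" by (rule step) (use less a in \<open>auto simp: less_rank_def\<close>)
    qed
  qed
  then show "Q a" by blast
qed

lemma bij_betw_Rep_rank: "bij_betw Rep_rank (UNIV :: 'a::finite rank set) {..<CARD('a)}"
  by (simp add: bij_betw_def inj_on_def Rep_rank_inject type_definition.Rep_range[OF type_definition_rank])

instance rank :: (finite) finite
  by standard (use bij_betw_finite[OF bij_betw_Rep_rank] in simp)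

lemma card_rank: "CARD('a::finite rank) = CARD('a)"
  using bij_betw_same_card[OF bij_betw_Rep_rank] by simp

text \<open>Leibniz's formula: conjugation by \<psi> is a bijection of the permutations that
  preserves the sign.\<close>

lemma det_reindex:
  fixes A :: "real^'n^'n" and \<psi> :: "'k::finite \<Rightarrow> 'n::finite"
  assumes "bij \<psi>"
  shows "det (\<chi> i j. A $ \<psi> i $ \<psi> j :: real^'k^'k) = det A"
proof -
  have inj: "inj \<psi>" using assms by (simp add: bij_is_inj)
  have inv: "bij_betw (inv \<psi>) UNIV UNIV" using bij_imp_bij_inv[OF assms] by simp
  let ?m = "map_permutation (UNIV :: 'k set) \<psi>"
  have m: "?m p (\<psi> i) = \<psi> (p i)" for p i
    using inj assms by (simp add: map_permutation_def restrict_id_def bij_is_surj)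
  have "det (\<chi> i j. A $ \<psi> i $ \<psi> j :: real^'k^'k) = (\<Sum>p | p permutes UNIV. of_int (sign p) * (\<Prod>i\<in>UNIV. A $ \<psi> i $ \<psi> (p i)))"
    by (simp add: det_def)
  also have "\<dots> = (\<Sum>p | p permutes UNIV. of_int (sign (?m p)) * (\<Prod>i\<in>UNIV. A $ \<psi> i $ ?m p (\<psi> i)))"
    using inj by (intro sum.cong) (auto simp: sign_map_permutation m)
  also have "\<dots> = (\<Sum>p | p permutes UNIV. of_int (sign (?m p)) * (\<Prod>i\<in>UNIV. A $ i $ ?m p i))"
    using prod.reindex_bij_betw[OF assms] by (intro sum.cong arg_cong2[where f="(*)"] refl) (auto simp: prod.reindex_bij_betw[OF assms, where g="\<lambda>i. A $ i $ ?m _ i"])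
  also have "\<dots> = (\<Sum>q | q permutes UNIV. of_int (sign q) * (\<Prod>i\<in>UNIV. A $ i $ q i))"
  proof (rule sum.reindex_bij_betw)
    show "bij_betw ?m {p. p permutes UNIV} {q. q permutes UNIV}"
    proof (rule bij_betw_byWitness[where f'="map_permutation UNIV (inv \<psi>)"])
      have 1: "map_permutation UNIV (inv \<psi>) (?m p) = p" if "p permutes UNIV" for p
        using that assms inj by (auto simp: map_permutation_def restrict_id_def fun_eq_iff bij_is_surj bij_imp_bij_inv surj_imp_inv_eq inv_inv_eq)
      have 2: "?m (map_permutation UNIV (inv \<psi>) q) = q" if "q permutes UNIV" for q
        using that assms inj by (auto simp: map_permutation_def restrict_id_def fun_eq_iff bij_is_surj bij_imp_bij_inv surj_f_inv_f inv_inv_eq)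
      show "\<forall>p\<in>{p. p permutes UNIV}. map_permutation UNIV (inv \<psi>) (?m p) = p" using 1 by auto
      show "\<forall>q\<in>{q. q permutes UNIV}. ?m (map_permutation UNIV (inv \<psi>) q) = q" using 2 by auto
      show "?m ` {p. p permutes UNIV} \<subseteq> {q. q permutes UNIV}"
        using assms by (auto intro!: map_permutation_permutes)
      show "map_permutation UNIV (inv \<psi>) ` {q. q permutes UNIV} \<subseteq> {p. p permutes UNIV}"
        using inv by (auto intro!: map_permutation_permutes)
    qed
  qed
  also have "\<dots> = det A" by (simp add: det_def)
  finally show ?thesis .
qed

text \<open>Renaming coordinates along \<psi> is an isometry onto the well-ordered copy, and the
  matrix of the transported map is the reindexed one, with the same determinant.\<close>

lemma measure_linear_image_compact:
  fixes f :: "real^'n \<Rightarrow> real^'n"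
  assumes f: "linear f" and S: "compact S"
  shows "measure lebesgue (f ` S) = \<bar>det (matrix f)\<bar> * measure lebesgue S"
proof -
  obtain \<psi> :: "'n rank \<Rightarrow> 'n" where \<psi>: "bij \<psi>"
    using finite_same_card_bij[of "UNIV :: 'n rank set" "UNIV :: 'n set"] card_rank[where 'a='n] by auto
  define \<Phi> :: "real^'n \<Rightarrow> real^'n rank" where "\<Phi> x = (\<chi> i. x $ \<psi> i)" for x
  define \<Phi>' :: "real^'n rank \<Rightarrow> real^'n" where "\<Phi>' x = (\<chi> i. x $ inv \<psi> i)" for x
  have lin: "linear \<Phi>" "linear \<Phi>'" by (auto simp: \<Phi>_def \<Phi>'_def linear_iff vec_eq_iff)
  have inv1: "\<Phi>' (\<Phi> x) = x" for x using \<psi> by (simp add: \<Phi>_def \<Phi>'_def vec_eq_iff bij_is_surj surj_f_inv_f)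
  have inv2: "\<Phi> (\<Phi>' x) = x" for x using \<psi> by (simp add: \<Phi>_def \<Phi>'_def vec_eq_iff bij_is_inj)
  have "norm (\<Phi> x) = norm x" for x
  proof -
    have "(\<Sum>i\<in>UNIV. (x $ \<psi> i)\<^sup>2) = (\<Sum>i\<in>UNIV. (x $ i)\<^sup>2)" by (rule sum.reindex_bij_betw[OF \<psi>])
    then show ?thesis by (simp add: norm_vec_def L2_set_def \<Phi>_def)
  qed
  then have dist: "dist (\<Phi> x) (\<Phi> y) = dist x y" for x y
    by (simp add: dist_norm linear_diff[OF lin(1), symmetric])
  have D: "DIM(real^'n) = DIM(real^'n rank)" using card_rank[where 'a='n] by simp
  define h where "h = \<Phi> \<circ> f \<circ> \<Phi>'"
  have h: "linear h" unfolding h_def by (intro linear_compose f lin)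
  have hb: "h ` \<Phi> ` S = \<Phi> ` f ` S" by (simp add: h_def image_image inv1)
  have cS: "compact (\<Phi> ` S)" "compact (f ` S)"
    using S f lin by (auto intro!: compact_continuous_image linear_continuous_on simp: linear_conv_bounded_linear)
  have "matrix h = (\<chi> i j. matrix f $ \<psi> i $ \<psi> j)"
  proof -
    have ax: "\<Phi>' (axis j 1) = axis (\<psi> j) 1" for j
      using \<psi> by (auto simp: \<Phi>'_def axis_def vec_eq_iff bij_is_inj bij_is_surj surj_f_inv_f)
    show ?thesis by (simp add: matrix_def h_def vec_eq_iff[of "\<chi> i j. _ i j"] \<Phi>_def ax)
  qed
  then have det: "det (matrix h) = det (matrix f)" by (simp add: det_reindex[OF \<psi>])
  have "measure lebesgue (f ` S) = measure lebesgue (\<Phi> ` f ` S)"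
    by (rule measure_isometric_image[OF D cS(2) dist, symmetric])
  also have "\<dots> = \<bar>det (matrix h)\<bar> * measure lebesgue (\<Phi> ` S)"
    unfolding hb[symmetric] by (rule measure_linear_image[OF h lmeasurable_compact[OF cS(1)]])
  also have "measure lebesgue (\<Phi> ` S) = measure lebesgue S"
    by (rule measure_isometric_image[OF D S dist])
  finally show ?thesis by (simp add: det)
qed

lemma transpose_eq_self_iff:
  fixes A :: "real^'n^'n"
  assumes "\<And>v w. v \<bullet> (A *v w) = w \<bullet> (A *v v)"
  shows "transpose A = A"
proof -
  have "A $ i $ j = A $ j $ i" for i j
    using assms[of "axis i 1" "axis j 1"]
    by (simp add: inner_axis' matrix_vector_mult_basis column_def)
  then show ?thesis by (simp add: transpose_def vec_eq_iff)
qed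

subsection \<open>Normals and curvature\<close>

locale C2_convex_body =
  fixes K :: "(real^'n) set"
  assumes card_ge_2: "CARD('n) \<ge> 2" and body: "convex_body K" and C2p: "C2_plus K"
begin

abbreviation "\<nu> \<equiv> outer_unit_normal K"
abbreviation "\<kappa> \<equiv> gauss_curvature K"
abbreviation "S \<equiv> frontier K"

lemma compactK: "compact K" and convexK: "convex K" and interiorK: "interior K \<noteq> {}"
  using body by (auto simp: convex_body_def)

lemma closedK: "closed K" by (rule compact_imp_closed[OF compactK])
lemma frontier_subset: "S \<subseteq> K" by (rule frontier_subset_closed[OF closedK])
lemma compact_frontier: "compact S" by (rule compact_frontier[OF compactK])
lemma closed_frontier: "closed S" by (rule compact_imp_closed[OF compact_frontier])
lemma K_nonempty: "K \<noteq> {}" using interiorK interior_subset by blast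

lemma curvature_pos: "x \<in> S \<Longrightarrow> \<kappa> x > 0" using C2p by (auto simp: C2_plus_def)

lemma chart0:
  assumes "x \<in> S"
  obtains U \<rho> G H where "C2_function U \<rho> G H" "x \<in> U" "\<forall>y\<in>U. G y \<noteq> 0" "S \<inter> U = {y\<in>U. \<rho> y = 0}"
proof -
  obtain U \<rho> G where U: "open U" "x \<in> U" "C2_on U \<rho> G" "\<forall>y\<in>U. G y \<noteq> 0" "S \<inter> U = {y\<in>U. \<rho> y = 0}"
    using C2p assms unfolding C2_plus_def C2_hypersurface_def by blast
  from U(3) obtain H where "(\<forall>y\<in>U. (\<rho> has_derivative (\<lambda>v. G y \<bullet> v)) (at y)) \<and>
        (\<forall>y\<in>U. (G has_derivative (\<lambda>v. H y *v v)) (at y)) \<and> continuous_on U H"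
    unfolding C2_on_def by blast
  then have "C2_function U \<rho> G H" using U(1) by unfold_locales auto
  then show ?thesis using that U by blast
qed

lemma chart_tangent:
  assumes "C2_function U \<rho> G H" "x \<in> U" "G x \<noteq> 0" "S \<inter> U = {y\<in>U. \<rho> y = 0}" "x \<in> S" "G x \<bullet> v = 0" "\<epsilon> > 0"
  shows "\<exists>t0>0. \<forall>t. 0 < t \<and> t < t0 \<longrightarrow> (\<exists>y\<in>S. norm (y - (x + t *\<^sub>R v)) \<le> \<epsilon> * t)"
proof -
  interpret C2_function U \<rho> G H by fact
  have "\<rho> x = 0" using assms by blast
  then obtain t0 where t0: "t0 > 0" "\<And>t. 0 < t \<Longrightarrow> t < t0 \<Longrightarrow> \<exists>y\<in>U. \<rho> y = 0 \<and> norm (y - (x + t *\<^sub>R v)) \<le> \<epsilon> * t"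
    using zero_set_tangent[OF U assms(2) cont\<rho> der[OF assms(2)] _ assms(3,6,7)] by metis
  then show ?thesis using assms(4) by blast
qed

text \<open>Membership of \<open>u\<close> in the normal cone of \<open>K\<close> at
  \<open>x\<close>, without normalisation.\<close>

definition supports :: "real^'n \<Rightarrow> real^'n \<Rightarrow> bool" where
  "supports u x \<longleftrightarrow> (\<forall>y\<in>K. u \<bullet> (y - x) \<le> 0)"

text \<open>A small step from \<open>y\<close> in direction \<open>u\<close> stays in
  \<open>K\<close>, which rules out equality.\<close>

lemma supports_interior:
  assumes "supports u x" "u \<noteq> 0" "y \<in> interior K"
  shows "u \<bullet> (y - x) < 0"
proof -
  obtain e where e: "e > 0" "cball y e \<subseteq> K" using assms(3) mem_interior_cball by blast
  define w where "w = y + (e / norm u) *\<^sub>R u"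
  have "w \<in> K" using e assms(2) by (intro subsetD[OF e(2)]) (simp add: w_def dist_norm)
  then have "u \<bullet> (w - x) \<le> 0" using assms(1) by (simp add: supports_def)
  moreover have "u \<bullet> (w - x) = u \<bullet> (y - x) + e * norm u"
    using assms(2) by (simp add: w_def inner_diff_right inner_add_right power2_norm_eq_inner[symmetric] power2_eq_square)
  ultimately show ?thesis using e(1) assms(2) by (smt (verit) mult_pos_pos zero_less_norm_iff)
qed

lemma supports_exists:
  assumes "x \<in> S"
  obtains u where "norm u = 1" "supports u x"
proof -
  have "x \<in> K" using assms frontier_subset by blast
  moreover have "x \<notin> rel_interior K"
    using assms interiorK by (auto simp: frontier_def rel_interior_nonempty_interior)
  ultimately obtain a where a: "a \<noteq> 0" "\<And>y. y \<in> K \<Longrightarrow> a \<bullet> x \<le> a \<bullet> y"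
    using supporting_hyperplane_rel_boundary[OF convexK] by metis
  show ?thesis
  proof
    show "norm (- (a /\<^sub>R norm a)) = 1" using a by simp
    show "supports (- (a /\<^sub>R norm a)) x" using a by (auto simp: supports_def inner_diff_right mult_left_mono)
  qed
qed

text \<open>Boundary points near \<open>x + t *\<^sub>R v\<close> show that
  \<open>u \<bullet> v \<le> 0\<close> for every tangent \<open>v\<close>. The same holds for
  \<open>- v\<close>, so \<open>u\<close> is orthogonal to the tangent hyperplane.\<close>

lemma supports_parallel:
  assumes ch: "C2_function U \<rho> G H" "x \<in> U" "G x \<noteq> 0" "S \<inter> U = {y\<in>U. \<rho> y = 0}" "x \<in> S"
    and u: "supports u x"
  shows "u = (u \<bullet> G x / (G x \<bullet> G x)) *\<^sub>R G x"
proof -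
  have le: "u \<bullet> v \<le> 0" if "G x \<bullet> v = 0" for v
  proof -
    have est: "u \<bullet> v \<le> norm u * \<epsilon>" if e: "\<epsilon> > 0" for \<epsilon>
    proof -
      obtain t0 where t0: "t0 > 0" "\<And>t. 0 < t \<Longrightarrow> t < t0 \<Longrightarrow> \<exists>y\<in>S. norm (y - (x + t *\<^sub>R v)) \<le> \<epsilon> * t"
        using chart_tangent[OF ch \<open>G x \<bullet> v = 0\<close> e] by blast
      define t where "t = t0 / 2"
      have t: "0 < t" "t < t0" using t0 by (auto simp: t_def)
      obtain y where y: "y \<in> S" "norm (y - (x + t *\<^sub>R v)) \<le> \<epsilon> * t" using t0(2)[OF t] by blast
      have "u \<bullet> (y - x) \<le> 0" using u y frontier_subset by (auto simp: supports_def)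
      moreover have "u \<bullet> (y - x) = t * (u \<bullet> v) + u \<bullet> (y - (x + t *\<^sub>R v))"
        by (simp add: inner_diff_right inner_add_right)
      ultimately have "t * (u \<bullet> v) \<le> - (u \<bullet> (y - (x + t *\<^sub>R v)))" by linarith
      also have "\<dots> \<le> norm u * norm (y - (x + t *\<^sub>R v))"
        using Cauchy_Schwarz_ineq2[of u "y - (x + t *\<^sub>R v)"] by linarith
      also have "\<dots> \<le> norm u * (\<epsilon> * t)" using y by (intro mult_left_mono) auto
      finally have "t * (u \<bullet> v) \<le> t * (norm u * \<epsilon>)" by (simp add: mult_ac)
      then show ?thesis using t by simp
    qed
    have "((\<lambda>\<epsilon>. norm u * \<epsilon>) \<longlongrightarrow> norm u * 0) (at_right 0)" by (intro tendsto_intros)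
    moreover have "\<forall>\<^sub>F \<epsilon> in at_right 0. u \<bullet> v \<le> norm u * \<epsilon>"
      using eventually_at_right_less[of 0] by (rule eventually_mono) (auto intro: est)
    ultimately show ?thesis by (intro tendsto_lowerbound[where F="at_right 0"]) auto
  qed
  define c where "c = u \<bullet> G x / (G x \<bullet> G x)"
  define v where "v = u - c *\<^sub>R G x"
  have gg: "G x \<bullet> G x > 0" using ch(3) by simp
  have gv: "G x \<bullet> v = 0" using gg by (simp add: v_def c_def inner_diff_right inner_commute)
  have "u \<bullet> v = 0" using le[OF gv] le[of "- v"] gv by simp
  then have "v \<bullet> v = 0" using gv by (simp add: v_def inner_diff_left)
  then show ?thesis by (simp add: v_def c_def)
qed

text \<open>Any two unit normals are multiples of the gradient, so they agree up to sign; an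
  interior point excludes the opposite sign. This makes the definite description in
  \<open>outer_unit_normal\<close> meaningful.\<close>

lemma normal_ex1:
  assumes "x \<in> S"
  shows "\<exists>!u. norm u = 1 \<and> (\<forall>y\<in>K. u \<bullet> (y - x) \<le> 0)"
proof -
  obtain u where u: "norm u = 1" "supports u x" using supports_exists[OF assms] by blast
  obtain U \<rho> G H where ch0: "C2_function U \<rho> G H" "x \<in> U" "\<forall>y\<in>U. G y \<noteq> 0" "S \<inter> U = {y\<in>U. \<rho> y = 0}"
    by (rule chart0[OF assms]) (rule that)
  note ch = ch0(1,2) bspec[OF ch0(3) ch0(2)] ch0(4)
  obtain p where p: "p \<in> interior K" using interiorK by blast
  have uniq: "u' = u" if u': "norm u' = 1" "supports u' x" for u'
  proof -
    define c where "c = u \<bullet> G x / (G x \<bullet> G x)"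
    define c' where "c' = u' \<bullet> G x / (G x \<bullet> G x)"
    have cc: "u = c *\<^sub>R G x" "u' = c' *\<^sub>R G x"
      unfolding c_def c'_def by (rule supports_parallel[OF ch assms u(2)], rule supports_parallel[OF ch assms u'(2)])
    then have "\<bar>c\<bar> * norm (G x) = \<bar>c'\<bar> * norm (G x)" using u u' by simp
    then have "\<bar>c\<bar> = \<bar>c'\<bar>" using ch(3) by simp
    moreover have "c' \<noteq> - c"
    proof
      assume "c' = - c"
      then have "u' = - u" using cc by simp
      moreover have "u \<bullet> (p - x) < 0" "u' \<bullet> (p - x) < 0"
        using u u' by (auto intro!: supports_interior p)
      ultimately show False by simp
    qed
    ultimately have "c' = c" by linarith
    then show ?thesis using cc by simp
  qed
  show ?thesis
  proof (rule ex1I[of _ u])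
    show "norm u = 1 \<and> (\<forall>y\<in>K. u \<bullet> (y - x) \<le> 0)" using u by (simp add: supports_def)
    show "u' = u" if "norm u' = 1 \<and> (\<forall>y\<in>K. u' \<bullet> (y - x) \<le> 0)" for u'
      using that by (intro uniq) (auto simp: supports_def)
  qed
qed

lemma normal_props:
  assumes "x \<in> S"
  shows "norm (\<nu> x) = 1 \<and> (\<forall>y\<in>K. \<nu> x \<bullet> (y - x) \<le> 0)"
proof -
  let ?Q = "\<lambda>u. norm u = 1 \<and> (\<forall>y\<in>K. u \<bullet> (y - x) \<le> 0)"
  have "?Q (THE u. ?Q u)" by (rule theI'[of ?Q]) (rule normal_ex1[OF assms])
  then show ?thesis unfolding outer_unit_normal_def .
qed

lemma normal_unit: "x \<in> S \<Longrightarrow> norm (\<nu> x) = 1"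
  using normal_props by simp

lemma normal_le: "x \<in> S \<Longrightarrow> y \<in> K \<Longrightarrow> \<nu> x \<bullet> (y - x) \<le> 0"
  using normal_props by simp

lemma normal_eqI:
  assumes "x \<in> S" "norm u = 1" "\<And>y. y \<in> K \<Longrightarrow> u \<bullet> (y - x) \<le> 0"
  shows "\<nu> x = u"
  unfolding outer_unit_normal_def by (rule the1_equality[OF normal_ex1[OF assms(1)]]) (use assms in auto)

lemma normal_supports: "x \<in> S \<Longrightarrow> supports (\<nu> x) x" by (auto simp: supports_def normal_le)

text \<open>The inequalities that characterise the normal are closed conditions in point and normal,
  so the graph is closed; its values lie in a compact sphere.\<close>

lemma continuous_on_normal: "continuous_on S \<nu>"
proof (rule continuous_from_closed_graph[of "sphere 0 1"])
  show "compact (sphere (0::real^'n) 1)" by simp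
  show "\<nu> \<in> S \<rightarrow> sphere 0 1" using normal_unit by auto
  have "(\<lambda>x. (x, \<nu> x)) ` S = (S \<times> sphere 0 1) \<inter> (\<Inter>y\<in>K. {p. snd p \<bullet> (y - fst p) \<le> 0})"
  proof (intro equalityI subsetI)
    fix p assume "p \<in> (S \<times> sphere 0 1) \<inter> (\<Inter>y\<in>K. {p. snd p \<bullet> (y - fst p) \<le> 0})"
    then have p: "fst p \<in> S" "norm (snd p) = 1" "\<And>y. y \<in> K \<Longrightarrow> snd p \<bullet> (y - fst p) \<le> 0" by auto
    then have "\<nu> (fst p) = snd p" by (intro normal_eqI)
    then show "p \<in> (\<lambda>x. (x, \<nu> x)) ` S" using p(1) by (intro image_eqI[of _ _ "fst p"]) auto
  qed (auto simp: normal_unit normal_le)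
  moreover have "closed (\<Inter>y\<in>K. {p :: (real^'n) \<times> (real^'n). snd p \<bullet> (y - fst p) \<le> 0})"
    by (intro closed_INT ballI closed_Collect_le continuous_intros)
  ultimately show "closed ((\<lambda>x. (x, \<nu> x)) ` S)"
    by (simp add: closed_Int closed_Times closed_frontier)
qed

text \<open>A gradient is only parallel to the normal. Multiplying \<rho> by a suitable constant
  makes it equal to the normal at \<open>y0\<close>, and continuity then fixes the sign
  nearby.\<close>

lemma good_chart:
  assumes y0: "y0 \<in> S"
  obtains \<delta> \<rho> G H where "\<delta> > 0" "C2_function (ball y0 \<delta>) \<rho> G H" "\<And>y. y \<in> ball y0 \<delta> \<Longrightarrow> G y \<noteq> 0"
    "S \<inter> ball y0 \<delta> = {y\<in>ball y0 \<delta>. \<rho> y = 0}" "\<And>z. z \<in> S \<Longrightarrow> z \<in> ball y0 \<delta> \<Longrightarrow> \<nu> z = G z /\<^sub>R norm (G z)"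
    "G y0 = \<nu> y0"
proof -
  obtain U \<rho> G H where ch0: "C2_function U \<rho> G H" "y0 \<in> U" "\<forall>y\<in>U. G y \<noteq> 0" "S \<inter> U = {y\<in>U. \<rho> y = 0}"
    by (rule chart0[OF y0]) (rule that)
  note ch = ch0(1,2) bspec[OF ch0(3)] ch0(4)
  interpret C2_function U \<rho> G H by fact
  define c where "c = \<nu> y0 \<bullet> G y0 / (G y0 \<bullet> G y0)"
  have c: "\<nu> y0 = c *\<^sub>R G y0"
    unfolding c_def by (rule supports_parallel[OF ch(1,2) ch(3)[OF ch(2)] ch(4) y0 normal_supports[OF y0]])
  have c0: "c \<noteq> 0" using c normal_unit[OF y0] by auto
  \<comment> \<open>This product is 1 at \<open>y0\<close>; as long as it stays positive, the
    normalised gradient is the outer and not the inner normal.\<close>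
  have "continuous_on (S \<inter> U) (\<lambda>z. \<nu> z \<bullet> (c *\<^sub>R G z))"
    by (intro continuous_intros continuous_on_subset[OF continuous_on_normal] continuous_on_subset[OF contG]) auto
  then obtain d where d: "d > 0" "\<And>z. z \<in> S \<inter> U \<Longrightarrow> dist z y0 < d \<Longrightarrow> dist (\<nu> z \<bullet> (c *\<^sub>R G z)) (\<nu> y0 \<bullet> (c *\<^sub>R G y0)) < 1"
    using y0 ch(2) unfolding continuous_on_iff by (metis IntI zero_less_one)
  have one: "\<nu> y0 \<bullet> (c *\<^sub>R G y0) = 1" using c normal_unit[OF y0] by (metis norm_eq_1)
  obtain r where r: "r > 0" "ball y0 r \<subseteq> U" using U ch(2) open_contains_ball by blast
  define \<delta> where "\<delta> = min d r"
  have sub: "ball y0 \<delta> \<subseteq> U" using r by (auto simp: \<delta>_def)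
  show ?thesis
  proof (rule that[of \<delta> "\<lambda>y. c * \<rho> y" "\<lambda>y. c *\<^sub>R G y" "\<lambda>y. c *\<^sub>R H y"])
    show "\<delta> > 0" using d r by (simp add: \<delta>_def)
    show "C2_function (ball y0 \<delta>) (\<lambda>y. c * \<rho> y) (\<lambda>y. c *\<^sub>R G y) (\<lambda>y. c *\<^sub>R H y)"
    proof
      fix y assume "y \<in> ball y0 \<delta>"
      then have y: "y \<in> U" using sub by blast
      show "((\<lambda>y. c * \<rho> y) has_derivative (\<lambda>v. (c *\<^sub>R G y) \<bullet> v)) (at y)"
        using has_derivative_mult_right[OF der[OF y], of c] by simp
      show "((\<lambda>y. c *\<^sub>R G y) has_derivative (\<lambda>v. (c *\<^sub>R H y) *v v)) (at y)"
        using has_derivative_scaleR_right[OF der2[OF y], of c] by (simp add: scaleR_matrix_vector_assoc)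
    qed (auto intro!: continuous_intros continuous_on_subset[OF contH sub])
    show "c *\<^sub>R G y \<noteq> 0" if "y \<in> ball y0 \<delta>" for y using ch(3) sub that c0 by auto
    show "S \<inter> ball y0 \<delta> = {y \<in> ball y0 \<delta>. c * \<rho> y = 0}" using ch(4) sub c0 by auto
    show "\<nu> z = (c *\<^sub>R G z) /\<^sub>R norm (c *\<^sub>R G z)" if z: "z \<in> S" "z \<in> ball y0 \<delta>" for z
    proof -
      have zU: "z \<in> U" using z sub by blast
      define a where "a = \<nu> z \<bullet> G z / (G z \<bullet> G z)"
      have a: "\<nu> z = a *\<^sub>R G z"
        unfolding a_def by (rule supports_parallel[OF ch(1) zU ch(3)[OF zU] ch(4) z(1) normal_supports[OF z(1)]])
      have "\<bar>\<nu> z \<bullet> (c *\<^sub>R G z) - 1\<bar> < 1"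
        using d(2)[of z] z zU unfolding one by (auto simp: \<delta>_def dist_commute dist_real_def)
      then have "\<nu> z \<bullet> (c *\<^sub>R G z) > 0" by linarith
      moreover have "\<nu> z \<bullet> (c *\<^sub>R G z) = (a * c) * (G z \<bullet> G z)" by (simp add: a)
      ultimately have "a * c > 0" by (metis inner_ge_zero mult_nonpos_nonneg not_le)
      moreover have an: "\<bar>a\<bar> * norm (G z) = 1" using normal_unit[OF z(1)] a by simp
      ultimately have "a = c / (\<bar>c\<bar> * norm (G z))"
      proof -
        have "\<bar>a\<bar> = 1 / norm (G z)" using an ch(3)[OF zU] by (simp add: field_simps)
        moreover have "a = \<bar>a\<bar> * (c / \<bar>c\<bar>)" using \<open>a * c > 0\<close> by (auto simp: zero_less_mult_iff abs_if)
        ultimately show ?thesis by simp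
      qed
      then show ?thesis using a by (simp add: divide_inverse mult_ac)
    qed
    show "c *\<^sub>R G y0 = \<nu> y0" using c by simp
  qed
qed

section \<open>Gauss curvature in a chart\<close>

text \<open>The derivative of \<open>G / norm G\<close> at a point with gradient \<open>g\<close>
  and Hessian \<open>A\<close>: the vector \<open>A *v v\<close> is projected orthogonally to
  \<open>g\<close> and rescaled.\<close>

definition normal_derivative :: "real^'n \<Rightarrow> real^'n^'n \<Rightarrow> real^'n \<Rightarrow> real^'n" where
  "normal_derivative g A v = (A *v v - ((g /\<^sub>R norm g) \<bullet> (A *v v)) *\<^sub>R (g /\<^sub>R norm g)) /\<^sub>R norm g"

text \<open>\<open>frechet_derivative\<close> within the boundary may differ from the derivative of
  the normalised gradient, but not on tangent vectors, and \<open>gauss_curvature\<close> evaluates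
  it only there.\<close>

lemma curvature_chart:
  assumes ch: "C2_function (ball y0 \<delta>) \<rho> G H" "\<And>y. y \<in> ball y0 \<delta> \<Longrightarrow> G y \<noteq> 0"
    "S \<inter> ball y0 \<delta> = {y\<in>ball y0 \<delta>. \<rho> y = 0}" "\<And>z. z \<in> S \<Longrightarrow> z \<in> ball y0 \<delta> \<Longrightarrow> \<nu> z = G z /\<^sub>R norm (G z)"
    and z: "z \<in> S" "z \<in> ball y0 \<delta>"
  shows "\<kappa> z = det (matrix (\<lambda>v. normal_derivative (G z) (H z) (v - (v \<bullet> \<nu> z) *\<^sub>R \<nu> z) + (v \<bullet> \<nu> z) *\<^sub>R \<nu> z))"
proof -
  interpret C2_function "ball y0 \<delta>" \<rho> G H by fact
  have g0: "G z \<noteq> 0" using ch(2) z(2) by blast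
  have "((\<lambda>y. inverse (norm (G y)) *\<^sub>R G y) has_derivative normal_derivative (G z) (H z)) (at z)"
  proof -
    have "((\<lambda>y. norm (G y)) has_derivative (\<lambda>v. sgn (G z) \<bullet> (H z *v v))) (at z)"
      using has_derivative_compose[OF der2[OF z(2)] has_derivative_norm[OF g0]] by (simp add: inner_commute)
    then have "((\<lambda>y. inverse (norm (G y))) has_derivative
       (\<lambda>v. - (inverse (norm (G z)) * (sgn (G z) \<bullet> (H z *v v)) * inverse (norm (G z))))) (at z)"
      using g0 by (intro Deriv.has_derivative_inverse) auto
    from has_derivative_scaleR[OF this der2[OF z(2)]]
    show ?thesis
      by (rule has_derivative_eq_rhs)
        (auto simp: fun_eq_iff normal_derivative_def sgn_div_norm algebra_simps)
  qed
  then have "((\<lambda>y. G y /\<^sub>R norm (G y)) has_derivative normal_derivative (G z) (H z)) (at z within S)"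
    by (rule has_derivative_at_withinI)
  then have D1: "(\<nu> has_derivative normal_derivative (G z) (H z)) (at z within S)"
  proof (rule has_derivative_transform_within)
    show "0 < \<delta> - dist y0 z" using z by simp
    fix y assume "y \<in> S" "dist y z < \<delta> - dist y0 z"
    then show "G y /\<^sub>R norm (G y) = \<nu> y"
      using ch(4)[of y] dist_triangle[of y0 y z] by (simp add: dist_commute)
  qed (rule z(1))
  define D where "D = frechet_derivative \<nu> (at z within S)"
  have D2: "(\<nu> has_derivative D) (at z within S)"
    unfolding D_def using D1 by (metis differentiable_def frechet_derivative_works)
  have "D v = normal_derivative (G z) (H z) v" if "G z \<bullet> v = 0" for v
    by (rule has_derivative_within_unique_tangent[OF D2 D1]) (rule chart_tangent[OF ch(1) z(2) g0 ch(3) z(1) that])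
  moreover have "G z \<bullet> (v - (v \<bullet> \<nu> z) *\<^sub>R \<nu> z) = 0" for v
    using g0 by (simp add: ch(4)[OF z] inner_diff_right power2_norm_eq_inner[symmetric] power2_eq_square inner_commute field_simps)
  ultimately show ?thesis by (simp add: gauss_curvature_def Let_def D_def[symmetric])
qed

text \<open>In a chart the curvature is a determinant whose entries depend continuously on gradient,
  Hessian and normal.\<close>

lemma continuous_on_curvature: "continuous_on S \<kappa>"
  unfolding continuous_on_eq_continuous_within
proof
  fix y0 assume y0: "y0 \<in> S"
  obtain \<delta> \<rho> G H where \<delta>: "\<delta> > 0" and ch: "C2_function (ball y0 \<delta>) \<rho> G H" "\<And>y. y \<in> ball y0 \<delta> \<Longrightarrow> G y \<noteq> 0"
    "S \<inter> ball y0 \<delta> = {y\<in>ball y0 \<delta>. \<rho> y = 0}" "\<And>z. z \<in> S \<Longrightarrow> z \<in> ball y0 \<delta> \<Longrightarrow> \<nu> z = G z /\<^sub>R norm (G z)"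
    "G y0 = \<nu> y0"
    by (rule good_chart[OF y0]) (rule that; (assumption | blast))
  interpret C2_function "ball y0 \<delta>" \<rho> G H by fact
  let ?T = "S \<inter> ball y0 \<delta>"
  have cn: "continuous_on ?T \<nu>" by (rule continuous_on_subset[OF continuous_on_normal]) auto
  have cG: "continuous_on ?T G" by (rule continuous_on_subset[OF contG]) auto
  have cH: "continuous_on ?T H" by (rule continuous_on_subset[OF contH]) auto
  have mv: "continuous_on ?T (\<lambda>z. H z *v w z)" if "continuous_on ?T w" for w
    unfolding matrix_vector_mult_def by (intro continuous_intros cH that)
  define F where "F z e = normal_derivative (G z) (H z) (e - (e \<bullet> \<nu> z) *\<^sub>R \<nu> z) + (e \<bullet> \<nu> z) *\<^sub>R \<nu> z" for z e
  have "continuous_on ?T (\<lambda>z. F z e)" for e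
    unfolding normal_derivative_def F_def using ch(2)
    by (intro continuous_intros mv cn cG) auto
  then have "continuous_on ?T (\<lambda>z. F z e $ i)" for e i by (rule continuous_on_component)
  then have "continuous_on ?T (\<lambda>z. det (matrix (F z)))"
    unfolding det_def matrix_def vec_lambda_beta
    by (intro continuous_on_sum continuous_on_mult continuous_on_prod continuous_on_const)
  then have "continuous_on ?T \<kappa>"
    by (rule continuous_on_eq) (use curvature_chart[OF ch(1-4)] in \<open>simp add: F_def[abs_def]\<close>)
  then have "continuous (at y0 within ?T) \<kappa>" using y0 \<delta> by (simp add: continuous_on_eq_continuous_within)
  moreover have "at y0 within ?T = at y0 within S"
    by (rule at_within_nhd[of _ "ball y0 \<delta>"]) (use \<delta> in auto)
  ultimately show "continuous (at y0 within S) \<kappa>" by simp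
qed

end

subsection \<open>Tangential coordinates\<close>

text \<open>Splits the space orthogonally into the hyperplane orthogonal to \<open>u\<close> and the
  line of \<open>u\<close>. \<open>J\<close> is an isometric parametrisation of the hyperplane and
  \<open>P\<close> the orthogonal projection in these coordinates. A separate type for the
  hyperplane makes its Lebesgue measure available.\<close>

locale frame =
  fixes J :: "real^'m \<Rightarrow> real^'n" and P :: "real^'n \<Rightarrow> real^'m" and u :: "real^'n"
  assumes linJ: "linear J" and linP: "linear P"
    and normJ: "norm (J p) = norm p" and Ju: "J p \<bullet> u = 0" and PJ: "P (J p) = p" and Pu: "P u = 0"
    and decomp: "v = J (P v) + (v \<bullet> u) *\<^sub>R u" and unit_u: "norm u = 1"
    and card_frame: "CARD('n) = Suc (CARD('m))"

lemma inner_transpose_mult: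
  fixes A :: "real^'n^'m"
  shows "v \<bullet> (transpose A *v w) = (A *v v) \<bullet> w"
  by (metis dot_lmul_matrix inner_commute transpose_matrix_vector)

lemma frame_exists:
  fixes u :: "real^'n"
  assumes u: "norm u = 1" and card: "CARD('n) = Suc (CARD('m))"
  obtains J :: "real^'m \<Rightarrow> real^'n" and P where "frame J P u"
proof -
  let ?T = "{v. u \<bullet> v = 0}"
  have u0: "u \<noteq> 0" using u by auto
  have d: "dim (UNIV :: (real^'m) set) = dim ?T" using dim_hyperplane[OF u0] card by simp
  obtain f g where fg: "linear f" "linear g" "f ` (UNIV :: (real^'m) set) = ?T" "g ` ?T = UNIV"
      "\<And>x. x \<in> (UNIV :: (real^'m) set) \<Longrightarrow> norm (f x) = norm x" "\<And>x. x \<in> ?T \<Longrightarrow> norm (g x) = norm x"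
      "\<And>x. x \<in> (UNIV :: (real^'m) set) \<Longrightarrow> g (f x) = x" "\<And>x. x \<in> ?T \<Longrightarrow> f (g x) = x"
    by (rule isometries_subspaces[OF subspace_UNIV subspace_hyperplane d]) (rule that)
  have uu: "u \<bullet> u = 1" using u by (simp add: norm_eq_1)
  define P where "P v = g (v - (v \<bullet> u) *\<^sub>R u)" for v
  have "frame f P u"
  proof (rule frame.intro)
    show "linear P" unfolding P_def[abs_def]
      by (intro linear_compose[OF _ fg(2), unfolded o_def] linear_compose_sub linear_ident)
         (auto simp: linear_iff inner_add_left scaleR_add_left)
    fix p and v :: "real^'n"
    have fp: "u \<bullet> f p = 0" using fg(3) by auto
    then show "f p \<bullet> u = 0" by (simp add: inner_commute)
    then show "P (f p) = p" using fg(7) by (simp add: P_def)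
    show "P u = 0" using uu linear_0[OF fg(2)] by (simp add: P_def)
    have "f (P v) = v - (v \<bullet> u) *\<^sub>R u" unfolding P_def using uu by (intro fg(8)) (simp add: inner_diff_right inner_commute)
    then show "v = f (P v) + (v \<bullet> u) *\<^sub>R u" by simp
  qed (use fg u card in auto)
  then show ?thesis by (rule that)
qed

context frame
begin

lemma norm_decomp: "(norm v)\<^sup>2 = (norm (P v))\<^sup>2 + (v \<bullet> u)\<^sup>2"
proof -
  have "(norm v)\<^sup>2 = (norm (J (P v) + (v \<bullet> u) *\<^sub>R u))\<^sup>2" using decomp[of v] by simp
  also have "\<dots> = (norm (J (P v)))\<^sup>2 + (norm ((v \<bullet> u) *\<^sub>R u))\<^sup>2"
    by (rule norm_add_Pythagorean) (simp add: orthogonal_def Ju)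
  finally show ?thesis by (simp add: normJ unit_u)
qed

lemma normP_le: "norm (P v) \<le> norm v"
proof -
  have "(norm (P v))\<^sup>2 \<le> (norm v)\<^sup>2" by (simp add: norm_decomp)
  then show ?thesis by (simp add: power2_le_iff_abs_le)
qed

lemma innerJ: "J p \<bullet> J q = p \<bullet> q"
proof -
  have "(norm (J p + J q))\<^sup>2 = (norm (p + q))\<^sup>2" by (simp add: normJ linear_add[OF linJ, symmetric])
  then show ?thesis by (simp add: power2_norm_eq_inner[symmetric] dot_norm normJ)
qed

lemma innerP: "p \<bullet> P w = J p \<bullet> w"
proof -
  have "J p \<bullet> w = J p \<bullet> (J (P w) + (w \<bullet> u) *\<^sub>R u)" using decomp[of w] by simp
  also have "\<dots> = p \<bullet> P w" by (simp add: inner_add_right innerJ Ju)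
  finally show ?thesis by simp
qed

lemma uu: "u \<bullet> u = 1" using unit_u by (simp add: norm_eq_1)

text \<open>The isometry from the product of hyperplane and line, through which cylinders get
  product measure.\<close>

definition Psi :: "(real^'m) \<times> real \<Rightarrow> real^'n" where "Psi x = J (fst x) + snd x *\<^sub>R u"

lemma Psi_inverse: "Psi (P v, v \<bullet> u) = v" using decomp[of v] by (simp add: Psi_def)

lemma P_Psi: "P (Psi x) = fst x"
  by (simp add: Psi_def linear_add[OF linP] linear_scale[OF linP] PJ Pu)

lemma inner_Psi: "Psi x \<bullet> u = snd x" by (simp add: Psi_def inner_add_left Ju uu)

lemma linear_Psi: "linear Psi"
  unfolding Psi_def[abs_def]
  by (auto simp: linear_iff linear_add[OF linJ] linear_scale[OF linJ] algebra_simps)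

lemma norm_Psi: "norm (Psi x) = norm x"
proof -
  have "(norm (Psi x))\<^sup>2 = (norm x)\<^sup>2"
    unfolding norm_decomp[of "Psi x"] P_Psi inner_Psi by (simp add: norm_prod_def)
  then show ?thesis by simp
qed

lemma dist_Psi: "dist (Psi x) (Psi y) = dist x y"
  by (simp add: dist_norm linear_diff[OF linear_Psi, symmetric] norm_Psi)

lemma continuous_PPsi: "continuous_on A P" "continuous_on C Psi"
  using linear_continuous_on linP linear_Psi linear_conv_bounded_linear by blast+

lemma Psi_image: "Psi ` X = (\<lambda>v. (P v, v \<bullet> u)) -` X"
  using Psi_inverse P_Psi inner_Psi by (auto simp: image_iff) (metis prod.collapse)

lemma Psi_image_borel: "X \<in> sets borel \<Longrightarrow> Psi ` X \<in> sets borel"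
  unfolding Psi_image
  by (intro measurable_sets_borel[of _ borel] borel_measurable_continuous_onI continuous_intros continuous_PPsi)

lemma emeasure_Psi_image:
  assumes "X \<in> sets borel"
  shows "emeasure lborel (Psi ` X) = emeasure lborel X"
proof -
  have D: "DIM((real^'m) \<times> real) = DIM(real^'n)" using card_frame by simp
  show ?thesis by (rule emeasure_isometric_image[OF D assms Psi_image_borel[OF assms] dist_Psi])
qed

lemma emeasure_cylinder:
  assumes "X \<in> sets borel" "T \<in> sets borel"
  shows "emeasure lborel (Psi ` (X \<times> T)) = emeasure lborel X * emeasure lborel T"
proof -
  have "X \<times> T \<in> sets (borel :: ((real^'m) \<times> real) measure)" using assms by (simp add: borel_Times)
  then have "emeasure lborel (Psi ` (X \<times> T)) = emeasure lborel (X \<times> T)" by (rule emeasure_Psi_image)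
  also have "\<dots> = emeasure (lborel \<Otimes>\<^sub>M lborel) (X \<times> T)" by (simp add: lborel_prod)
  also have "\<dots> = emeasure lborel X * emeasure lborel T"
    using assms by (intro lborel.emeasure_pair_measure_Times) auto
  finally show ?thesis .
qed

lemma linear_block:
  fixes B :: "real^'m^'m"
  shows "linear (\<lambda>v. J (B *v P v) + (v \<bullet> u) *\<^sub>R u)"
proof (rule linearI)
  fix x y c
  show "J (B *v P (x + y)) + ((x + y) \<bullet> u) *\<^sub>R u = (J (B *v P x) + (x \<bullet> u) *\<^sub>R u) + (J (B *v P y) + (y \<bullet> u) *\<^sub>R u)"
    by (simp add: linear_add[OF linJ] linear_add[OF linP] matrix_vector_right_distrib inner_add_left scaleR_add_left)
  show "J (B *v P (c *\<^sub>R x)) + ((c *\<^sub>R x) \<bullet> u) *\<^sub>R u = c *\<^sub>R (J (B *v P x) + (x \<bullet> u) *\<^sub>R u)"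
    by (simp add: linear_scale[OF linJ] linear_scale[OF linP] matrix_vector_mult_scaleR scaleR_add_right)
qed

lemma inner_frame: "(J a + s *\<^sub>R u) \<bullet> (J b + t *\<^sub>R u) = a \<bullet> b + s * t"
  by (simp add: inner_add_left inner_add_right innerJ Ju uu inner_commute[of u "J b"])

text \<open>Read off from volumes: the map carries the cylinder over the unit ball to the cylinder
  over its image under \<open>B\<close>. This determines the determinant up to sign, which is enough
  since only its square is used.\<close>

lemma det_block:
  fixes B :: "real^'m^'m"
  shows "\<bar>det (matrix (\<lambda>v. J (B *v P v) + (v \<bullet> u) *\<^sub>R u))\<bar> = \<bar>det B\<bar>"
proof -
  define C where "C v = J (B *v P v) + (v \<bullet> u) *\<^sub>R u" for v
  have linC: "linear C"
    unfolding C_def[abs_def] by (rule linear_block)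
  have CPsi: "C (Psi (p, t)) = Psi (B *v p, t)" for p t
    unfolding C_def using P_Psi[of "(p,t)"] inner_Psi[of "(p,t)"] by (simp add: Psi_def)
  let ?b = "cball (0::real^'m) 1"
  let ?X = "Psi ` (?b \<times> {0..1::real})"
  have img: "C ` ?X = Psi ` (((*v) B ` ?b) \<times> {0..1})"
  proof -
    have "C ` ?X = (\<lambda>x. Psi (B *v fst x, snd x)) ` (?b \<times> {0..1})"
      unfolding image_image by (intro image_cong) (auto simp: CPsi)
    also have "\<dots> = Psi ` ((\<lambda>x. (B *v fst x, snd x)) ` (?b \<times> {0..1}))" by (simp add: image_image)
    also have "(\<lambda>x. (B *v fst x, snd x)) ` (?b \<times> {0..1::real}) = ((*v) B ` ?b) \<times> {0..1}" by (force simp: image_iff)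
    finally show ?thesis .
  qed
  have cpt: "compact ((*v) B ` ?b)" by (intro compact_continuous_image) (auto simp: matrix_vector_mult_linear_continuous_on)
  have cX: "compact ?X" by (intro compact_continuous_image continuous_PPsi compact_Times) auto
  have cyl: "measure lebesgue (Psi ` (Y \<times> {0..1})) = measure lebesgue Y" if "compact Y" for Y
  proof -
    have "Y \<in> sets borel" using that by (simp add: borel_compact)
    then have "emeasure lborel (Psi ` (Y \<times> {0..1})) = emeasure lborel Y" by (subst emeasure_cylinder) auto
    moreover have "Psi ` (Y \<times> {0..1}) \<in> sets borel" by (intro Psi_image_borel borel_Times) (use \<open>Y \<in> sets borel\<close> in auto)
    ultimately show ?thesis using \<open>Y \<in> sets borel\<close> by (simp add: measure_def)
  qed
  have "measure lebesgue (C ` ?X) = \<bar>det (matrix C)\<bar> * measure lebesgue ?X"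
    by (rule measure_linear_image_compact[OF linC cX])
  moreover have "measure lebesgue (C ` ?X) = \<bar>det B\<bar> * measure lebesgue ?b"
    unfolding img cyl[OF cpt] by (subst measure_linear_image_compact) (auto simp: matrix_vector_mul_linear)
  moreover have "measure lebesgue ?X = measure lebesgue ?b" by (rule cyl) auto
  moreover have "measure lebesgue ?b > 0" by (simp add: content_cball)
  ultimately show ?thesis unfolding C_def[abs_def] by simp
qed

end

section \<open>The second fundamental form\<close>

context C2_convex_body
begin

text \<open>All boundary points lie below the tangent hyperplane at \<open>y0\<close>, so by
  \<open>level_set_quadratic\<close> the form is nearly nonnegative on rescaled chords
  \<open>w'\<close> that approximate \<open>w\<close>; continuity gives the limit.\<close>

lemma chart_psd:
  assumes ch: "C2_function (ball y0 \<delta>) \<rho> G H" "S \<inter> ball y0 \<delta> = {y\<in>ball y0 \<delta>. \<rho> y = 0}"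
    and y0: "y0 \<in> S" "\<delta> > 0" "G y0 = \<nu> y0" and w: "w \<bullet> \<nu> y0 = 0"
  shows "0 \<le> w \<bullet> (H y0 *v w)"
proof -
  interpret C2_function "ball y0 \<delta>" \<rho> G H by fact
  have yb: "y0 \<in> ball y0 \<delta>" using y0 by simp
  have G0: "G y0 \<noteq> 0" "G y0 \<bullet> w = 0" using y0 w normal_unit[OF y0(1)] by (auto simp: inner_commute)
  define f where "f h = h \<bullet> (H y0 *v h)" for h
  have ex: "\<exists>w'. norm (w' - w) \<le> e \<and> f w' \<ge> - (2 * e * (norm w')\<^sup>2)" if e: "e > 0" for e
  proof -
    obtain d where d: "d > 0" "ball y0 d \<subseteq> ball y0 \<delta>"
       "\<And>a b. a \<in> ball y0 d \<Longrightarrow> b \<in> ball y0 d \<Longrightarrow> \<rho> a = \<rho> b \<Longrightarrow>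
       \<bar>G a \<bullet> (a - b) - (a - b) \<bullet> (H y0 *v (a - b)) / 2\<bar> \<le> e * (norm (a - b))\<^sup>2"
      using level_set_quadratic[OF yb e] by metis
    obtain t0 where t0: "t0 > 0" "\<And>t. 0 < t \<Longrightarrow> t < t0 \<Longrightarrow> \<exists>y\<in>S. norm (y - (y0 + t *\<^sub>R w)) \<le> e * t"
      using chart_tangent[OF ch(1) yb G0(1) ch(2) y0(1) G0(2) e] by blast
    define R where "R = norm w + e + 1"
    have R: "R > 0" using e by (simp add: R_def add_nonneg_pos)
    define t where "t = min (t0 / 2) (d / (2 * R))"
    have t: "0 < t" "t < t0" using t0 d R by (auto simp: t_def)
    obtain y where y: "y \<in> S" "norm (y - (y0 + t *\<^sub>R w)) \<le> e * t" using t0(2)[OF t] by blast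
    define w' where "w' = (1 / t) *\<^sub>R (y - y0)"
    have yw: "y - y0 = t *\<^sub>R w'" using t by (simp add: w'_def)
    have "t *\<^sub>R (w' - w) = y - (y0 + t *\<^sub>R w)" using yw by (simp add: algebra_simps)
    then have "t * norm (w' - w) \<le> t * e" using y t by (metis abs_of_pos mult.commute norm_scaleR)
    then have ww: "norm (w' - w) \<le> e" using t by simp
    have "norm w' \<le> norm w + e" using ww norm_triangle_sub[of w' w] by linarith
    then have "norm (y - y0) \<le> t * (norm w + e)" using t unfolding yw by simp
    also have "\<dots> \<le> t * R" using t by (simp add: R_def)
    also have "\<dots> \<le> d / (2 * R) * R" using R by (intro mult_right_mono) (auto simp: t_def)
    also have "\<dots> < d" using R d by simp
    finally have yd: "y \<in> ball y0 d" by (simp add: dist_norm norm_minus_commute)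
    then have "\<rho> y = 0" "\<rho> y0 = 0" using y y0 ch(2) d(2) yb by auto
    then have "\<bar>G y0 \<bullet> (y0 - y) - (y0 - y) \<bullet> (H y0 *v (y0 - y)) / 2\<bar> \<le> e * (norm (y0 - y))\<^sup>2"
      using d yd by (intro d(3)) auto
    moreover have "G y0 \<bullet> (y0 - y) \<ge> 0"
      using normal_le[OF y0(1), of y] y frontier_subset y0(3) by (auto simp: inner_diff_right)
    ultimately have "- (2 * e * (norm (y0 - y))\<^sup>2) \<le> (y0 - y) \<bullet> (H y0 *v (y0 - y))" by linarith
    moreover have "y0 - y = (- t) *\<^sub>R w'" using yw by (simp add: algebra_simps)
    ultimately have "- (2 * e * (t\<^sup>2 * (norm w')\<^sup>2)) \<le> t\<^sup>2 * f w'"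
      by (simp only: f_def matrix_vector_mult_scaleR) (simp add: power2_eq_square mult_ac)
    then have "t\<^sup>2 * (- (2 * e * (norm w')\<^sup>2)) \<le> t\<^sup>2 * f w'" by (simp add: mult_ac)
    then have "- (2 * e * (norm w')\<^sup>2) \<le> f w'" using t by (simp only: mult_le_cancel_left_pos zero_less_power)
    then show ?thesis using ww by blast
  qed
  have "\<exists>w'. norm (w' - w) \<le> 1 / real (Suc n) \<and> f w' \<ge> - (2 * (1 / real (Suc n)) * (norm w')\<^sup>2)" for n
    by (rule ex) simp
  then obtain W where W: "\<And>n. norm (W n - w) \<le> 1 / real (Suc n)" "\<And>n. f (W n) \<ge> - (2 * (1 / real (Suc n)) * (norm (W n))\<^sup>2)"
    by metis
  have l0: "(\<lambda>n. 1 / real (Suc n)) \<longlonglongrightarrow> 0" using LIMSEQ_inverse_real_of_nat by (simp add: inverse_eq_divide)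
  have "(\<lambda>n. W n - w) \<longlonglongrightarrow> 0" by (rule Lim_null_comparison[OF _ l0]) (use W in auto)
  then have Wl: "W \<longlonglongrightarrow> w" by (simp add: LIM_zero_iff)
  have "isCont f w" unfolding f_def
    by (intro continuous_intros linear_continuous_at matrix_vector_mul_bounded_linear)
  then have "(\<lambda>n. f (W n)) \<longlonglongrightarrow> f w" using Wl by (rule isCont_tendsto_compose)
  moreover have "(\<lambda>n. - (2 * (1 / real (Suc n)) * (norm (W n))\<^sup>2)) \<longlonglongrightarrow> - (2 * 0 * (norm w)\<^sup>2)"
    by (intro tendsto_intros l0 Wl)
  ultimately have "- (2 * 0 * (norm w)\<^sup>2) \<le> f w"
    by (intro LIMSEQ_le[of "\<lambda>n. - (2 * (1 / real (Suc n)) * (norm (W n))\<^sup>2)" _ "\<lambda>n. f (W n)"]) (use W(2) in blast)+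
  then show ?thesis by (simp add: f_def)
qed

text \<open>\<open>M\<close> is the Weingarten map extended by the identity on the normal. It is
  symmetric by symmetry of the Hessian, semidefinite by convexity and nonsingular by positive
  curvature, hence definite. Factoring its tangential block \<open>A\<close> as
  \<open>transpose B ** B\<close> and extending \<open>B\<close> to \<open>C\<close> in the same way
  gives \<open>transpose C ** C = M\<close>.\<close>

lemma second_fundamental_form:
  fixes J :: "real^'m \<Rightarrow> real^'n"
  assumes fr: "frame J P (\<nu> y0)" and y0: "y0 \<in> S" "\<delta> > 0"
    and ch: "C2_function (ball y0 \<delta>) \<rho> G H" "\<And>y. y \<in> ball y0 \<delta> \<Longrightarrow> G y \<noteq> 0"
    "S \<inter> ball y0 \<delta> = {y\<in>ball y0 \<delta>. \<rho> y = 0}" "\<And>z. z \<in> S \<Longrightarrow> z \<in> ball y0 \<delta> \<Longrightarrow> \<nu> z = G z /\<^sub>R norm (G z)"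
    "G y0 = \<nu> y0"
  obtains B :: "real^'m^'m" where "(det B)\<^sup>2 = \<kappa> y0" "\<And>p. J p \<bullet> (H y0 *v J p) = (norm (B *v p))\<^sup>2"
proof -
  interpret frame J P "\<nu> y0" by fact
  interpret C2_function "ball y0 \<delta>" \<rho> G H by fact
  let ?u = "\<nu> y0"
  have yb: "y0 \<in> ball y0 \<delta>" using y0 by simp
  define A where "A = matrix (\<lambda>p. P (H y0 *v J p))"
  define M where "M = matrix (\<lambda>v. normal_derivative (G y0) (H y0) (v - (v \<bullet> ?u) *\<^sub>R ?u) + (v \<bullet> ?u) *\<^sub>R ?u)"
  have kM: "\<kappa> y0 = det M" unfolding M_def by (rule curvature_chart[OF ch(1-4) y0(1) yb])
  have nd: "normal_derivative (G y0) (H y0) w = H y0 *v w - (?u \<bullet> (H y0 *v w)) *\<^sub>R ?u" for w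
    by (simp add: normal_derivative_def ch(5) unit_u)
  have JP: "v - (v \<bullet> ?u) *\<^sub>R ?u = J (P v)" for v using decomp[of v] by (simp add: algebra_simps)
  have Av: "A *v p = P (H y0 *v J p)" for p
    unfolding A_def
    by (rule fun_cong[OF matrix_vector_mul(2)]) (auto simp: linear_iff linear_add[OF linJ] linear_scale[OF linJ] linear_add[OF linP] linear_scale[OF linP]
        matrix_vector_right_distrib matrix_vector_mult_scaleR)
  have Mv: "M *v v = H y0 *v J (P v) - (?u \<bullet> (H y0 *v J (P v))) *\<^sub>R ?u + (v \<bullet> ?u) *\<^sub>R ?u" for v
    unfolding M_def nd JP
    by (rule fun_cong[OF matrix_vector_mul(2)]) (auto simp: linear_iff linear_add[OF linJ] linear_scale[OF linJ] linear_add[OF linP] linear_scale[OF linP]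
        matrix_vector_right_distrib matrix_vector_mult_scaleR algebra_simps inner_add_right)
  have pA: "p \<bullet> (A *v q) = J p \<bullet> (H y0 *v J q)" for p q unfolding Av innerP ..
  have vM: "v \<bullet> (M *v w) = P v \<bullet> (A *v P w) + (v \<bullet> ?u) * (w \<bullet> ?u)" for v w
  proof -
    have "v \<bullet> (M *v w) = (J (P v) + (v \<bullet> ?u) *\<^sub>R ?u) \<bullet> (M *v w)" using decomp[of v] by simp
    also have "\<dots> = J (P v) \<bullet> (H y0 *v J (P w)) + (v \<bullet> ?u) * (w \<bullet> ?u)"
      unfolding Mv by (simp add: inner_add_left inner_add_right inner_diff_right Ju uu algebra_simps)
    finally show ?thesis by (simp add: pA)
  qed
  have symA: "transpose A = A"
    by (rule transpose_eq_self_iff) (metis pA Hessian_symmetric[OF yb] inner_commute)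
  have symA': "p \<bullet> (A *v q) = q \<bullet> (A *v p)" for p q
    by (metis pA Hessian_symmetric[OF yb] inner_commute)
  have symM: "transpose M = M"
    by (rule transpose_eq_self_iff) (simp add: vM symA'[of "P _" "P _"] mult.commute)
  have psdA: "0 \<le> p \<bullet> (A *v p)" for p
    unfolding pA by (rule chart_psd[OF ch(1,3) y0(1,2) ch(5)]) (rule Ju)
  have pdA: "0 < p \<bullet> (A *v p)" if "p \<noteq> 0" for p
  proof -
    have "J p \<noteq> 0" using that normJ[of p] by (metis norm_eq_zero)
    moreover have "det M \<noteq> 0" using curvature_pos[OF y0(1)] kM by simp
    ultimately have "0 < J p \<bullet> (M *v J p)" using psdA vM by (intro psd_nonsingular_pos_def[OF symM]) auto
    then show ?thesis by (simp add: vM PJ Ju)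
  qed
  obtain B :: "real^'m^'m" where B: "transpose B ** B = A" using pos_def_factorization[OF symA pdA] by blast
  have Bn: "p \<bullet> (A *v q) = (B *v p) \<bullet> (B *v q)" for p q
    unfolding B[symmetric] matrix_vector_mul_assoc[symmetric] by (rule inner_transpose_mult)
  define C where "C = matrix (\<lambda>v. J (B *v P v) + (v \<bullet> ?u) *\<^sub>R ?u)"
  have Cv: "C *v v = J (B *v P v) + (v \<bullet> ?u) *\<^sub>R ?u" for v
    unfolding C_def by (rule fun_cong[OF matrix_vector_mul(2)[OF linear_block]])
  have "v \<bullet> ((transpose C ** C) *v w) = v \<bullet> (M *v w)" for v w
  proof -
    have "v \<bullet> ((transpose C ** C) *v w) = (C *v v) \<bullet> (C *v w)"
      unfolding matrix_vector_mul_assoc[symmetric] by (rule inner_transpose_mult)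
    also have "\<dots> = (B *v P v) \<bullet> (B *v P w) + (v \<bullet> ?u) * (w \<bullet> ?u)"
      by (simp only: Cv inner_frame)
    also have "\<dots> = v \<bullet> (M *v w)"
      by (simp only: vM Bn)
    finally show ?thesis .
  qed
  then have "(transpose C ** C) *v w = M *v w" for w using vector_eq_ldot by blast
  then have "transpose C ** C = M" by (simp add: matrix_eq)
  then have "det M = (det C)\<^sup>2" by (metis det_mul det_transpose power2_eq_square)
  also have "\<dots> = \<bar>det C\<bar>\<^sup>2" by simp
  also have "\<bar>det C\<bar> = \<bar>det B\<bar>" unfolding C_def by (rule det_block)
  also have "\<bar>det B\<bar>\<^sup>2 = (det B)\<^sup>2" by simp
  finally have "(det B)\<^sup>2 = \<kappa> y0" using kM by simp
  moreover have "J p \<bullet> (H y0 *v J p) = (norm (B *v p))\<^sup>2" for p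
    unfolding pA[symmetric] Bn by (simp add: power2_norm_eq_inner)
  ultimately show ?thesis by (rule that)
qed

end

lemma matrix_bounded_below:
  fixes B :: "real^'m^'m"
  assumes "det B \<noteq> 0"
  obtains \<beta> where "\<beta> > 0" "\<And>p. \<beta> * (norm p)\<^sup>2 \<le> (norm (B *v p))\<^sup>2"
proof -
  obtain B' where inv: "B' ** B = mat 1" using assms by (metis invertible_det_nz invertible_def)
  define N where "N = norm B' + 1"
  have N: "N > 0" by (simp add: N_def add_nonneg_pos)
  have "1 / N\<^sup>2 * (norm p)\<^sup>2 \<le> (norm (B *v p))\<^sup>2" for p
  proof -
    have "norm p = norm (B' *v (B *v p))" by (simp add: matrix_vector_mul_assoc inv)
    also have "\<dots> \<le> norm B' * norm (B *v p)" by (rule norm_matrix_vector_mult_le)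
    also have "\<dots> \<le> N * norm (B *v p)" by (intro mult_right_mono) (auto simp: N_def)
    finally have "(norm p)\<^sup>2 \<le> (N * norm (B *v p))\<^sup>2" by (intro power_mono) auto
    then show ?thesis using N by (simp add: power_mult_distrib field_simps)
  qed
  then show ?thesis using that[of "1 / N\<^sup>2"] N by simp
qed

text \<open>\<open>B\<^sup>T B\<close> represents the second fundamental form at \<open>y0\<close>.\<close>

locale local_frame = C2_convex_body K + frame J P "\<nu> y0"
  for K :: "(real^'n) set" and J :: "real^'m \<Rightarrow> real^'n" and P and y0 +
  fixes \<delta>0 :: real and \<rho> G H and B :: "real^'m^'m"
  assumes y0: "y0 \<in> S" and \<delta>0: "\<delta>0 > 0"
    and ch: "C2_function (ball y0 \<delta>0) \<rho> G H"
    and Gnz: "y \<in> ball y0 \<delta>0 \<Longrightarrow> G y \<noteq> 0"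
    and zero_set: "S \<inter> ball y0 \<delta>0 = {y\<in>ball y0 \<delta>0. \<rho> y = 0}"
    and normal_G: "z \<in> S \<Longrightarrow> z \<in> ball y0 \<delta>0 \<Longrightarrow> \<nu> z = G z /\<^sub>R norm (G z)"
    and G0: "G y0 = \<nu> y0"
    and detB: "(det B)\<^sup>2 = \<kappa> y0"
    and Bform: "J p \<bullet> (H y0 *v J p) = (norm (B *v p))\<^sup>2"

sublocale local_frame \<subseteq> C2_function "ball y0 \<delta>0" \<rho> G H by (rule ch)

section \<open>Uniform estimates near a boundary point\<close>

context local_frame
begin

lemma y0_ball: "y0 \<in> ball y0 \<delta>0" using \<delta>0 by simp

lemma detB_nz: "det B \<noteq> 0" using detB curvature_pos[OF y0] by auto

lemma \<rho>_zero: "z \<in> S \<Longrightarrow> z \<in> ball y0 \<delta>0 \<Longrightarrow> \<rho> z = 0" using zero_set by blast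

text \<open>\<open>G\<close> is Lipschitz near \<open>y0\<close> and its norm exceeds 1/2 there,
  because \<open>G y0\<close> is a unit vector; normalising costs a factor of at most 4.\<close>

lemma normal_lipschitz:
  obtains \<delta> L where "\<delta> > 0" "L > 0"
    "\<And>z y. z \<in> S \<inter> ball y0 \<delta> \<Longrightarrow> y \<in> S \<inter> ball y0 \<delta> \<Longrightarrow> norm (\<nu> z - \<nu> y) \<le> L * norm (z - y)"
proof -
  obtain d where d: "d > 0" "ball y0 d \<subseteq> ball y0 \<delta>0"
     "\<And>a b. a \<in> ball y0 d \<Longrightarrow> b \<in> ball y0 d \<Longrightarrow> norm (G a - G b - H y0 *v (a - b)) \<le> 1 * norm (a - b)"
    using strict_G[OF y0_ball zero_less_one] by metis
  obtain d' where d': "d' > 0" "\<And>y. y \<in> ball y0 \<delta>0 \<Longrightarrow> dist y y0 < d' \<Longrightarrow> dist (G y) (G y0) < 1/2"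
    using contG y0_ball unfolding continuous_on_iff by (metis half_gt_zero zero_less_one)
  define M where "M = norm (H y0) + 1"
  have M: "M > 0" by (simp add: M_def add_nonneg_pos)
  define \<delta> where "\<delta> = min d d'"
  have "norm (\<nu> z - \<nu> y) \<le> 4 * M * norm (z - y)"
    if zy: "z \<in> S \<inter> ball y0 \<delta>" "y \<in> S \<inter> ball y0 \<delta>" for z y
  proof -
    have b: "z \<in> ball y0 d" "y \<in> ball y0 d" "z \<in> ball y0 \<delta>0" "y \<in> ball y0 \<delta>0"
      using zy d(2) by (auto simp: \<delta>_def)
    have half: "norm (G x) > 1/2" if "x \<in> ball y0 \<delta>0" "x \<in> ball y0 \<delta>" for x
    proof -
      have "norm (G x - \<nu> y0) < 1/2" using d'(2)[OF that(1)] that(2) by (auto simp: \<delta>_def G0 dist_norm norm_minus_commute)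
      then show ?thesis using norm_triangle_ineq2[of "\<nu> y0" "G x"] unit_u by (simp add: norm_minus_commute)
    qed
    have hz: "norm (G z) > 1/2" "norm (G y) > 1/2" using half b zy by auto
    have "norm (G z - G y) \<le> norm (G z - G y - H y0 *v (z - y)) + norm (H y0 *v (z - y))"
      by (metis diff_add_cancel norm_triangle_ineq)
    also have "\<dots> \<le> 1 * norm (z - y) + norm (H y0) * norm (z - y)"
      using d(3)[OF b(1,2)] norm_matrix_vector_mult_le[of "H y0" "z - y"] by (intro add_mono)
    also have "\<dots> = M * norm (z - y)" by (simp add: M_def algebra_simps)
    finally have GG: "norm (G z - G y) \<le> M * norm (z - y)" .
    define a where "a = norm (G z)"
    define c where "c = norm (G y)"
    have ac: "a > 1/2" "c > 1/2" using hz by (auto simp: a_def c_def)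
    \<comment> \<open>The second summand corrects the normalisation; it is no longer than the first
      by the reverse triangle inequality.\<close>
    have "\<nu> z - \<nu> y = (1 / a) *\<^sub>R (G z - G y) + ((c - a) / a) *\<^sub>R \<nu> y"
    proof -
      have "G y = c *\<^sub>R \<nu> y" using normal_G[of y] zy b Gnz[of y] by (simp add: c_def)
      moreover have "\<nu> z = (1 / a) *\<^sub>R G z" using normal_G[of z] zy b by (simp add: a_def divide_inverse)
      moreover have "(1 / a) *\<^sub>R (c *\<^sub>R \<nu> y) = ((c - a) / a) *\<^sub>R \<nu> y + \<nu> y"
      proof -
        have "c / a = (c - a) / a + 1" using ac by (simp add: field_simps)
        then show ?thesis by (simp add: scaleR_add_left[symmetric] del: scaleR_add_left) (metis scaleR_add_left scaleR_one)
      qed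
      ultimately show ?thesis by (simp add: scaleR_diff_right)
    qed
    then have "norm (\<nu> z - \<nu> y) \<le> norm ((1 / a) *\<^sub>R (G z - G y)) + norm (((c - a) / a) *\<^sub>R \<nu> y)"
      by (simp only: norm_triangle_ineq)
    also have "\<dots> = (norm (G z - G y) + \<bar>c - a\<bar>) / a"
      using ac normal_unit[of y] zy by (simp add: add_divide_distrib)
    also have "\<dots> \<le> (norm (G z - G y) + norm (G z - G y)) / a"
      using norm_triangle_ineq3[of "G y" "G z"] ac
      by (intro divide_right_mono add_left_mono) (auto simp: a_def c_def norm_minus_commute)
    also have "\<dots> \<le> (norm (G z - G y) + norm (G z - G y)) / (1/2)"
      using ac by (intro divide_left_mono) auto
    also have "\<dots> \<le> 4 * M * norm (z - y)" using GG by simp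
    finally show ?thesis .
  qed
  then show ?thesis using that[of \<delta> "4 * M"] d d' M by (auto simp: \<delta>_def)
qed

text \<open>\<rho> vanishes at both ends of the chord, so its strict first-order expansion at
  \<open>y0\<close> leaves only the error term.\<close>

lemma near_tangent:
  assumes e: "e > 0"
  obtains \<delta> where "\<delta> > 0"
    "\<And>z y. z \<in> S \<inter> ball y0 \<delta> \<Longrightarrow> y \<in> S \<inter> ball y0 \<delta> \<Longrightarrow> \<bar>(z - y) \<bullet> \<nu> y0\<bar> \<le> e * norm (z - y)"
proof -
  obtain d where d: "d > 0" "ball y0 d \<subseteq> ball y0 \<delta>0"
    "\<And>a b. a \<in> ball y0 d \<Longrightarrow> b \<in> ball y0 d \<Longrightarrow> \<bar>\<rho> a - \<rho> b - G y0 \<bullet> (a - b)\<bar> \<le> e * norm (a - b)"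
    using strict_\<rho>[OF y0_ball e] by metis
  show ?thesis
  proof (rule that[OF d(1)])
    fix z y assume zy: "z \<in> S \<inter> ball y0 d" "y \<in> S \<inter> ball y0 d"
    then have "\<rho> z = 0" "\<rho> y = 0" using d(2) \<rho>_zero by blast+
    then show "\<bar>(z - y) \<bullet> \<nu> y0\<bar> \<le> e * norm (z - y)" using d(3)[of z y] zy by (simp add: G0 inner_commute)
  qed
qed

text \<open>The source of the ellipsoid: the depth of \<open>y\<close> below the tangent hyperplane
  at \<open>z\<close> is half the form at \<open>y0\<close>. Errors come from the Hessian frozen at
  \<open>y0\<close>, from the normal part of the chord and from normalising \<open>G z\<close>. They
  become relative errors because \<open>B\<close> is bounded below.\<close>

lemma quadratic_estimate:
  assumes \<epsilon>: "\<epsilon> > 0"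
  obtains \<delta> where "\<delta> > 0"
    "\<And>z y. z \<in> S \<inter> ball y0 \<delta> \<Longrightarrow> y \<in> S \<inter> ball y0 \<delta> \<Longrightarrow>
       \<bar>\<nu> z \<bullet> (z - y) - (norm (B *v P (z - y)))\<^sup>2 / 2\<bar> \<le> \<epsilon> * (norm (B *v P (z - y)))\<^sup>2"
proof -
  obtain \<beta> where \<beta>: "\<beta> > 0" "\<And>p. \<beta> * (norm p)\<^sup>2 \<le> (norm (B *v p))\<^sup>2" using matrix_bounded_below[OF detB_nz] by blast
  define N where "N = norm (H y0) + 1"
  have N: "N \<ge> 1" by (simp add: N_def)
  \<comment> \<open>The errors add up to at most \<open>5 * e * N * n\<^sup>2\<close>, and
    \<open>n\<^sup>2 \<le> 2 * (norm (P h))\<^sup>2\<close>; the choice with 14 absorbs them with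
    room to spare.\<close>
  define e where "e = min (1/2) (\<epsilon> * \<beta> / (14 * N))"
  have e: "e > 0" "e \<le> 1/2" "14 * e * N \<le> \<epsilon> * \<beta>"
  proof -
    show "e > 0" "e \<le> 1/2" using \<epsilon> \<beta> N by (auto simp: e_def)
    have "e * (14 * N) \<le> \<epsilon> * \<beta> / (14 * N) * (14 * N)" using N by (intro mult_right_mono) (auto simp: e_def)
    then show "14 * e * N \<le> \<epsilon> * \<beta>" using N by (simp add: mult_ac)
  qed
  obtain d1 where d1: "d1 > 0" "ball y0 d1 \<subseteq> ball y0 \<delta>0"
     "\<And>a b. a \<in> ball y0 d1 \<Longrightarrow> b \<in> ball y0 d1 \<Longrightarrow> \<rho> a = \<rho> b \<Longrightarrow>
       \<bar>G a \<bullet> (a - b) - (a - b) \<bullet> (H y0 *v (a - b)) / 2\<bar> \<le> e * (norm (a - b))\<^sup>2"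
    using level_set_quadratic[OF y0_ball e(1)] by metis
  obtain d2 where d2: "d2 > 0" "\<And>z y. z \<in> S \<inter> ball y0 d2 \<Longrightarrow> y \<in> S \<inter> ball y0 d2 \<Longrightarrow> \<bar>(z - y) \<bullet> \<nu> y0\<bar> \<le> e * norm (z - y)"
    using near_tangent[OF e(1)] by blast
  obtain d3 where d3: "d3 > 0" "\<And>y. y \<in> ball y0 \<delta>0 \<Longrightarrow> dist y y0 < d3 \<Longrightarrow> dist (G y) (G y0) < e"
    using contG y0_ball e(1) unfolding continuous_on_iff by metis
  define \<delta> where "\<delta> = min d1 (min d2 d3)"
  have *: "\<bar>\<nu> z \<bullet> (z - y) - (norm (B *v P (z - y)))\<^sup>2 / 2\<bar> \<le> \<epsilon> * (norm (B *v P (z - y)))\<^sup>2"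
    if zy: "z \<in> S \<inter> ball y0 \<delta>" "y \<in> S \<inter> ball y0 \<delta>" for z y
  proof -
    have b: "z \<in> ball y0 d1" "y \<in> ball y0 d1" "z \<in> ball y0 \<delta>0" "y \<in> ball y0 \<delta>0" "z \<in> ball y0 d2" "y \<in> ball y0 d2"
      using zy d1(2) by (auto simp: \<delta>_def)
    define h where "h = z - y"
    define s where "s = h \<bullet> \<nu> y0"
    define n where "n = norm h"
    have n0: "n \<ge> 0" by (simp add: n_def)
    have hs: "h = J (P h) + s *\<^sub>R \<nu> y0" using decomp[of h] by (simp add: s_def)
    have s: "\<bar>s\<bar> \<le> e * n" using d2(2)[of z y] zy b by (simp add: s_def h_def n_def)
    have 1: "\<bar>G z \<bullet> h - h \<bullet> (H y0 *v h) / 2\<bar> \<le> e * n\<^sup>2"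
      using d1(3)[OF b(1,2)] \<rho>_zero zy b by (simp add: h_def n_def)
    define X where "X = H y0 *v J (P h)"
    define Y where "Y = H y0 *v \<nu> y0"
    have "norm X \<le> norm (H y0) * norm (J (P h))" unfolding X_def by (rule norm_matrix_vector_mult_le)
    also have "\<dots> \<le> N * n" using normP_le[of h] n0 by (intro mult_mono) (auto simp: N_def n_def normJ)
    finally have X: "norm X \<le> N * n" .
    have "norm Y \<le> norm (H y0) * norm (\<nu> y0)" unfolding Y_def by (rule norm_matrix_vector_mult_le)
    then have Y: "norm Y \<le> N" by (simp add: N_def unit_u)
    have HY: "J (P h) \<bullet> Y = \<nu> y0 \<bullet> X" unfolding X_def Y_def using Hessian_symmetric[OF y0_ball] by (simp add: inner_commute)
    have "h \<bullet> (H y0 *v h) = (J (P h) + s *\<^sub>R \<nu> y0) \<bullet> (X + s *\<^sub>R Y)"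
      unfolding X_def Y_def using hs by (metis matrix_vector_mult_scaleR matrix_vector_right_distrib)
    also have "\<dots> = J (P h) \<bullet> X + 2 * (s * (\<nu> y0 \<bullet> X)) + s * (s * (\<nu> y0 \<bullet> Y))"
      using HY by (simp add: inner_add_left inner_add_right algebra_simps)
    finally have quad: "h \<bullet> (H y0 *v h) = (norm (B *v P h))\<^sup>2 + 2 * (s * (\<nu> y0 \<bullet> X)) + s * (s * (\<nu> y0 \<bullet> Y))"
      by (simp add: X_def Bform)
    have q1: "\<bar>s * (\<nu> y0 \<bullet> X)\<bar> \<le> e * n * (N * n)"
      unfolding abs_mult using s X Cauchy_Schwarz_ineq2[of "\<nu> y0" X] n0 e by (intro mult_mono) (auto simp: unit_u)
    have q2: "\<bar>s * (s * (\<nu> y0 \<bullet> Y))\<bar> \<le> e * n * (1 * n * N)"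
    proof -
      have "e * n \<le> 1 * n" using e n0 by (intro mult_right_mono) auto
      then have "\<bar>s\<bar> \<le> 1 * n" using s by linarith
      then show ?thesis
        unfolding abs_mult using s Y Cauchy_Schwarz_ineq2[of "\<nu> y0" Y] n0 e N by (intro mult_mono) (auto simp: unit_u)
    qed
    have quad': "\<bar>h \<bullet> (H y0 *v h) - (norm (B *v P h))\<^sup>2\<bar> \<le> 3 * (e * N * n\<^sup>2)"
      using q1 q2 unfolding quad by (simp add: power2_eq_square algebra_simps)
    have "norm (H y0 *v h) \<le> norm (H y0) * n"
      unfolding n_def by (rule norm_matrix_vector_mult_le)
    also have "\<dots> \<le> N * n" using n0 by (intro mult_right_mono) (auto simp: N_def)
    finally have "\<bar>h \<bullet> (H y0 *v h)\<bar> \<le> n * (N * n)"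
      using n0 by (intro order_trans[OF Cauchy_Schwarz_ineq2] mult_mono) (auto simp: n_def)
    then have "\<bar>G z \<bullet> h\<bar> \<le> n * (N * n) / 2 + e * n\<^sup>2" using 1 by linarith
    also have "\<dots> \<le> n * (N * n) / 2 + (1/2) * N * n\<^sup>2"
      using e N by (intro add_left_mono mult_right_mono) (auto intro: order_trans[of e "1/2"])
    finally have Gh: "\<bar>G z \<bullet> h\<bar> \<le> N * n\<^sup>2" by (simp add: power2_eq_square algebra_simps)
    have Gz: "\<bar>norm (G z) - 1\<bar> \<le> e"
    proof -
      have "norm (G z - \<nu> y0) < e" using d3(2)[of z] zy b by (auto simp: \<delta>_def G0 dist_norm norm_minus_commute)
      then show ?thesis using norm_triangle_ineq3[of "G z" "\<nu> y0"] unit_u by simp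
    qed
    define a where "a = norm (G z)"
    have a: "a \<ge> 1/2" "\<bar>1 - a\<bar> \<le> e" using Gz e by (auto simp: a_def)
    have nz: "\<nu> z \<bullet> h = (G z \<bullet> h) / a" using normal_G[of z] zy b by (simp add: a_def divide_inverse mult.commute)
    have "\<nu> z \<bullet> h - G z \<bullet> h = (1 - a) / a * (G z \<bullet> h)" using a by (simp add: nz field_simps)
    also have "\<bar>\<dots>\<bar> \<le> (2 * e) * (N * n\<^sup>2)"
      unfolding abs_mult
    proof (intro mult_mono Gh)
      have "\<bar>(1 - a) / a\<bar> = \<bar>1 - a\<bar> / a" using a by simp
      also have "\<dots> \<le> e / (1/2)" using a e by (intro frac_le) auto
      finally show "\<bar>(1 - a) / a\<bar> \<le> 2 * e" by simp
    qed (use e in auto)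
    finally have 2: "\<bar>\<nu> z \<bullet> h - G z \<bullet> h\<bar> \<le> 2 * (e * N * n\<^sup>2)" by simp
    have "e * n\<^sup>2 \<le> e * N * n\<^sup>2" using e N by (intro mult_right_mono) auto
    then have tot: "\<bar>\<nu> z \<bullet> h - (norm (B *v P h))\<^sup>2 / 2\<bar> \<le> 5 * (e * N * n\<^sup>2)"
      using 1 2 quad' by linarith
    have "n\<^sup>2 = (norm (P h))\<^sup>2 + s\<^sup>2" using norm_decomp[of h] by (simp add: n_def s_def)
    moreover have "s\<^sup>2 \<le> n\<^sup>2 / 4"
    proof -
      have "\<bar>s\<bar> \<le> (1/2) * n" using s e n0 by (meson mult_right_mono order_trans)
      then have "\<bar>s\<bar>\<^sup>2 \<le> ((1/2) * n)\<^sup>2" by (intro power_mono) auto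
      then show ?thesis by (simp add: power_mult_distrib power_divide)
    qed
    ultimately have "n\<^sup>2 \<le> 2 * (norm (P h))\<^sup>2" using zero_le_power2[of "norm (P h)"] by linarith
    then have "7 * (e * N * n\<^sup>2) \<le> 7 * (e * N * (2 * (norm (P h))\<^sup>2))"
      using e N by (intro mult_left_mono) auto
    also have "\<dots> = (14 * e * N) * (norm (P h))\<^sup>2" by simp
    also have "\<dots> \<le> (\<epsilon> * \<beta>) * (norm (P h))\<^sup>2" using e by (intro mult_right_mono) auto
    also have "\<dots> \<le> \<epsilon> * (norm (B *v P h))\<^sup>2"
      using mult_left_mono[OF \<beta>(2)[of "P h"], of \<epsilon>] \<epsilon> by (simp add: mult.assoc)
    finally have "7 * (e * N * n\<^sup>2) \<le> \<epsilon> * (norm (B *v P h))\<^sup>2" .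
    moreover have "0 \<le> e * N * n\<^sup>2" using e N by simp
    ultimately show ?thesis using tot unfolding h_def by linarith
  qed
  have "\<delta> > 0" using d1(1) d2(1) d3(1) by (simp add: \<delta>_def)
  then show ?thesis by (rule that) (rule *)
qed

text \<open>\<rho> has opposite signs slightly above and below \<open>y0\<close>, and these signs
  persist under small tangential shifts. By the intermediate value theorem every line in direction
  \<open>\<nu> y0\<close> near \<open>y0\<close> meets the boundary.\<close>

lemma projection_onto:
  assumes d: "\<delta> > 0"
  obtains r where "r > 0" "ball (P y0) r \<subseteq> P ` (S \<inter> ball y0 \<delta>)"
proof -
  define e where "e = min \<delta> \<delta>0 / 2"
  have e: "e > 0" "e < \<delta>" "e < \<delta>0" using d \<delta>0 by (auto simp: e_def)
  have uu': "\<nu> y0 \<bullet> \<nu> y0 = 1" by (rule uu)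
  have "DERIV (\<lambda>s. \<rho> (y0 + s *\<^sub>R \<nu> y0)) 0 :> G (y0 + 0 *\<^sub>R \<nu> y0) \<bullet> \<nu> y0"
    by (rule DERIV_line) (use \<delta>0 in simp)
  then have D: "DERIV (\<lambda>s. \<rho> (y0 + s *\<^sub>R \<nu> y0)) 0 :> 1" by (simp add: G0 uu')
  have D': "DERIV (\<lambda>s. \<rho> (y0 - s *\<^sub>R \<nu> y0)) 0 :> -1"
  proof -
    have "DERIV (\<lambda>s. \<rho> (y0 + s *\<^sub>R (- \<nu> y0))) 0 :> G (y0 + 0 *\<^sub>R (- \<nu> y0)) \<bullet> (- \<nu> y0)"
      by (rule DERIV_line) (use \<delta>0 in simp)
    then show ?thesis by (simp add: G0 uu')
  qed
  have r0: "\<rho> y0 = 0" by (rule \<rho>_zero[OF y0 y0_ball])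
  obtain d1 where d1: "d1 > 0" "\<And>h. h > 0 \<Longrightarrow> h < d1 \<Longrightarrow> \<rho> (y0 + h *\<^sub>R \<nu> y0) > 0"
    using DERIV_pos_inc_right[OF D] r0 by auto
  obtain d2 where d2: "d2 > 0" "\<And>h. h > 0 \<Longrightarrow> h < d2 \<Longrightarrow> \<rho> (y0 - h *\<^sub>R \<nu> y0) < 0"
    using DERIV_neg_dec_right[OF D'] r0 by auto
  define t where "t = min (e / 2) (min d1 d2 / 2)"
  have t: "0 < t" "t < d1" "t < d2" "t \<le> e / 2" using e d1 d2 by (auto simp: t_def min_def)
  have near: "\<exists>r>0. \<forall>v. norm v < r \<longrightarrow> \<bar>\<rho> (y0 + c *\<^sub>R \<nu> y0 + v) - \<rho> (y0 + c *\<^sub>R \<nu> y0)\<bar> < \<bar>\<rho> (y0 + c *\<^sub>R \<nu> y0)\<bar> \<and> norm v < e / 2"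
    if "\<bar>c\<bar> = t" for c
  proof -
    have "\<rho> (y0 + c *\<^sub>R \<nu> y0) \<noteq> 0" using d1(2)[of t] d2(2)[of t] t that by (auto simp: abs_if split: if_splits)
    moreover have inb: "y0 + c *\<^sub>R \<nu> y0 \<in> ball y0 \<delta>0" using that t e by (simp add: dist_norm unit_u)
    ultimately obtain r where r: "r > 0" "\<And>x. x \<in> ball y0 \<delta>0 \<Longrightarrow> dist x (y0 + c *\<^sub>R \<nu> y0) < r \<Longrightarrow>
        dist (\<rho> x) (\<rho> (y0 + c *\<^sub>R \<nu> y0)) < \<bar>\<rho> (y0 + c *\<^sub>R \<nu> y0)\<bar>"
      using cont\<rho> unfolding continuous_on_iff by (metis zero_less_abs_iff)
    have "y0 + c *\<^sub>R \<nu> y0 + v \<in> ball y0 \<delta>0" if "norm v < e / 2" for v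
    proof -
      have "norm (c *\<^sub>R \<nu> y0 + v) \<le> t + norm v"
        using norm_triangle_ineq[of "c *\<^sub>R \<nu> y0" v] \<open>\<bar>c\<bar> = t\<close> by (simp add: unit_u)
      then have "norm (c *\<^sub>R \<nu> y0 + v) < \<delta>0" using that t e by linarith
      moreover have "y0 - (y0 + c *\<^sub>R \<nu> y0 + v) = - (c *\<^sub>R \<nu> y0 + v)" by simp
      ultimately show ?thesis by (simp only: mem_ball dist_norm norm_minus_cancel)
    qed
    then show ?thesis using r e
      by (intro exI[of _ "min r (e / 2)"]) (auto simp: dist_norm dist_real_def)
  qed
  obtain r1 where r1: "r1 > 0" "\<And>v. norm v < r1 \<Longrightarrow> \<bar>\<rho> (y0 + t *\<^sub>R \<nu> y0 + v) - \<rho> (y0 + t *\<^sub>R \<nu> y0)\<bar> < \<bar>\<rho> (y0 + t *\<^sub>R \<nu> y0)\<bar> \<and> norm v < e / 2"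
    using near[of t] t by auto
  obtain r2 where r2: "r2 > 0" "\<And>v. norm v < r2 \<Longrightarrow> \<bar>\<rho> (y0 + (-t) *\<^sub>R \<nu> y0 + v) - \<rho> (y0 + (-t) *\<^sub>R \<nu> y0)\<bar> < \<bar>\<rho> (y0 + (-t) *\<^sub>R \<nu> y0)\<bar> \<and> norm v < e / 2"
    using near[of "-t"] t by auto
  have "p \<in> P ` (S \<inter> ball y0 \<delta>)" if p: "p \<in> ball (P y0) (min r1 r2)" for p
  proof -
    define v where "v = J (p - P y0)"
    have v: "norm v < r1" "norm v < r2" using p by (auto simp: v_def normJ dist_norm norm_minus_commute)
    have Pv: "P v = p - P y0" by (simp add: v_def PJ)
    define f where "f s = \<rho> (y0 + s *\<^sub>R \<nu> y0 + v)" for s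
    have inb: "y0 + s *\<^sub>R \<nu> y0 + v \<in> ball y0 e" if "-t \<le> s" "s \<le> t" for s
    proof -
      have "norm (s *\<^sub>R \<nu> y0 + v) \<le> \<bar>s\<bar> + norm v" using norm_triangle_ineq[of "s *\<^sub>R \<nu> y0" v] by (simp add: unit_u)
      moreover have "\<bar>s\<bar> \<le> e / 2" using that t by linarith
      ultimately have "norm (s *\<^sub>R \<nu> y0 + v) < e" using r1(2)[OF v(1)] by linarith
      moreover have "y0 - (y0 + s *\<^sub>R \<nu> y0 + v) = - (s *\<^sub>R \<nu> y0 + v)" by simp
      ultimately show ?thesis by (simp only: mem_ball dist_norm norm_minus_cancel)
    qed
    have "continuous_on {-t..t} f" unfolding f_def
    proof (rule continuous_on_compose2[OF cont\<rho>])
      show "(\<lambda>s. y0 + s *\<^sub>R \<nu> y0 + v) ` {- t..t} \<subseteq> ball y0 \<delta>0"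
      proof clarify
        fix s assume "s \<in> {-t..t}"
        then have "y0 + s *\<^sub>R \<nu> y0 + v \<in> ball y0 e" by (intro inb) auto
        then show "y0 + s *\<^sub>R \<nu> y0 + v \<in> ball y0 \<delta>0" using e(3) by (simp only: mem_ball)
      qed
    qed (intro continuous_intros)
    moreover have "f t > 0"
    proof -
      have "\<bar>\<rho> (y0 + t *\<^sub>R \<nu> y0 + v) - \<rho> (y0 + t *\<^sub>R \<nu> y0)\<bar> < \<bar>\<rho> (y0 + t *\<^sub>R \<nu> y0)\<bar>" using r1(2)[OF v(1)] by blast
      moreover have "\<rho> (y0 + t *\<^sub>R \<nu> y0) > 0" using d1(2)[of t] t by blast
      ultimately show ?thesis unfolding f_def by linarith
    qed
    moreover have "f (-t) < 0"
    proof -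
      have "\<bar>\<rho> (y0 + (-t) *\<^sub>R \<nu> y0 + v) - \<rho> (y0 + (-t) *\<^sub>R \<nu> y0)\<bar> < \<bar>\<rho> (y0 + (-t) *\<^sub>R \<nu> y0)\<bar>" using r2(2)[OF v(2)] by blast
      moreover have "\<rho> (y0 + (-t) *\<^sub>R \<nu> y0) < 0" using d2(2)[of t] t by simp
      ultimately show ?thesis unfolding f_def by linarith
    qed
    ultimately obtain s where s: "-t \<le> s" "s \<le> t" "f s = 0" using IVT'[of f "-t" 0 t] t by auto
    define z where "z = y0 + s *\<^sub>R \<nu> y0 + v"
    have "z \<in> ball y0 \<delta>0" "z \<in> ball y0 \<delta>" using inb[OF s(1,2)] e by (auto simp: z_def)
    moreover have "z \<in> S" using zero_set \<open>z \<in> ball y0 \<delta>0\<close> s by (auto simp: z_def f_def)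
    moreover have "P z = p" by (simp add: z_def linear_add[OF linP] linear_scale[OF linP] Pu Pv)
    ultimately show ?thesis by blast
  qed
  then have "ball (P y0) (min r1 r2) \<subseteq> P ` (S \<inter> ball y0 \<delta>)" by blast
  moreover have "min r1 r2 > 0" using r1(1) r2(1) by simp
  ultimately show ?thesis by (rule that[rotated])
qed

end

context C2_convex_body
begin

lemma local_frame_exists:
  assumes y0: "y0 \<in> S" and card: "CARD('n) = Suc (CARD('m))"
  obtains J :: "real^'m \<Rightarrow> real^'n" and P \<delta> \<rho> G H B where "local_frame K J P y0 \<delta> \<rho> G H B"
proof -
  obtain J :: "real^'m \<Rightarrow> real^'n" and P where fr: "frame J P (\<nu> y0)"
    using frame_exists[OF normal_unit[OF y0] card] by blast
  obtain \<delta> \<rho> G H where \<delta>: "\<delta> > 0" and ch: "C2_function (ball y0 \<delta>) \<rho> G H" "\<And>y. y \<in> ball y0 \<delta> \<Longrightarrow> G y \<noteq> 0"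
    "S \<inter> ball y0 \<delta> = {y\<in>ball y0 \<delta>. \<rho> y = 0}" "\<And>z. z \<in> S \<Longrightarrow> z \<in> ball y0 \<delta> \<Longrightarrow> \<nu> z = G z /\<^sub>R norm (G z)"
    "G y0 = \<nu> y0"
    by (rule good_chart[OF y0]) (rule that; (assumption | blast))
  obtain B where B: "(det B)\<^sup>2 = \<kappa> y0" "\<And>p. J p \<bullet> (H y0 *v J p) = (norm (B *v p))\<^sup>2"
    using second_fundamental_form[OF fr y0 \<delta> ch] by blast
  have "local_frame K J P y0 \<delta> \<rho> G H B"
    by (intro local_frame.intro local_frame_axioms.intro C2_convex_body_axioms fr y0 \<delta> ch B)
  then show ?thesis by (rule that)
qed

end

section \<open>Comparison of Hausdorff measures, and ellipsoids\<close>

text \<open>The bound forces \<open>f\<close> to factor through \<open>g\<close>, and the factor is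
  Lipschitz. Two maps from a common parameter set spare the explicit inverse of either one.\<close>

lemma hausdorff_outer_compare:
  fixes f :: "'c \<Rightarrow> 'a::metric_space" and g :: "'c \<Rightarrow> 'b::metric_space"
  assumes L: "L > 0" and le: "\<And>x y. x \<in> Y \<Longrightarrow> y \<in> Y \<Longrightarrow> dist (f x) (f y) \<le> L * dist (g x) (g y)"
  shows "hausdorff_outer d (f ` Y) \<le> ennreal (L ^ d) * hausdorff_outer d (g ` Y)"
proof -
  let ?i = "inv_into Y g"
  have i: "?i (g x) \<in> Y" "g (?i (g x)) = g x" if "x \<in> Y" for x
    using that by (auto intro: inv_into_into f_inv_into_f)
  have "f (?i (g x)) = f x" if "x \<in> Y" for x
    using le[OF i(1)[OF that] that] i(2)[OF that] by simp
  then have "f ` Y = (\<lambda>q. f (?i q)) ` (g ` Y)" by (simp add: image_image)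
  also have "hausdorff_outer d \<dots> \<le> ennreal (L ^ d) * hausdorff_outer d (g ` Y)"
  proof (rule hausdorff_outer_lipschitz_image[OF L])
    fix p q assume "p \<in> g ` Y" "q \<in> g ` Y"
    then obtain x y where "x \<in> Y" "p = g x" "y \<in> Y" "q = g y" by blast
    then show "dist (f (?i p)) (f (?i q)) \<le> L * dist p q" using le[OF i(1) i(1), of x y] i(2) by simp
  qed
  finally show ?thesis .
qed

text \<open>The inverse is continuous on the compact image, and the image of \<open>E\<close> is a
  preimage under it.\<close>

lemma injective_continuous_image_borel:
  fixes f :: "'a::euclidean_space \<Rightarrow> 'b::euclidean_space"
  assumes C: "compact C" and f: "continuous_on C f" "inj_on f C" and E: "E \<in> sets borel" "E \<subseteq> C"
  shows "f ` E \<in> sets borel"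
proof -
  let ?g = "inv_into C f"
  have "continuous_on (f ` C) ?g"
    by (rule continuous_on_inv[OF f(1) C]) (use f(2) in auto)
  then have "?g \<in> borel_measurable (restrict_space borel (f ` C))"
    by (rule borel_measurable_continuous_on_restrict)
  then have "?g -` E \<inter> space (restrict_space borel (f ` C)) \<in> sets (restrict_space borel (f ` C))"
    using E(1) by (rule measurable_sets)
  moreover have "?g -` E \<inter> space (restrict_space borel (f ` C)) = f ` E"
    using f(2) E(2) by (auto simp: space_restrict_space intro!: image_eqI[of _ f])
  moreover have "f ` C \<in> sets borel" using compact_continuous_image[OF f(1) C] by (rule borel_compact)
  ultimately show ?thesis by (auto simp: sets_restrict_space)
qed

lemma measure_ellipsoid:
  fixes B :: "real^'m^'m"
  assumes B: "det B \<noteq> 0" and r: "r \<ge> 0"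
  shows "compact {p. norm (B *v (p - q)) \<le> r}"
    and "emeasure lborel {p. norm (B *v (p - q)) \<le> r} = ennreal (unit_ball_vol (real CARD('m)) * r ^ CARD('m) / \<bar>det B\<bar>)"
proof -
  obtain B' where B': "B ** B' = mat 1" "B' ** B = mat 1" using B by (metis invertible_det_nz invertible_def)
  have detB': "\<bar>det B'\<bar> = 1 / \<bar>det B\<bar>"
  proof -
    have "det B * det B' = 1" using B'(1) by (metis det_I det_mul)
    then have "\<bar>det B\<bar> * \<bar>det B'\<bar> = 1" by (metis abs_mult abs_one)
    then show ?thesis using B by (simp add: field_simps)
  qed
  have cE: "compact ((*v) B' ` cball 0 r)"
    by (intro compact_continuous_image linear_continuous_on matrix_vector_mul_bounded_linear) auto
  have eq: "{p. norm (B *v (p - q)) \<le> r} = (+) q ` (*v) B' ` cball 0 r"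
  proof (intro equalityI subsetI)
    fix p assume "p \<in> {p. norm (B *v (p - q)) \<le> r}"
    then have "B *v (p - q) \<in> cball 0 r" by simp
    moreover have "p = q + B' *v (B *v (p - q))" by (simp add: matrix_vector_mul_assoc B')
    ultimately show "p \<in> (+) q ` (*v) B' ` cball 0 r" by blast
  qed (auto simp: matrix_vector_mul_assoc B')
  then show cpt: "compact {p. norm (B *v (p - q)) \<le> r}" using cE by (simp add: compact_translation)
  have "measure lebesgue {p. norm (B *v (p - q)) \<le> r} = measure lebesgue ((*v) B' ` cball 0 r)"
    unfolding eq by (rule measure_translation)
  also have "\<dots> = \<bar>det B'\<bar> * measure lebesgue (cball (0::real^'m) r)"
    using measure_linear_image_compact[of "(*v) B'" "cball 0 r"] by (simp add: matrix_vector_mul_linear)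
  also have "measure lebesgue (cball (0::real^'m) r) = unit_ball_vol (real CARD('m)) * r ^ CARD('m)"
    using content_cball[OF r, of "0::real^'m"] by simp
  finally have m: "measure lborel {p. norm (B *v (p - q)) \<le> r} = unit_ball_vol (real CARD('m)) * r ^ CARD('m) / \<bar>det B\<bar>"
    using cpt by (simp add: detB' borel_compact)
  then show "emeasure lborel {p. norm (B *v (p - q)) \<le> r} = ennreal (unit_ball_vol (real CARD('m)) * r ^ CARD('m) / \<bar>det B\<bar>)"
    using emeasure_eq_ennreal_measure[of lborel "{p. norm (B *v (p - q)) \<le> r}"] emeasure_compact_finite[OF cpt] by auto
qed

context local_frame
begin

lemma norm_le_projection:
  assumes e: "0 < e" "e \<le> 1/2"
    and nt: "\<bar>h \<bullet> \<nu> y0\<bar> \<le> e * norm h"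
  shows "norm h \<le> (1 + e) * norm (P h)"
proof -
  have "(h \<bullet> \<nu> y0)\<^sup>2 \<le> (e * norm h)\<^sup>2" using nt by (metis abs_ge_zero power2_abs power_mono)
  then have 1: "(1 - e\<^sup>2) * (norm h)\<^sup>2 \<le> (norm (P h))\<^sup>2" using norm_decomp[of h] by (simp add: power_mult_distrib algebra_simps)
  \<comment> \<open>For \<open>e \<le> 1/2\<close> the bracket is at least 2 - 1/2 - 1/8. This is
    the excess of \<open>(1 + e)\<^sup>2 * (1 - e\<^sup>2)\<close> over 1.\<close>
  have "0 \<le> e * (2 - 2 * e\<^sup>2 - e ^ 3)"
  proof -
    have "e\<^sup>2 \<le> (1/2)\<^sup>2" "e ^ 3 \<le> (1/2) ^ 3" using e by (intro power_mono; simp)+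
    then show ?thesis using e by (intro mult_nonneg_nonneg) (auto simp: power_divide)
  qed
  moreover have "(1 + e)\<^sup>2 * (1 - e\<^sup>2) = 1 + e * (2 - 2 * e\<^sup>2 - e ^ 3)"
    by (simp add: power2_eq_square power3_eq_cube algebra_simps)
  ultimately have "1 \<le> (1 + e)\<^sup>2 * (1 - e\<^sup>2)" by linarith
  then have "1 * (norm h)\<^sup>2 \<le> (1 + e)\<^sup>2 * (1 - e\<^sup>2) * (norm h)\<^sup>2" by (intro mult_right_mono) auto
  also have "\<dots> \<le> (1 + e)\<^sup>2 * (norm (P h))\<^sup>2" using mult_left_mono[OF 1, of "(1 + e)\<^sup>2"] by (simp add: mult.assoc)
  finally have "(norm h)\<^sup>2 \<le> ((1 + e) * norm (P h))\<^sup>2" by (simp add: power_mult_distrib)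
  then show ?thesis by (rule power2_le_imp_le) (use e in auto)
qed

lemma projection_bilipschitz:
  assumes e: "0 < e" "e \<le> 1/2"
  obtains \<delta> where "\<delta> > 0"
    "\<And>z y. z \<in> S \<inter> ball y0 \<delta> \<Longrightarrow> y \<in> S \<inter> ball y0 \<delta> \<Longrightarrow> norm (z - y) \<le> (1 + e) * norm (P z - P y)"
proof -
  obtain \<delta> where \<delta>: "\<delta> > 0" "\<And>z y. z \<in> S \<inter> ball y0 \<delta> \<Longrightarrow> y \<in> S \<inter> ball y0 \<delta> \<Longrightarrow> \<bar>(z - y) \<bullet> \<nu> y0\<bar> \<le> e * norm (z - y)"
    using near_tangent[OF e(1)] by blast
  show ?thesis
  proof (rule that[OF \<delta>(1)])
    fix z y assume "z \<in> S \<inter> ball y0 \<delta>" "y \<in> S \<inter> ball y0 \<delta>"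
    then show "norm (z - y) \<le> (1 + e) * norm (P z - P y)"
      using norm_le_projection[OF e \<delta>(2)] by (simp add: linear_diff[OF linP])
  qed
qed

text \<open>With relative error 1/4 in \<open>quadratic_estimate\<close> the depth is at least a
  quarter of the form, which is positive since the projection is injective near
  \<open>y0\<close>.\<close>

lemma normal_strict:
  obtains \<delta> where "\<delta> > 0" "\<And>w. w \<in> S \<inter> ball y0 \<delta> \<Longrightarrow> w \<noteq> y0 \<Longrightarrow> \<nu> y0 \<bullet> (y0 - w) > 0"
proof -
  have quarter: "(1/4::real) > 0" and half: "(0::real) < 1/2" "(1/2::real) \<le> 1/2" by simp_all
  obtain d1 where d1: "d1 > 0" "\<And>z y. z \<in> S \<inter> ball y0 d1 \<Longrightarrow> y \<in> S \<inter> ball y0 d1 \<Longrightarrow>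
       \<bar>\<nu> z \<bullet> (z - y) - (norm (B *v P (z - y)))\<^sup>2 / 2\<bar> \<le> (1/4) * (norm (B *v P (z - y)))\<^sup>2"
    using quadratic_estimate[OF quarter] by blast
  obtain d2 where d2: "d2 > 0" "\<And>z y. z \<in> S \<inter> ball y0 d2 \<Longrightarrow> y \<in> S \<inter> ball y0 d2 \<Longrightarrow> norm (z - y) \<le> (1 + 1/2) * norm (P z - P y)"
    using projection_bilipschitz[OF half] by blast
  obtain \<beta> where \<beta>: "\<beta> > 0" "\<And>p. \<beta> * (norm p)\<^sup>2 \<le> (norm (B *v p))\<^sup>2" using matrix_bounded_below[OF detB_nz] by blast
  show ?thesis
  proof (rule that[of "min d1 d2"])
    fix w assume w: "w \<in> S \<inter> ball y0 (min d1 d2)" "w \<noteq> y0"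
    have "norm (y0 - w) > 0" using w by simp
    then have "norm (P y0 - P w) > 0" using d2(2)[of y0 w] w y0 d2(1) by (auto simp: zero_less_mult_iff less_le_trans)
    then have "norm (P (y0 - w)) > 0" by (simp add: linear_diff[OF linP])
    then have "0 < \<beta> * (norm (P (y0 - w)))\<^sup>2" using \<beta>(1) by simp
    then have "0 < (norm (B *v P (y0 - w)))\<^sup>2" using \<beta>(2)[of "P (y0 - w)"] by linarith
    moreover have "\<bar>\<nu> y0 \<bullet> (y0 - w) - (norm (B *v P (y0 - w)))\<^sup>2 / 2\<bar> \<le> (1/4) * (norm (B *v P (y0 - w)))\<^sup>2"
      by (rule d1(2)) (use w y0 d1(1) in auto)
    ultimately show "\<nu> y0 \<bullet> (y0 - w) > 0" by linarith
  qed (use d1 d2 in simp)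
qed

end

text \<open>An index type for the coordinates of a hyperplane.\<close>

typedef ('a::finite) pred_index = "{..CARD('a) - 2}"
  by blast

lemma bij_betw_Rep_pred_index: "bij_betw Rep_pred_index (UNIV :: 'a::finite pred_index set) {..CARD('a) - 2}"
  by (simp add: bij_betw_def inj_on_def Rep_pred_index_inject type_definition.Rep_range[OF type_definition_pred_index])

instance pred_index :: (finite) finite
  by standard (use bij_betw_finite[OF bij_betw_Rep_pred_index] in simp)

lemma card_pred_index: "CARD('a::finite) \<ge> 2 \<Longrightarrow> CARD('a) = Suc (CARD('a pred_index))"
  using bij_betw_same_card[OF bij_betw_Rep_pred_index[where ?'a = 'a]] by simp

section \<open>Strict convexity and closest points\<close>

context C2_convex_body
begin

text \<open>If \<open>y\<close> lay in the tangent hyperplane at \<open>z\<close>, so would the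
  segment between them, which would then consist of boundary points; near \<open>z\<close> this
  contradicts the local statement \<open>normal_strict\<close>.\<close>

lemma normal_inner_pos:
  assumes z: "z \<in> S" and y: "y \<in> S" "y \<noteq> z"
  shows "\<nu> z \<bullet> (z - y) > 0"
proof (rule ccontr)
  assume "\<not> ?thesis"
  moreover have "\<nu> z \<bullet> (y - z) \<le> 0" using y frontier_subset by (intro normal_le[OF z]) auto
  ultimately have 0: "\<nu> z \<bullet> (y - z) = 0" by (simp add: inner_diff_right)
  obtain J :: "real^'n pred_index \<Rightarrow> real^'n" and P \<delta>0 \<rho> G H B where lf: "local_frame K J P z \<delta>0 \<rho> G H B"
    using local_frame_exists[OF z card_pred_index[OF card_ge_2]] by blast
  interpret lf: local_frame K J P z \<delta>0 \<rho> G H B by fact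
  obtain \<delta> where \<delta>: "\<delta> > 0" "\<And>w. w \<in> S \<inter> ball z \<delta> \<Longrightarrow> w \<noteq> z \<Longrightarrow> \<nu> z \<bullet> (z - w) > 0"
    using lf.normal_strict by blast
  define t where "t = min 1 (\<delta> / (2 * norm (y - z)))"
  have n: "norm (y - z) > 0" using y by simp
  have t: "0 < t" "t \<le> 1" "t * norm (y - z) < \<delta>"
  proof -
    show "0 < t" "t \<le> 1" using \<delta> n by (auto simp: t_def)
    have "t * norm (y - z) \<le> \<delta> / (2 * norm (y - z)) * norm (y - z)" using n by (intro mult_right_mono) (auto simp: t_def)
    then show "t * norm (y - z) < \<delta>" using n \<delta> by simp
  qed
  define w where "w = z + t *\<^sub>R (y - z)"
  have "w = (1 - t) *\<^sub>R z + t *\<^sub>R y" by (simp add: w_def algebra_simps)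
  then have wK: "w \<in> K" using convexD[OF convexK, of z y "1 - t" t] z y t frontier_subset by auto
  have w0: "\<nu> z \<bullet> (w - z) = 0" using 0 by (simp add: w_def)
  have "w \<notin> interior K"
  proof
    assume "w \<in> interior K"
    moreover have "\<nu> z \<noteq> 0" using normal_unit[OF z] by (metis norm_zero zero_neq_one)
    ultimately show False using supports_interior[OF normal_supports[OF z], of w] w0 by simp
  qed
  then have "w \<in> S" using wK closedK by (simp add: frontier_def closure_closed)
  moreover have "w \<in> ball z \<delta>" using t by (simp add: w_def dist_norm)
  moreover have "w \<noteq> z" using t y by (simp add: w_def)
  ultimately have "\<nu> z \<bullet> (z - w) > 0" by (intro \<delta>(2)) auto
  then show False using w0 by (simp add: inner_diff_right)
qed

text \<open>Compactness of the set of pairs at distance at least \<open>r\<close>. It confines what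
  a point close to \<open>K\<close> can see to a small neighbourhood of its closest point.\<close>

lemma normal_inner_uniform:
  assumes r: "r > 0"
  obtains h0 where "h0 > 0" "\<And>z y. z \<in> S \<Longrightarrow> y \<in> S \<Longrightarrow> \<nu> z \<bullet> (z - y) \<le> h0 \<Longrightarrow> norm (z - y) < r"
proof -
  define T where "T = (S \<times> S) \<inter> {p. r \<le> dist (fst p) (snd p)}"
  have T: "compact T" unfolding T_def
    by (intro compact_Int_closed compact_Times compact_frontier closed_Collect_le continuous_intros)
  have cont: "continuous_on T (\<lambda>p. \<nu> (fst p) \<bullet> (fst p - snd p))"
    by (intro continuous_intros continuous_on_compose2[OF continuous_on_normal]) (auto simp: T_def)
  show ?thesis
  proof (cases "T = {}")
    case True
    show ?thesis
    proof (rule that[of 1])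
      fix z y assume "z \<in> S" "y \<in> S"
      then show "norm (z - y) < r"
      proof (rule_tac ccontr)
        assume "\<not> norm (z - y) < r"
        then have "(z, y) \<in> T" using \<open>z \<in> S\<close> \<open>y \<in> S\<close> by (simp add: T_def dist_norm)
        then show False using True by simp
      qed
    qed simp
  next
    case False
    obtain p where p: "p \<in> T" "\<And>q. q \<in> T \<Longrightarrow> \<nu> (fst p) \<bullet> (fst p - snd p) \<le> \<nu> (fst q) \<bullet> (fst q - snd q)"
      using continuous_attains_inf[OF T False cont] by blast
    define m where "m = \<nu> (fst p) \<bullet> (fst p - snd p)"
    have m: "m > 0" unfolding m_def using p(1) r by (intro normal_inner_pos) (auto simp: T_def)
    show ?thesis
    proof (rule that[of "m / 2"])
      fix z y assume zy: "z \<in> S" "y \<in> S" "\<nu> z \<bullet> (z - y) \<le> m / 2"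
      show "norm (z - y) < r"
      proof (rule ccontr)
        assume "\<not> ?thesis"
        then have "(z, y) \<in> T" using zy by (auto simp: T_def dist_norm)
        then have "m \<le> \<nu> z \<bullet> (z - y)" using p(2)[of "(z, y)"] by (simp add: m_def)
        then show False using zy m by linarith
      qed
    qed (use m in simp)
  qed
qed

lemma closest_point_normal:
  assumes x: "x \<notin> K"
  defines "y \<equiv> closest_point K x"
  shows "y \<in> S" "x = y + norm (x - y) *\<^sub>R \<nu> y" "infdist x K = norm (x - y)" "norm (x - y) > 0"
proof -
  have yK: "y \<in> K" unfolding y_def by (rule closest_point_in_set[OF closedK K_nonempty])
  have n: "norm (x - y) > 0" using x yK by auto
  then show "norm (x - y) > 0" .
  have sup: "(x - y) \<bullet> (w - y) \<le> 0" if "w \<in> K" for w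
    unfolding y_def by (rule closest_point_dot[OF convexK closedK that])
  have "y \<notin> interior K"
  proof
    assume "y \<in> interior K"
    then have "(x - y) \<bullet> (y - y) < 0" using n sup by (intro supports_interior) (auto simp: supports_def)
    then show False by simp
  qed
  then show yS: "y \<in> S" using yK closedK by (simp add: frontier_def closure_closed)
  have "\<nu> y = (x - y) /\<^sub>R norm (x - y)"
    using n sup by (intro normal_eqI yS) (auto simp: divide_simps mult_le_0_iff)
  then show "x = y + norm (x - y) *\<^sub>R \<nu> y" using n by simp
  show "infdist x K = norm (x - y)"
  proof (rule antisym)
    show "infdist x K \<le> norm (x - y)" using infdist_le[OF yK, of x] by (simp add: dist_norm)
    show "norm (x - y) \<le> infdist x K"
      unfolding infdist_notempty[OF K_nonempty]
      using closest_point_le[OF closedK, of _ x] by (intro cINF_greatest K_nonempty) (simp add: y_def dist_norm)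
  qed
qed

text \<open>Together with \<open>closest_point_normal\<close> this shows that closest point and
  distance are coordinates on the complement of \<open>K\<close>, inverse to moving along the
  normal.\<close>

lemma closest_point_offset:
  assumes z: "z \<in> S" and t: "t > 0"
  shows "z + t *\<^sub>R \<nu> z \<notin> K" "closest_point K (z + t *\<^sub>R \<nu> z) = z" "infdist (z + t *\<^sub>R \<nu> z) K = t"
proof -
  let ?x = "z + t *\<^sub>R \<nu> z"
  have nn: "\<nu> z \<bullet> \<nu> z = 1" using normal_unit[OF z] by (simp add: norm_eq_1)
  show xK: "?x \<notin> K" using normal_le[OF z, of ?x] t nn by auto
  have zK: "z \<in> K" using z frontier_subset by blast
  have dist: "dist ?x z \<le> dist ?x w" if "w \<in> K" for w
  proof -
    have "t = \<nu> z \<bullet> (?x - z)" using nn by simp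
    also have "\<dots> \<le> \<nu> z \<bullet> (?x - w)" using normal_le[OF z that] by (simp add: inner_diff_right inner_add_right)
    also have "\<dots> \<le> norm (\<nu> z) * norm (?x - w)" by (rule norm_cauchy_schwarz)
    finally show ?thesis using normal_unit[OF z] t by (simp add: dist_norm)
  qed
  show cp: "closest_point K ?x = z"
    using closest_point_unique[OF convexK closedK zK] dist by metis
  show "infdist ?x K = t" using closest_point_normal(3)[OF xK] cp normal_unit[OF z] t by simp
qed

section \<open>The visible part of the boundary\<close>

text \<open>Up to points whose tangent hyperplane contains \<open>x\<close>, these are the
  \<open>z\<close> with \<open>\<nu> z \<bullet> (x - z) > 0\<close>; \<open>visibleI\<close> and
  \<open>visibleD\<close> give the two inclusions.\<close>

definition visible :: "real^'n \<Rightarrow> (real^'n) set" where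
  "visible x = S \<inter> closure (convex hull (insert x K) - K)"

lemma closed_visible: "closed (visible x)"
  by (simp add: visible_def closed_Int closed_frontier)

lemma visible_subset: "visible x \<subseteq> S" by (simp add: visible_def)

text \<open>The segment from \<open>z\<close> to \<open>x\<close> leaves \<open>K\<close> at once,
  since it rises above the tangent hyperplane.\<close>

lemma visibleI:
  assumes z: "z \<in> S" and pos: "\<nu> z \<bullet> (x - z) > 0"
  shows "z \<in> visible x"
proof -
  let ?w = "\<lambda>n::nat. z + (1 / real (Suc n)) *\<^sub>R (x - z)"
  have zK: "z \<in> K" using z frontier_subset by blast
  have "?w n \<in> convex hull (insert x K) - K" for n
  proof
    have "?w n = (1 - 1 / real (Suc n)) *\<^sub>R z + (1 / real (Suc n)) *\<^sub>R x" by (simp add: algebra_simps)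
    moreover have "\<dots> \<in> convex hull (insert x K)"
      by (rule convexD[OF convex_convex_hull]) (use zK in \<open>auto intro: hull_inc\<close>)
    ultimately show "?w n \<in> convex hull (insert x K)" by simp
    show "?w n \<notin> K"
    proof
      assume "?w n \<in> K"
      then have "\<nu> z \<bullet> (?w n - z) \<le> 0" by (rule normal_le[OF z])
      moreover have "\<nu> z \<bullet> (?w n - z) = (1 / real (Suc n)) * (\<nu> z \<bullet> (x - z))" by simp
      moreover have "(1 / real (Suc n)) * (\<nu> z \<bullet> (x - z)) > 0" using pos by (intro mult_pos_pos) auto
      ultimately show False by linarith
    qed
  qed
  moreover have "?w \<longlonglongrightarrow> z"
  proof -
    have "(\<lambda>n. 1 / real (Suc n)) \<longlonglongrightarrow> 0" using LIMSEQ_inverse_real_of_nat by (simp add: inverse_eq_divide)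
    then have "?w \<longlonglongrightarrow> z + 0 *\<^sub>R (x - z)" by (intro tendsto_intros)
    then show ?thesis by simp
  qed
  ultimately have "z \<in> closure (convex hull (insert x K) - K)"
    unfolding closure_sequential by (intro exI[of _ ?w]) auto
  then show ?thesis using z by (simp add: visible_def)
qed

text \<open>If \<open>x\<close> lies strictly below the tangent hyperplane at \<open>z\<close>, then some point \<open>p\<close> between \<open>z\<close> and \<open>x\<close> is interior
  to \<open>K\<close>, and a point of the hull near \<open>z\<close> lies between a point of \<open>K\<close> and one near \<open>p\<close>.\<close>

lemma visibleD:
  assumes vis: "z \<in> visible x"
  shows "\<nu> z \<bullet> (x - z) \<ge> 0"
proof (rule ccontr)
  assume neg: "\<not> ?thesis"
  have z: "z \<in> S" using vis by (simp add: visible_def)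
  have zK: "z \<in> K" using z frontier_subset by blast
  \<comment> \<open>Otherwise a hyperplane separates the segment from the interior. It passes
    through \<open>z\<close>, so by uniqueness of the normal it is the tangent one, and
    \<open>x\<close> could not lie strictly below it.\<close>
  have "\<exists>\<tau>. 0 < \<tau> \<and> \<tau> \<le> 1 \<and> z + \<tau> *\<^sub>R (x - z) \<in> interior K"
  proof (rule ccontr)
    assume no: "\<not> ?thesis"
    define R where "R = (\<lambda>\<tau>. z + \<tau> *\<^sub>R (x - z)) ` {0<..1}"
    have "convex R"
    proof -
      have "R = (+) z ` (\<lambda>\<tau>. \<tau> *\<^sub>R (x - z)) ` {0<..1}" by (simp add: R_def image_image)
      then show ?thesis by (simp add: convex_translation convex_linear_image linear_scaleR_left)
    qed
    moreover have "R \<noteq> {}" by (simp add: R_def)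
    moreover have "interior K \<inter> R = {}" using no by (auto simp: R_def)
    ultimately obtain a b where ab: "a \<noteq> 0" "\<And>w. w \<in> interior K \<Longrightarrow> a \<bullet> w \<le> b" "\<And>w. w \<in> R \<Longrightarrow> a \<bullet> w \<ge> b"
      using separating_hyperplane_sets[of "interior K" R] interiorK convexK by (metis convex_interior)
    have aK: "a \<bullet> w \<le> b" if "w \<in> K" for w
    proof -
      have "w \<in> closure (interior K)" using that convexK interiorK closedK by (simp add: convex_closure_interior closure_closed)
      moreover have "closure (interior K) \<subseteq> {w. a \<bullet> w \<le> b}"
        using ab(2) by (intro closure_minimal closed_halfspace_le) auto
      ultimately show ?thesis by auto
    qed
    have aR: "b \<le> a \<bullet> z + \<tau> * (a \<bullet> (x - z))" if "0 < \<tau>" "\<tau> \<le> 1" for \<tau>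
    proof -
      have "z + \<tau> *\<^sub>R (x - z) \<in> R" unfolding R_def using that by (intro image_eqI[OF refl]) auto
      from ab(3)[OF this] show ?thesis by (simp add: inner_add_right)
    qed
    have az: "a \<bullet> z = b"
    proof (rule antisym)
      show "a \<bullet> z \<le> b" by (rule aK[OF zK])
      have "((\<lambda>\<tau>. a \<bullet> z + \<tau> * (a \<bullet> (x - z))) \<longlongrightarrow> a \<bullet> z + 0 * (a \<bullet> (x - z))) (at_right 0)"
        by (intro tendsto_intros)
      moreover have "\<forall>\<^sub>F \<tau> in at_right 0. b \<le> a \<bullet> z + \<tau> * (a \<bullet> (x - z))"
        using eventually_at_right_real[OF zero_less_one] by (rule eventually_mono) (auto intro: aR)
      ultimately have "b \<le> a \<bullet> z + 0 * (a \<bullet> (x - z))" by (intro tendsto_lowerbound[where F="at_right 0"]) auto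
      then show "b \<le> a \<bullet> z" by simp
    qed
    have "\<nu> z = a /\<^sub>R norm a"
      using ab(1) aK az by (intro normal_eqI z) (auto simp: inner_diff_right divide_simps)
    then have "norm a * (\<nu> z \<bullet> (x - z)) = a \<bullet> (x - z)" using ab(1) by simp
    moreover have "a \<bullet> (x - z) \<ge> 0" using aR[of 1] az by simp
    ultimately show False using neg ab(1) by (metis zero_le_mult_iff norm_le_zero_iff not_le zero_less_norm_iff)
  qed
  then obtain \<tau> where \<tau>: "0 < \<tau>" "\<tau> \<le> 1" "z + \<tau> *\<^sub>R (x - z) \<in> interior K" by blast
  obtain e where e: "e > 0" "ball (z + \<tau> *\<^sub>R (x - z)) e \<subseteq> K" using \<tau>(3) mem_interior by blast
  have "z \<in> closure (convex hull (insert x K) - K)" using vis by (simp add: visible_def)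
  then obtain w where w: "w \<in> convex hull (insert x K)" "w \<notin> K" "dist w z < e"
    using e(1) unfolding closure_approachable by blast
  have "\<exists>a\<in>K. \<exists>t. 0 \<le> t \<and> t \<le> 1 \<and> w = (1 - t) *\<^sub>R a + t *\<^sub>R x"
  proof -
    obtain u v b where uv: "0 \<le> u" "0 \<le> v" "u + v = 1" "b \<in> convex hull K" "w = u *\<^sub>R x + v *\<^sub>R b"
      using w(1) convex_hull_insert[OF K_nonempty, of x] by auto
    then have "w = (1 - u) *\<^sub>R b + u *\<^sub>R x" "b \<in> K" using convexK by (auto simp: hull_same add.commute eq_diff_eq[symmetric])
    then show ?thesis using uv by (intro bexI[of _ b] exI[of _ u]) auto
  qed
  then obtain a t where a: "a \<in> K" "0 \<le> t" "t \<le> 1" "w = (1 - t) *\<^sub>R a + t *\<^sub>R x" by blast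
  define p where "p = w + \<tau> *\<^sub>R (x - w)"
  have "p - (z + \<tau> *\<^sub>R (x - z)) = (1 - \<tau>) *\<^sub>R (w - z)" by (simp add: p_def algebra_simps)
  then have "norm (p - (z + \<tau> *\<^sub>R (x - z))) \<le> 1 * norm (w - z)" using \<tau> by (simp add: mult_left_le_one_le)
  then have "p \<in> ball (z + \<tau> *\<^sub>R (x - z)) e" using w(3) by (simp add: dist_norm norm_minus_commute)
  then have pK: "p \<in> K" using e by blast
  have "t < 1"
  proof (rule ccontr)
    assume "\<not> t < 1"
    then have "w = x" using a by simp
    then show False using pK w(2) by (simp add: p_def)
  qed
  \<comment> \<open>Solved from \<open>w = (1 - s) *\<^sub>R a + s *\<^sub>R p\<close> by comparing
    the coefficients of \<open>x\<close>.\<close>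
  define s where "s = t / (t + \<tau> * (1 - t))"
  have den: "t + \<tau> * (1 - t) > 0" using \<tau> a \<open>t < 1\<close> by (simp add: add_nonneg_pos)
  have s: "0 \<le> s" "s \<le> 1" using a \<tau> den \<open>t < 1\<close> by (auto simp: s_def divide_simps)
  have pa: "p = ((1 - \<tau>) * (1 - t)) *\<^sub>R a + (t + \<tau> * (1 - t)) *\<^sub>R x"
    by (simp add: p_def a(4) algebra_simps)
  have sd: "s * (t + \<tau> * (1 - t)) = t" using den by (simp add: s_def)
  have "(1 - s) + s * ((1 - \<tau>) * (1 - t)) = 1 - s * (t + \<tau> * (1 - t))" by (simp add: algebra_simps)
  then have c1: "(1 - s) + s * ((1 - \<tau>) * (1 - t)) = 1 - t" using sd by simp
  have "(1 - s) *\<^sub>R a + s *\<^sub>R p = ((1 - s) + s * ((1 - \<tau>) * (1 - t))) *\<^sub>R a + (s * (t + \<tau> * (1 - t))) *\<^sub>R x"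
    by (simp add: pa scaleR_add_right scaleR_add_left distrib_left)
  also have "\<dots> = w" unfolding c1 sd by (simp add: a(4))
  finally have "w \<in> K" using convexD[OF convexK a(1) pK, of "1 - s" s] s by auto
  then show False using w(2) by simp
qed

lemma visible_mono:
  assumes "x' \<in> convex hull (insert x K)"
  shows "visible x' \<subseteq> visible x"
proof -
  have "insert x' K \<subseteq> convex hull (insert x K)" using assms hull_subset[of "insert x K" convex] by auto
  then have "convex hull (insert x' K) \<subseteq> convex hull (insert x K)" by (intro hull_minimal) auto
  then show ?thesis unfolding visible_def by (intro Int_mono closure_mono Diff_mono) auto
qed

end

subsection \<open>The measure of the visible part\<close>

text \<open>Both sides are additive, so the members of the cover can be split off one at a time. The
  inequality for all Borel pieces, not only for \<open>U i\<close>, makes the pieces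
  disjoint.\<close>

lemma emeasure_le_locally:
  assumes sets: "sets M = sets borel" "sets N = sets borel" and I: "finite I" and U: "\<And>i. i \<in> I \<Longrightarrow> open (U i)"
    and C: "C \<in> sets borel" "C \<subseteq> (\<Union>i\<in>I. U i)"
    and le: "\<And>i E. i \<in> I \<Longrightarrow> E \<in> sets borel \<Longrightarrow> E \<subseteq> C \<inter> U i \<Longrightarrow> a * emeasure M E \<le> c * emeasure N E"
  shows "a * emeasure M C \<le> c * emeasure N C"
proof -
  have "a * emeasure M E \<le> c * emeasure N E"
    if "F \<subseteq> I" "finite F" "E \<in> sets borel" "E \<subseteq> C" "E \<subseteq> (\<Union>i\<in>F. U i)" for F E
    using that(2,1,3-)
  proof (induction F arbitrary: E rule: finite_induct)
    case empty then show ?case by simp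
  next
    case (insert i F)
    have Ui: "U i \<in> sets borel" using U insert.prems by (auto intro: borel_open)
    have split: "emeasure L E = emeasure L (E \<inter> U i) + emeasure L (E - U i)" if "sets L = sets borel" for L
    proof -
      have "E \<inter> U i \<in> sets L" "E - U i \<in> sets L" using that insert.prems Ui by auto
      then have "emeasure L (E \<inter> U i) + emeasure L (E - U i) = emeasure L ((E \<inter> U i) \<union> (E - U i))"
        by (intro plus_emeasure) auto
      then show ?thesis by (simp add: Int_Diff_Un)
    qed
    have "a * emeasure M (E \<inter> U i) \<le> c * emeasure N (E \<inter> U i)"
      using insert.prems Ui by (intro le[of i]) auto
    moreover have "a * emeasure M (E - U i) \<le> c * emeasure N (E - U i)"
      using insert.prems Ui by (intro insert.IH) auto
    ultimately show ?case
      unfolding split[OF sets(1)] split[OF sets(2)] distrib_left by (rule add_mono)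
  qed
  from this[OF order_refl I C(1) order_refl C(2)] show ?thesis .
qed

context C2_convex_body
begin

lemma d_pos: "1 \<le> (CARD('n) - 1)" using card_ge_2 by simp

lemma S_borel: "S \<in> sets borel" using closed_frontier by (rule borel_closed)

lemma sets_surface: "A \<in> sets borel \<Longrightarrow> A \<subseteq> S \<Longrightarrow> A \<in> sets (surface_area_measure K)"
  using S_borel by (simp add: surface_area_measure_def sets_restrict_space_iff)

lemma emeasure_surface:
  assumes "A \<in> sets borel" "A \<subseteq> S"
  shows "emeasure (surface_area_measure K) A = hausdorff_outer (CARD('n) - 1) A"
  unfolding surface_area_measure_def
  using S_borel assms emeasure_hausdorff_measure[OF d_pos assms(1)] by (subst emeasure_restrict_space) auto

lemma weighted_bounds:
  assumes g: "\<And>x. x \<in> S \<Longrightarrow> g x = sqrt (\<kappa> x)" and A: "A \<in> sets borel" "A \<subseteq> S"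
    and ab: "\<And>z. z \<in> A \<Longrightarrow> a \<le> sqrt (\<kappa> z) \<and> sqrt (\<kappa> z) \<le> b"
  shows "ennreal a * hausdorff_outer (CARD('n) - 1) A \<le> emeasure (weighted_surface_measure K g) A"
    and "emeasure (weighted_surface_measure K g) A \<le> ennreal b * hausdorff_outer (CARD('n) - 1) A"
proof -
  let ?M = "surface_area_measure K"
  \<comment> \<open>\<open>g\<close> is prescribed on the boundary only, so it is measurable for the
    restricted Borel algebra.\<close>
  have "continuous_on S (\<lambda>x. sqrt (\<kappa> x))" by (intro continuous_intros continuous_on_curvature)
  then have "continuous_on S g" by (rule continuous_on_eq) (simp add: g)
  then have "g \<in> borel_measurable (restrict_space borel S)" by (rule borel_measurable_continuous_on_restrict)
  moreover have "sets ?M = sets (restrict_space borel S)"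
    unfolding surface_area_measure_def by (rule sets_restrict_space_cong) simp
  ultimately have gm: "g \<in> borel_measurable ?M" using measurable_cong_sets by blast
  have As: "A \<in> sets ?M" by (rule sets_surface[OF A])
  have eq: "emeasure (weighted_surface_measure K g) A = (\<integral>\<^sup>+ x. ennreal (g x) * indicator A x \<partial>?M)"
    unfolding weighted_surface_measure_def using gm As by (intro emeasure_density) auto
  have c: "(\<integral>\<^sup>+ x. ennreal c * indicator A x \<partial>?M) = ennreal c * hausdorff_outer (CARD('n) - 1) A" for c
    using As emeasure_surface[OF A] by (simp add: nn_integral_cmult_indicator)
  show "ennreal a * hausdorff_outer (CARD('n) - 1) A \<le> emeasure (weighted_surface_measure K g) A"
    unfolding eq c[symmetric]
  proof (rule nn_integral_mono)
    show "ennreal a * indicator A x \<le> ennreal (g x) * indicator A x" for x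
      using ab[of x] g[of x] A(2) by (cases "x \<in> A") (auto intro!: ennreal_leI)
  qed
  show "emeasure (weighted_surface_measure K g) A \<le> ennreal b * hausdorff_outer (CARD('n) - 1) A"
    unfolding eq c[symmetric]
  proof (rule nn_integral_mono)
    show "ennreal (g x) * indicator A x \<le> ennreal b * indicator A x" for x
      using ab[of x] g[of x] A(2) by (cases "x \<in> A") (auto intro!: ennreal_leI)
  qed
qed

end

context local_frame
begin

lemma d_eq: "(CARD('n) - 1) = CARD('m)" using card_frame by simp

lemma m_pos: "1 \<le> CARD('m)" using d_pos d_eq by simp

lemma sqrt_curvature: "sqrt (\<kappa> y0) = \<bar>det B\<bar>" unfolding detB[symmetric] by simp

lemma normal_close:
  assumes e: "0 < e"
  obtains \<delta> where "\<delta> > 0"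
    "\<And>z y. z \<in> S \<inter> ball y0 \<delta> \<Longrightarrow> y \<in> S \<inter> ball y0 \<delta> \<Longrightarrow> norm (\<nu> z - \<nu> y) \<le> e"
proof -
  obtain \<delta>1 L where L: "\<delta>1 > 0" "L > 0"
    "\<And>z y. z \<in> S \<inter> ball y0 \<delta>1 \<Longrightarrow> y \<in> S \<inter> ball y0 \<delta>1 \<Longrightarrow> norm (\<nu> z - \<nu> y) \<le> L * norm (z - y)"
    using normal_lipschitz by blast
  define \<delta> where "\<delta> = min \<delta>1 (e / (2 * L))"
  show ?thesis
  proof (rule that[of \<delta>])
    show "\<delta> > 0" using L e by (simp add: \<delta>_def)
    fix z y assume zy: "z \<in> S \<inter> ball y0 \<delta>" "y \<in> S \<inter> ball y0 \<delta>"
    then have "norm (\<nu> z - \<nu> y) \<le> L * norm (z - y)" by (intro L(3)) (auto simp: \<delta>_def)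
    also have "\<dots> \<le> L * (2 * (e / (2 * L)))"
    proof (intro mult_left_mono)
      have "norm (z - y) \<le> dist y0 z + dist y0 y" using dist_triangle3[of z y y0] by (simp add: dist_norm)
      also have "\<dots> \<le> 2 * (e / (2 * L))" using zy by (simp add: \<delta>_def)
      finally show "norm (z - y) \<le> 2 * (e / (2 * L))" .
    qed (use L in simp)
    also have "\<dots> = e" using L by simp
    finally show "norm (\<nu> z - \<nu> y) \<le> e" .
  qed
qed

lemma curvature_close:
  assumes e: "0 < e"
  obtains \<delta> where "\<delta> > 0"
    "\<And>z. z \<in> S \<inter> ball y0 \<delta> \<Longrightarrow> (1 - e) * \<bar>det B\<bar> \<le> sqrt (\<kappa> z) \<and> sqrt (\<kappa> z) \<le> (1 + e) * \<bar>det B\<bar>"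
proof -
  have "continuous_on S (\<lambda>x. sqrt (\<kappa> x))" by (intro continuous_intros continuous_on_curvature)
  moreover have "e * \<bar>det B\<bar> > 0" using e detB_nz by simp
  ultimately obtain \<delta> where \<delta>: "\<delta> > 0" "\<forall>z\<in>S. dist z y0 < \<delta> \<longrightarrow> dist (sqrt (\<kappa> z)) (sqrt (\<kappa> y0)) < e * \<bar>det B\<bar>"
    using y0 unfolding continuous_on_iff by blast
  show ?thesis
  proof (rule that[OF \<delta>(1)])
    fix z assume z: "z \<in> S \<inter> ball y0 \<delta>"
    then have "\<bar>sqrt (\<kappa> z) - \<bar>det B\<bar>\<bar> < e * \<bar>det B\<bar>"
      using \<delta>(2) by (auto simp: dist_commute dist_real_def sqrt_curvature)
    then show "(1 - e) * \<bar>det B\<bar> \<le> sqrt (\<kappa> z) \<and> sqrt (\<kappa> z) \<le> (1 + e) * \<bar>det B\<bar>"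
      by (simp add: algebra_simps abs_le_iff) linarith
  qed
qed

text \<open>These quotients are the total losses in \<open>visible_measure_local\<close>. The roots
  come from the quadratic estimate; the factors \<open>1 + e\<close> from curvature and projection,
  the factors \<open>1 - e\<close> from curvature and the turning of the normal.\<close>

lemma small_parameter:
  assumes "0 < \<epsilon>" "\<epsilon> < 1"
  obtains e :: real where "0 < e" "e < 1/4" "(1 + e)\<^sup>2 / sqrt (1 - 2 * e) \<le> 1 + \<epsilon>" "1 - \<epsilon> \<le> (1 - e)\<^sup>2 / sqrt (1 + 2 * e)"
proof -
  have "((\<lambda>e::real. (1 + e)\<^sup>2 / sqrt (1 - 2 * e)) \<longlongrightarrow> (1 + 0)\<^sup>2 / sqrt (1 - 2 * 0)) (at_right 0)"
    by (intro tendsto_intros) auto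
  then have 1: "\<forall>\<^sub>F e::real in at_right 0. (1 + e)\<^sup>2 / sqrt (1 - 2 * e) < 1 + \<epsilon>"
    using assms by (intro order_tendstoD(2)) auto
  have "((\<lambda>e::real. (1 - e)\<^sup>2 / sqrt (1 + 2 * e)) \<longlongrightarrow> (1 - 0)\<^sup>2 / sqrt (1 + 2 * 0)) (at_right 0)"
    by (intro tendsto_intros) auto
  then have 2: "\<forall>\<^sub>F e::real in at_right 0. 1 - \<epsilon> < (1 - e)\<^sup>2 / sqrt (1 + 2 * e)"
    using assms by (intro order_tendstoD(1)) auto
  have 3: "\<forall>\<^sub>F e::real in at_right 0. e \<in> {0<..<1/4}" by (rule eventually_at_right_real) simp
  have "\<exists>e::real. (1 + e)\<^sup>2 / sqrt (1 - 2 * e) < 1 + \<epsilon> \<and> 1 - \<epsilon> < (1 - e)\<^sup>2 / sqrt (1 + 2 * e) \<and> e \<in> {0<..<1/4}"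
    using eventually_conj[OF 1 eventually_conj[OF 2 3]] eventually_happens'[OF trivial_limit_at_right_real] by blast
  then show ?thesis using that by force
qed

text \<open>The closest point \<open>y\<close> of \<open>x\<close> varies near \<open>y0\<close>,
  but projection and form are those at \<open>y0\<close>: the projected visible part is caught
  between two ellipsoids centred at \<open>P y\<close>, of the fixed shape given by
  \<open>B\<close>.\<close>

lemma visible_measure_local:
  assumes g: "\<And>x. x \<in> S \<Longrightarrow> g x = sqrt (\<kappa> x)" and \<epsilon>: "0 < \<epsilon>" "\<epsilon> < 1"
  obtains \<delta> h0 where "\<delta> > 0" "h0 > 0"
    "\<And>x. x \<notin> K \<Longrightarrow> closest_point K x \<in> ball y0 \<delta> \<Longrightarrow> infdist x K \<le> h0 \<Longrightarrow>
       ennreal (unit_ball_vol (real (CARD('m))) * ((1 - \<epsilon>) * sqrt (2 * infdist x K)) ^ CARD('m)) \<le> emeasure (weighted_surface_measure K g) (visible x) \<and>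
       emeasure (weighted_surface_measure K g) (visible x) \<le> ennreal (unit_ball_vol (real (CARD('m))) * ((1 + \<epsilon>) * sqrt (2 * infdist x K)) ^ CARD('m))"
proof -
  obtain e :: real where e: "0 < e" "e < 1/4" and e1: "(1 + e)\<^sup>2 / sqrt (1 - 2 * e) \<le> 1 + \<epsilon>"
    and e2: "1 - \<epsilon> \<le> (1 - e)\<^sup>2 / sqrt (1 + 2 * e)"
    by (rule small_parameter[OF \<epsilon>])
  have eh: "0 < e" "e \<le> 1/2" using e by auto
  obtain \<delta>1 where \<delta>1: "\<delta>1 > 0" "\<And>z y. z \<in> S \<inter> ball y0 \<delta>1 \<Longrightarrow> y \<in> S \<inter> ball y0 \<delta>1 \<Longrightarrow>
       \<bar>\<nu> z \<bullet> (z - y) - (norm (B *v P (z - y)))\<^sup>2 / 2\<bar> \<le> e * (norm (B *v P (z - y)))\<^sup>2"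
    using quadratic_estimate[OF e(1)] by blast
  obtain \<delta>2 where \<delta>2: "\<delta>2 > 0"
    "\<And>z y. z \<in> S \<inter> ball y0 \<delta>2 \<Longrightarrow> y \<in> S \<inter> ball y0 \<delta>2 \<Longrightarrow> norm (z - y) \<le> (1 + e) * norm (P z - P y)"
    using projection_bilipschitz[OF eh] by blast
  obtain \<delta>3 where \<delta>3: "\<delta>3 > 0" "\<And>z y. z \<in> S \<inter> ball y0 \<delta>3 \<Longrightarrow> y \<in> S \<inter> ball y0 \<delta>3 \<Longrightarrow> norm (\<nu> z - \<nu> y) \<le> e"
    using normal_close[OF e(1)] by blast
  obtain \<delta>4 where \<delta>4: "\<delta>4 > 0"
    "\<And>z. z \<in> S \<inter> ball y0 \<delta>4 \<Longrightarrow> (1 - e) * \<bar>det B\<bar> \<le> sqrt (\<kappa> z) \<and> sqrt (\<kappa> z) \<le> (1 + e) * \<bar>det B\<bar>"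
    using curvature_close[OF e(1)] by blast
  define D where "D = min (min \<delta>1 \<delta>2) (min \<delta>3 \<delta>4)"
  have D: "D > 0" using \<delta>1 \<delta>2 \<delta>3 \<delta>4 by (simp add: D_def)
  have Db: "ball y0 D \<subseteq> ball y0 \<delta>1" "ball y0 D \<subseteq> ball y0 \<delta>2" "ball y0 D \<subseteq> ball y0 \<delta>3" "ball y0 D \<subseteq> ball y0 \<delta>4"
    by (auto simp: D_def)
  obtain r1 where r1: "r1 > 0" "ball (P y0) r1 \<subseteq> P ` (S \<inter> ball y0 D)" using projection_onto[OF D] by blast
  have D2: "D / 2 > 0" using D by simp
  obtain hA where hA: "hA > 0" "\<And>z y. z \<in> S \<Longrightarrow> y \<in> S \<Longrightarrow> \<nu> z \<bullet> (z - y) \<le> hA \<Longrightarrow> norm (z - y) < D / 2"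
    using normal_inner_uniform[OF D2] by blast
  obtain \<beta> where \<beta>: "\<beta> > 0" "\<And>p. \<beta> * (norm p)\<^sup>2 \<le> (norm (B *v p))\<^sup>2" using matrix_bounded_below[OF detB_nz] by blast
  \<comment> \<open>\<open>hA\<close> keeps visible points within \<open>D / 2\<close> of
    \<open>y\<close>. The other bound keeps the inner ellipsoid within \<open>r1 / 2\<close> of
    \<open>P y\<close>, because there \<open>\<beta> * (norm (p - P y))\<^sup>2 \<le> 2 * h \<le>
    \<beta> * r1\<^sup>2 / 8\<close>. The choice of \<delta> supplies the remaining halves.\<close>
  define h0 where "h0 = min hA (\<beta> * r1\<^sup>2 / 16)"
  define \<delta> where "\<delta> = min (D / 2) (r1 / 2)"
  have db: "\<bar>det B\<bar> > 0" using detB_nz by simp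
  show ?thesis
  proof (rule that[of \<delta> h0])
    show "\<delta> > 0" using D r1 by (simp add: \<delta>_def)
    show "h0 > 0" using hA \<beta> r1 by (simp add: h0_def)
    fix x assume x: "x \<notin> K" "closest_point K x \<in> ball y0 \<delta>" "infdist x K \<le> h0"
    define y where "y = closest_point K x"
    define h where "h = infdist x K"
    note cp = closest_point_normal[OF x(1), folded y_def]
    have h: "h > 0" "h \<le> hA" "h \<le> \<beta> * r1\<^sup>2 / 16" using cp(3,4) x(3) by (auto simp: h_def h0_def)
    have xy: "x = y + h *\<^sub>R \<nu> y" using cp(2,3) by (simp add: h_def)
    have yS: "y \<in> S" by (rule cp(1))
    have yb: "dist y0 y < D / 2" "dist y0 y < r1 / 2" using x(2) by (auto simp: y_def[symmetric] \<delta>_def)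
    have yD: "y \<in> S \<inter> ball y0 D" using yS yb D by simp
    have form: "\<nu> z \<bullet> (x - z) = h * (\<nu> z \<bullet> \<nu> y) - \<nu> z \<bullet> (z - y)" for z
      by (simp add: xy inner_diff_right inner_add_right)
    have nn1: "\<nu> z \<bullet> \<nu> y \<le> 1" if "z \<in> S" for z
      using norm_cauchy_schwarz[of "\<nu> z" "\<nu> y"] normal_unit[OF that] normal_unit[OF yS] by simp
    \<comment> \<open>A point that sees \<open>x\<close> has depth at most \<open>h\<close> times a
      cosine, hence at most \<open>h\<close>, so \<open>normal_inner_uniform\<close>
      applies.\<close>
    have vis: "z \<in> S \<inter> ball y0 D" "\<nu> z \<bullet> (z - y) \<le> h" if "z \<in> visible x" for z
    proof -
      have z: "z \<in> S" using that visible_subset by blast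
      have "0 \<le> \<nu> z \<bullet> (x - z)" by (rule visibleD[OF that])
      moreover have "h * (\<nu> z \<bullet> \<nu> y) \<le> h * 1" using nn1[OF z] h by (intro mult_left_mono) auto
      ultimately show le: "\<nu> z \<bullet> (z - y) \<le> h" unfolding form by linarith
      then have "norm (z - y) < D / 2" using h by (intro hA(2) z yS) linarith
      then have "dist y0 z < D" using yb dist_triangle[of y0 z y] by (simp add: dist_norm norm_minus_commute)
      then show "z \<in> S \<inter> ball y0 D" using z by simp
    qed
    define V where "V = visible x"
    have Vb: "V \<in> sets borel" "V \<subseteq> S" using closed_visible visible_subset by (auto simp: V_def borel_closed)
    define Hd where "Hd = hausdorff_outer CARD('m) V"
    have PV: "hausdorff_outer CARD('m) (P ` V) \<le> Hd" "Hd \<le> ennreal ((1 + e) ^ CARD('m)) * hausdorff_outer CARD('m) (P ` V)"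
    proof -
      have "hausdorff_outer CARD('m) (P ` V) \<le> ennreal (1 ^ CARD('m)) * hausdorff_outer CARD('m) V"
        by (rule hausdorff_outer_lipschitz_image)
           (auto simp: dist_norm linear_diff[OF linP, symmetric] normP_le)
      then show "hausdorff_outer CARD('m) (P ` V) \<le> Hd" by (simp add: Hd_def)
      have "hausdorff_outer CARD('m) ((\<lambda>z. z) ` V) \<le> ennreal ((1 + e) ^ CARD('m)) * hausdorff_outer CARD('m) (P ` V)"
      proof (rule hausdorff_outer_compare)
        fix z w assume "z \<in> V" "w \<in> V"
        then have "z \<in> S \<inter> ball y0 \<delta>2" "w \<in> S \<inter> ball y0 \<delta>2" using vis(1) Db(2) unfolding V_def by blast+
        then show "dist z w \<le> (1 + e) * dist (P z) (P w)" using \<delta>2(2) by (simp add: dist_norm)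
      qed (use e in simp)
      then show "Hd \<le> ennreal ((1 + e) ^ CARD('m)) * hausdorff_outer CARD('m) (P ` V)" by (simp add: Hd_def)
    qed
    have W: "ennreal ((1 - e) * \<bar>det B\<bar>) * Hd \<le> emeasure (weighted_surface_measure K g) V"
      "emeasure (weighted_surface_measure K g) V \<le> ennreal ((1 + e) * \<bar>det B\<bar>) * Hd"
    proof -
      note wb = weighted_bounds[OF g Vb, unfolded d_eq, folded Hd_def]
      have Vab: "(1 - e) * \<bar>det B\<bar> \<le> sqrt (\<kappa> z) \<and> sqrt (\<kappa> z) \<le> (1 + e) * \<bar>det B\<bar>" if "z \<in> V" for z
        using \<delta>4(2)[of z] vis(1)[of z] Db(4) that unfolding V_def by blast
      show "ennreal ((1 - e) * \<bar>det B\<bar>) * Hd \<le> emeasure (weighted_surface_measure K g) V" by (rule wb(1)[OF _ Vab])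
      show "emeasure (weighted_surface_measure K g) V \<le> ennreal ((1 + e) * \<bar>det B\<bar>) * Hd" by (rule wb(2)[OF _ Vab])
    qed
    let ?E = "\<lambda>R. {p. norm (B *v (p - P y)) \<le> R}"
    have HE: "hausdorff_outer CARD('m) (?E R) = ennreal (unit_ball_vol (real (CARD('m))) * R ^ CARD('m) / \<bar>det B\<bar>)" if "R \<ge> 0" for R
    proof -
      have "?E R \<in> sets borel" using measure_ellipsoid(1)[OF detB_nz that] by (rule borel_compact)
      then have "hausdorff_outer DIM(real^'m) (?E R) = emeasure lborel (?E R)" by (rule hausdorff_outer_eq_lborel)
      then show ?thesis using measure_ellipsoid(2)[OF detB_nz that, of "P y"] by simp
    qed
    define t where "t = sqrt (2 * h)"
    have t: "t > 0" "t\<^sup>2 = 2 * h" using h by (auto simp: t_def)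
    have upper: "emeasure (weighted_surface_measure K g) V \<le> ennreal (unit_ball_vol (real (CARD('m))) * ((1 + \<epsilon>) * t) ^ CARD('m))"
    proof -
      \<comment> \<open>Solves \<open>(1/2 - e) * R\<^sup>2 = h\<close>, the worst case of the
        quadratic estimate.\<close>
      define R where "R = t / sqrt (1 - 2 * e)"
      have R: "R \<ge> 0" using t e by (simp add: R_def)
      have R2: "R\<^sup>2 = 2 * h / (1 - 2 * e)" using t e by (simp add: R_def power_divide)
      have "P ` V \<subseteq> ?E R"
      proof clarify
        fix z assume "z \<in> V"
        then have z: "z \<in> S \<inter> ball y0 D" "\<nu> z \<bullet> (z - y) \<le> h" using vis by (auto simp: V_def)
        define N where "N = norm (B *v P (z - y))"
        have "\<bar>\<nu> z \<bullet> (z - y) - N\<^sup>2 / 2\<bar> \<le> e * N\<^sup>2" unfolding N_def using z yD Db by (intro \<delta>1(2)) auto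
        then have "N\<^sup>2 / 2 - e * N\<^sup>2 \<le> h" using z(2) by linarith
        then have "N\<^sup>2 * (1 - 2 * e) \<le> 2 * h" by (simp add: algebra_simps)
        then have "N\<^sup>2 \<le> R\<^sup>2" unfolding R2 using e by (simp add: field_simps)
        then have "N \<le> R" using R by (rule power2_le_imp_le)
        then show "norm (B *v (P z - P y)) \<le> R" by (simp add: N_def linear_diff[OF linP])
      qed
      then have "hausdorff_outer CARD('m) (P ` V) \<le> ennreal (unit_ball_vol (real (CARD('m))) * R ^ CARD('m) / \<bar>det B\<bar>)"
        using hausdorff_outer_mono[of "P ` V" "?E R" "CARD('m)"] HE[OF R] by simp
      then have "Hd \<le> ennreal ((1 + e) ^ CARD('m)) * ennreal (unit_ball_vol (real (CARD('m))) * R ^ CARD('m) / \<bar>det B\<bar>)"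
        by (intro order_trans[OF PV(2)] mult_left_mono) auto
      then have "emeasure (weighted_surface_measure K g) V
          \<le> ennreal ((1 + e) * \<bar>det B\<bar>) * (ennreal ((1 + e) ^ CARD('m)) * ennreal (unit_ball_vol (real (CARD('m))) * R ^ CARD('m) / \<bar>det B\<bar>))"
        by (intro order_trans[OF W(2)] mult_left_mono) auto
      also have "\<dots> = ennreal ((1 + e) * \<bar>det B\<bar> * ((1 + e) ^ CARD('m) * (unit_ball_vol (real (CARD('m))) * R ^ CARD('m) / \<bar>det B\<bar>)))"
        using e R db by (simp add: ennreal_mult[symmetric])
      also have "\<dots> \<le> ennreal (unit_ball_vol (real (CARD('m))) * ((1 + \<epsilon>) * t) ^ CARD('m))"
      proof (rule ennreal_leI)
        have "(1 + e) * \<bar>det B\<bar> * ((1 + e) ^ CARD('m) * (unit_ball_vol (real (CARD('m))) * R ^ CARD('m) / \<bar>det B\<bar>)) = (1 + e) ^ 1 * ((1 + e) ^ CARD('m) * (unit_ball_vol (real (CARD('m))) * R ^ CARD('m)))"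
          using db by simp
        \<comment> \<open>As \<open>CARD('m) \<ge> 1\<close>, the single factor from the curvature
          may be raised to this power, so that all losses can be charged to the radius.\<close>
        also have "\<dots> \<le> (1 + e) ^ CARD('m) * ((1 + e) ^ CARD('m) * (unit_ball_vol (real (CARD('m))) * R ^ CARD('m)))"
          using e R m_pos by (intro mult_right_mono power_increasing) auto
        also have "\<dots> = unit_ball_vol (real (CARD('m))) * ((1 + e)\<^sup>2 * R) ^ CARD('m)" by (simp add: power_mult_distrib power2_eq_square)
        also have "\<dots> \<le> unit_ball_vol (real (CARD('m))) * ((1 + \<epsilon>) * t) ^ CARD('m)"
        proof (intro mult_left_mono power_mono)
          have "(1 + e)\<^sup>2 * R = ((1 + e)\<^sup>2 / sqrt (1 - 2 * e)) * t" by (simp add: R_def)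
          also have "\<dots> \<le> (1 + \<epsilon>) * t" using e1 t by (intro mult_right_mono) auto
          finally show "(1 + e)\<^sup>2 * R \<le> (1 + \<epsilon>) * t" .
        qed (use R in auto)
        finally show "(1 + e) * \<bar>det B\<bar> * ((1 + e) ^ CARD('m) * (unit_ball_vol (real (CARD('m))) * R ^ CARD('m) / \<bar>det B\<bar>)) \<le> unit_ball_vol (real (CARD('m))) * ((1 + \<epsilon>) * t) ^ CARD('m)" .
      qed
      finally show ?thesis .
    qed
    have lower: "ennreal (unit_ball_vol (real (CARD('m))) * ((1 - \<epsilon>) * t) ^ CARD('m)) \<le> emeasure (weighted_surface_measure K g) V"
    proof -
      \<comment> \<open>Solves \<open>(1/2 + e) * R\<^sup>2 = (1 - e)\<^sup>2 * h\<close>. This is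
        strictly below \<open>(1 - e) * h\<close>, a lower bound for
        \<open>h * (\<nu> z \<bullet> \<nu> y)\<close>, so \<open>visibleI\<close> applies with
        strict inequality.\<close>
      define R where "R = (1 - e) * t / sqrt (1 + 2 * e)"
      have R: "R \<ge> 0" using t e by (simp add: R_def)
      have R2: "R\<^sup>2 = (1 - e)\<^sup>2 * (2 * h) / (1 + 2 * e)" using t e by (simp add: R_def power_divide power_mult_distrib)
      have R2h: "R\<^sup>2 \<le> 2 * h"
      proof -
        have "(1 - e)\<^sup>2 \<le> 1" using e by (simp add: power_le_one)
        then have "(1 - e)\<^sup>2 * (2 * h) \<le> 1 * (2 * h)" using h by (intro mult_right_mono) auto
        then have "R\<^sup>2 \<le> 2 * h / (1 + 2 * e)" unfolding R2 using e by (intro divide_right_mono) auto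
        also have "\<dots> \<le> 2 * h / 1" using e h by (intro divide_left_mono) auto
        finally show ?thesis by simp
      qed
      \<comment> \<open>Here the projection must be onto: every point of the ellipsoid has to come
        from a boundary point.\<close>
      have "?E R \<subseteq> P ` V"
      proof
        fix p assume p: "p \<in> ?E R"
        have "\<beta> * (norm (p - P y))\<^sup>2 \<le> (norm (B *v (p - P y)))\<^sup>2" by (rule \<beta>(2))
        also have "\<dots> \<le> R\<^sup>2" using p by (intro power_mono) auto
        also have "\<dots> \<le> \<beta> * r1\<^sup>2 / 8" using R2h h by linarith
        also have "\<dots> < \<beta> * (r1 / 2)\<^sup>2" using \<beta> r1 by (simp add: power_divide)
        finally have "(norm (p - P y))\<^sup>2 < (r1 / 2)\<^sup>2" using \<beta>(1) by simp
        then have "norm (p - P y) < r1 / 2" using r1 by (intro power2_less_imp_less[of _ "r1 / 2"]) auto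
        moreover have "norm (P y - P y0) < r1 / 2"
          using yb(2) normP_le[of "y - y0"] by (simp add: linear_diff[OF linP] dist_norm norm_minus_commute)
        moreover have "norm (p - P y0) \<le> norm (p - P y) + norm (P y - P y0)"
          by (metis diff_add_cancel add_diff_eq norm_triangle_ineq)
        ultimately have "p \<in> ball (P y0) r1" by (simp add: dist_norm norm_minus_commute)
        then obtain z where z: "z \<in> S \<inter> ball y0 D" "P z = p" using r1(2) by blast
        define N where "N = norm (B *v P (z - y))"
        have N: "N \<le> R" using p z by (simp add: N_def linear_diff[OF linP])
        have "N\<^sup>2 \<le> R\<^sup>2" using N by (intro power_mono) (auto simp: N_def)
        have "\<bar>\<nu> z \<bullet> (z - y) - N\<^sup>2 / 2\<bar> \<le> e * N\<^sup>2" unfolding N_def using z yD Db by (intro \<delta>1(2)) auto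
        then have "\<nu> z \<bullet> (z - y) \<le> (1/2 + e) * N\<^sup>2" by (simp add: algebra_simps abs_le_iff)
        also have "\<dots> \<le> (1/2 + e) * R\<^sup>2" using \<open>N\<^sup>2 \<le> R\<^sup>2\<close> e by (intro mult_left_mono) auto
        also have "\<dots> = (1 - e)\<^sup>2 * h" unfolding R2 using e by (simp add: field_simps)
        also have "\<dots> < (1 - e) * h" using e h by (simp add: power2_eq_square)
        finally have 1: "\<nu> z \<bullet> (z - y) < (1 - e) * h" .
        have "norm (\<nu> z - \<nu> y) \<le> e" using z yD Db by (intro \<delta>3(2)) auto
        then have "(norm (\<nu> z - \<nu> y))\<^sup>2 \<le> e\<^sup>2" by (intro power_mono) auto
        moreover have "(norm (\<nu> z - \<nu> y))\<^sup>2 = 2 - 2 * (\<nu> z \<bullet> \<nu> y)"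
          using normal_unit[of z] normal_unit[of y] z yS
          by (simp add: power2_norm_eq_inner inner_diff_left inner_diff_right inner_commute[of "\<nu> y" "\<nu> z"] norm_eq_1)
        moreover have "e\<^sup>2 \<le> 2 * e" using e by (simp add: power2_eq_square)
        ultimately have "1 - e \<le> \<nu> z \<bullet> \<nu> y" by linarith
        then have "(1 - e) * h \<le> h * (\<nu> z \<bullet> \<nu> y)" using h by (simp add: mult.commute)
        then have "\<nu> z \<bullet> (x - z) > 0" unfolding form using 1 by linarith
        then have "z \<in> V" unfolding V_def using z by (intro visibleI) auto
        then show "p \<in> P ` V" using z by blast
      qed
      then have "ennreal (unit_ball_vol (real (CARD('m))) * R ^ CARD('m) / \<bar>det B\<bar>) \<le> hausdorff_outer CARD('m) (P ` V)"
        using hausdorff_outer_mono[of "?E R" "P ` V" "CARD('m)"] HE[OF R] by simp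
      then have "ennreal (unit_ball_vol (real (CARD('m))) * R ^ CARD('m) / \<bar>det B\<bar>) \<le> Hd" using PV(1) by (rule order_trans)
      then have "ennreal ((1 - e) * \<bar>det B\<bar>) * ennreal (unit_ball_vol (real (CARD('m))) * R ^ CARD('m) / \<bar>det B\<bar>) \<le> emeasure (weighted_surface_measure K g) V"
        by (intro order_trans[OF _ W(1)] mult_left_mono) auto
      moreover have "unit_ball_vol (real (CARD('m))) * ((1 - \<epsilon>) * t) ^ CARD('m) \<le> (1 - e) * \<bar>det B\<bar> * (unit_ball_vol (real (CARD('m))) * R ^ CARD('m) / \<bar>det B\<bar>)"
      proof -
        have "unit_ball_vol (real (CARD('m))) * ((1 - \<epsilon>) * t) ^ CARD('m) \<le> unit_ball_vol (real (CARD('m))) * ((1 - e) * R) ^ CARD('m)"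
        proof (intro mult_left_mono power_mono)
          have "(1 - \<epsilon>) * t \<le> ((1 - e)\<^sup>2 / sqrt (1 + 2 * e)) * t" using e2 t by (intro mult_right_mono) auto
          also have "\<dots> = (1 - e) * R" by (simp add: R_def power2_eq_square)
          finally show "(1 - \<epsilon>) * t \<le> (1 - e) * R" .
        qed (use \<epsilon> t in auto)
        also have "\<dots> = (1 - e) ^ CARD('m) * (unit_ball_vol (real (CARD('m))) * R ^ CARD('m))" by (simp add: power_mult_distrib)
        also have "\<dots> \<le> (1 - e) ^ 1 * (unit_ball_vol (real (CARD('m))) * R ^ CARD('m))"
          using e R m_pos by (intro mult_right_mono power_decreasing) auto
        also have "\<dots> = (1 - e) * \<bar>det B\<bar> * (unit_ball_vol (real (CARD('m))) * R ^ CARD('m) / \<bar>det B\<bar>)" using db by simp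
        finally show ?thesis .
      qed
      then have "ennreal (unit_ball_vol (real (CARD('m))) * ((1 - \<epsilon>) * t) ^ CARD('m)) \<le> ennreal ((1 - e) * \<bar>det B\<bar>) * ennreal (unit_ball_vol (real (CARD('m))) * R ^ CARD('m) / \<bar>det B\<bar>)"
        using e R db by (subst ennreal_mult[symmetric]) (auto intro: ennreal_leI)
      ultimately show ?thesis by (rule order_trans[rotated])
    qed
    show "ennreal (unit_ball_vol (real (CARD('m))) * ((1 - \<epsilon>) * sqrt (2 * infdist x K)) ^ CARD('m)) \<le> emeasure (weighted_surface_measure K g) (visible x) \<and>
       emeasure (weighted_surface_measure K g) (visible x) \<le> ennreal (unit_ball_vol (real (CARD('m))) * ((1 + \<epsilon>) * sqrt (2 * infdist x K)) ^ CARD('m))"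
      using upper lower by (simp only: V_def t_def h_def)
  qed
qed

end

subsection \<open>The volume of parallel shells\<close>

context C2_convex_body
begin

definition offset :: "(real^'n) \<times> real \<Rightarrow> real^'n" where
  "offset a = fst a + snd a *\<^sub>R \<nu> (fst a)"

definition annulus :: "real \<Rightarrow> (real^'n) set" where
  "annulus h = {x. x \<notin> K \<and> infdist x K \<le> h}"

lemma annulus_borel: "annulus h \<in> sets borel"
proof -
  have "closed {x. infdist x K \<le> h}" by (intro closed_Collect_le continuous_intros)
  then have "{x. infdist x K \<le> h} - K \<in> sets borel" using closedK by (intro sets.Diff borel_closed)
  moreover have "annulus h = {x. infdist x K \<le> h} - K" by (auto simp: annulus_def)
  ultimately show ?thesis by simp
qed

lemma annulus_closest_point:
  assumes "E \<subseteq> S"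
  shows "{x \<in> annulus h. closest_point K x \<in> E} = offset ` (E \<times> {0<..h})"
proof (intro equalityI subsetI)
  fix x assume x: "x \<in> {x \<in> annulus h. closest_point K x \<in> E}"
  then have "x \<notin> K" by (simp add: annulus_def)
  note cp = closest_point_normal[OF this]
  have "x = offset (closest_point K x, infdist x K)" using cp(2,3) by (simp add: offset_def)
  moreover have "(closest_point K x, infdist x K) \<in> E \<times> {0<..h}" using x cp(3,4) by (auto simp: annulus_def)
  ultimately show "x \<in> offset ` (E \<times> {0<..h})" by (rule image_eqI)
next
  fix x assume "x \<in> offset ` (E \<times> {0<..h})"
  then obtain z t where zt: "z \<in> E" "0 < t" "t \<le> h" "x = z + t *\<^sub>R \<nu> z" by (auto simp: offset_def)
  then show "x \<in> {x \<in> annulus h. closest_point K x \<in> E}"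
    using closest_point_offset[of z t] assms by (auto simp: annulus_def)
qed

end

context local_frame
begin

text \<open>\<open>offset\<close> is compared with the flat coordinates \<open>(P z, t)\<close>,
  whose distances \<open>Psi\<close> preserves. The difference vectors deviate by three terms of
  sizes \<open>2 * e\<close>, \<open>e\<close> and \<open>2 * e\<close> relative to the flat
  distance.\<close>

lemma offset_bilipschitz:
  assumes e: "0 < e" "e \<le> 1/10"
  obtains \<delta> h0 where "\<delta> > 0" "h0 > 0"
    "\<And>z y. z \<in> S \<inter> ball y0 \<delta> \<Longrightarrow> y \<in> S \<inter> ball y0 \<delta> \<Longrightarrow> norm (z - y) \<le> (1 + e) * norm (P z - P y)"
    "\<And>z t z' t'. z \<in> S \<inter> ball y0 \<delta> \<Longrightarrow> z' \<in> S \<inter> ball y0 \<delta> \<Longrightarrow> 0 < t' \<Longrightarrow> t' \<le> h0 \<Longrightarrow>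
       \<bar>dist (offset (z, t)) (offset (z', t')) - dist (P z, t) (P z', t')\<bar> \<le> 5 * e * dist (P z, t) (P z', t')"
proof -
  have eh: "0 < e" "e \<le> 1/2" using e by auto
  obtain \<delta>1 where \<delta>1: "\<delta>1 > 0" "\<And>z y. z \<in> S \<inter> ball y0 \<delta>1 \<Longrightarrow> y \<in> S \<inter> ball y0 \<delta>1 \<Longrightarrow> \<bar>(z - y) \<bullet> \<nu> y0\<bar> \<le> e * norm (z - y)"
    using near_tangent[OF e(1)] by blast
  obtain \<delta>2 where \<delta>2: "\<delta>2 > 0"
    "\<And>z y. z \<in> S \<inter> ball y0 \<delta>2 \<Longrightarrow> y \<in> S \<inter> ball y0 \<delta>2 \<Longrightarrow> norm (z - y) \<le> (1 + e) * norm (P z - P y)"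
    using projection_bilipschitz[OF eh] by blast
  obtain \<delta>3 where \<delta>3: "\<delta>3 > 0" "\<And>z y. z \<in> S \<inter> ball y0 \<delta>3 \<Longrightarrow> y \<in> S \<inter> ball y0 \<delta>3 \<Longrightarrow> norm (\<nu> z - \<nu> y) \<le> e"
    using normal_close[OF e(1)] by blast
  obtain \<delta>4 L where \<delta>4: "\<delta>4 > 0" and L: "L > 0"
    "\<And>z y. z \<in> S \<inter> ball y0 \<delta>4 \<Longrightarrow> y \<in> S \<inter> ball y0 \<delta>4 \<Longrightarrow> norm (\<nu> z - \<nu> y) \<le> L * norm (z - y)"
    using normal_lipschitz by blast
  define \<delta> where "\<delta> = min (min \<delta>1 \<delta>2) (min \<delta>3 \<delta>4)"
  have \<delta>: "\<delta> > 0" using \<delta>1 \<delta>2 \<delta>3 \<delta>4 by (simp add: \<delta>_def)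
  have Db: "ball y0 \<delta> \<subseteq> ball y0 \<delta>1" "ball y0 \<delta> \<subseteq> ball y0 \<delta>2" "ball y0 \<delta> \<subseteq> ball y0 \<delta>3" "ball y0 \<delta> \<subseteq> ball y0 \<delta>4"
    by (auto simp: \<delta>_def)
  \<comment> \<open>Up to this height the turning of the normal, at rate \<open>L\<close>, moves
    points by at most \<open>e\<close> times their distance.\<close>
  define h0 where "h0 = e / L"
  have bil: "norm (z - y) \<le> (1 + e) * norm (P z - P y)" if "z \<in> S \<inter> ball y0 \<delta>" "y \<in> S \<inter> ball y0 \<delta>" for z y
    using that Db(2) by (intro \<delta>2(2)) blast+
  show ?thesis
  proof (rule that[of \<delta> h0])
    show "\<delta> > 0" by (rule \<delta>)
    show "h0 > 0" using e L by (simp add: h0_def)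
    show "norm (z - y) \<le> (1 + e) * norm (P z - P y)" if "z \<in> S \<inter> ball y0 \<delta>" "y \<in> S \<inter> ball y0 \<delta>" for z y
      by (rule bil[OF that])
    fix z t z' t' assume z: "z \<in> S \<inter> ball y0 \<delta>" "z' \<in> S \<inter> ball y0 \<delta>" and t': "0 < t'" "t' \<le> h0"
    define w where "w = Psi (P z - P z', t - t')"
    define n where "n = norm w"
    have nw: "dist (P z, t) (P z', t') = n"
      unfolding n_def w_def norm_Psi by (simp add: dist_norm)
    have nP: "norm (P z - P z') \<le> n" "\<bar>t - t'\<bar> \<le> n"
      unfolding n_def w_def norm_Psi
      using norm_fst_le[of "P z - P z'" "t - t'"] norm_snd_le[of "t - t'" "P z - P z'"] by (auto simp: norm_Pair)
    have n0: "n \<ge> 0" by (simp add: n_def)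
    have zz: "norm (z - z') \<le> (1 + e) * n"
      using bil[OF z] nP(1) e by (meson add_nonneg_nonneg mult_left_mono order_trans zero_le_one less_imp_le)
    define s where "s = (z - z') \<bullet> \<nu> y0"
    have s: "\<bar>s\<bar> \<le> e * norm (z - z')" unfolding s_def using z Db(1) by (intro \<delta>1(2)) blast+
    have "z - z' = J (P z - P z') + s *\<^sub>R \<nu> y0"
      using decomp[of "z - z'"] by (simp add: s_def linear_diff[OF linP])
    \<comment> \<open>The three corrections: the normal part of the chord, the tilt of
      \<open>\<nu> z\<close> against \<open>\<nu> y0\<close>, and the change of the normal between
      the two points.\<close>
    then have eq: "offset (z, t) - offset (z', t') = w + (s *\<^sub>R \<nu> y0 + ((t - t') *\<^sub>R (\<nu> z - \<nu> y0) + t' *\<^sub>R (\<nu> z - \<nu> z')))"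
      by (simp add: offset_def w_def Psi_def algebra_simps)
    have "norm (\<nu> z - \<nu> y0) \<le> e" using z y0 \<delta>3(1) Db(3) by (intro \<delta>3(2)) auto
    then have 1: "norm ((t - t') *\<^sub>R (\<nu> z - \<nu> y0)) \<le> n * e" using nP(2) by (simp add: mult_mono)
    have "norm (t' *\<^sub>R (\<nu> z - \<nu> z')) \<le> h0 * (L * norm (z - z'))"
    proof -
      have "norm (\<nu> z - \<nu> z') \<le> L * norm (z - z')" using z Db(4) by (intro L(2)) blast+
      then show ?thesis using t' L by (simp add: mult_mono)
    qed
    also have "\<dots> = e * norm (z - z')" using L by (simp add: h0_def)
    finally have 2: "norm (t' *\<^sub>R (\<nu> z - \<nu> z')) \<le> e * norm (z - z')" .
    have 3: "norm (s *\<^sub>R \<nu> y0) \<le> e * norm (z - z')" using s by (simp add: unit_u)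
    have ez: "e * norm (z - z') \<le> 2 * e * n"
    proof -
      have "(1 + e) * n \<le> 2 * n" using e n0 by (intro mult_right_mono) auto
      then have "norm (z - z') \<le> 2 * n" using zz by linarith
      then show ?thesis using mult_left_mono[of "norm (z - z')" "2 * n" e] e by simp
    qed
    have "norm (s *\<^sub>R \<nu> y0 + ((t - t') *\<^sub>R (\<nu> z - \<nu> y0) + t' *\<^sub>R (\<nu> z - \<nu> z')))
       \<le> norm (s *\<^sub>R \<nu> y0) + (norm ((t - t') *\<^sub>R (\<nu> z - \<nu> y0)) + norm (t' *\<^sub>R (\<nu> z - \<nu> z')))"
      by (intro norm_triangle_le add_left_mono norm_triangle_ineq)
    also have "\<dots> \<le> 5 * (e * n)"
    proof -
      have "norm ((t - t') *\<^sub>R (\<nu> z - \<nu> y0)) \<le> e * n" using 1 by (simp only: mult.commute[of n e])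
      moreover have "e * norm (z - z') \<le> 2 * (e * n)" using ez by simp
      ultimately show ?thesis using 2 3 by linarith
    qed
    also have "5 * (e * n) = 5 * e * n" by simp
    finally have le: "norm (s *\<^sub>R \<nu> y0 + ((t - t') *\<^sub>R (\<nu> z - \<nu> y0) + t' *\<^sub>R (\<nu> z - \<nu> z'))) \<le> 5 * e * n" .
    have "\<bar>norm (offset (z, t) - offset (z', t')) - norm w\<bar> \<le> 5 * e * n"
      unfolding eq by (rule order_trans[OF norm_triangle_ineq3 order_trans[OF _ le]]) simp
    then show "\<bar>dist (offset (z, t)) (offset (z', t')) - dist (P z, t) (P z', t')\<bar> \<le> 5 * e * dist (P z, t) (P z', t')"
      unfolding nw by (simp add: dist_norm n_def)
  qed
qed

lemma minkowski_local:
  assumes \<epsilon>: "0 < \<epsilon>" "\<epsilon> < 1"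
  obtains \<delta> h0 where "\<delta> > 0" "h0 > 0"
    "\<And>E h. E \<in> sets borel \<Longrightarrow> E \<subseteq> S \<inter> ball y0 \<delta> \<Longrightarrow> 0 < h \<Longrightarrow> h \<le> h0 \<Longrightarrow>
       hausdorff_outer CARD('n) (offset ` (E \<times> {0<..h})) \<le> ennreal ((1 + \<epsilon>) ^ (2 * CARD('n))) * (ennreal h * hausdorff_outer (CARD('n) - 1) E) \<and>
       ennreal h * hausdorff_outer (CARD('n) - 1) E \<le> ennreal ((1 + \<epsilon>) ^ (2 * CARD('n))) * hausdorff_outer CARD('n) (offset ` (E \<times> {0<..h})) \<and>
       hausdorff_outer (CARD('n) - 1) E < \<infinity>"
proof -
  \<comment> \<open>Then \<open>5 * e = \<epsilon> / 4\<close>, and both \<open>1 + 5 * e\<close>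
    and the inverse of \<open>1 - 5 * e\<close> are at most \<open>1 + \<epsilon>\<close>.\<close>
  define e where "e = \<epsilon> / 20"
  have e: "0 < e" "e \<le> 1/10" using \<epsilon> by (auto simp: e_def)
  have e5: "1 + 5 * e \<le> 1 + \<epsilon>" "1 \<le> (1 + \<epsilon>) * (1 - 5 * e)" "1 + e \<le> 1 + \<epsilon>"
  proof -
    have "\<epsilon> * \<epsilon> \<le> \<epsilon> * 1" using \<epsilon> by (intro mult_left_mono) auto
    moreover have "(1 + \<epsilon>) * (1 - 5 * e) = 1 + (3 * \<epsilon> - \<epsilon> * \<epsilon>) / 4" by (simp add: e_def field_simps)
    ultimately show "1 \<le> (1 + \<epsilon>) * (1 - 5 * e)" using \<epsilon> by simp
  qed (use \<epsilon> in \<open>auto simp: e_def\<close>)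
  obtain \<delta> h0 where \<delta>: "\<delta> > 0" "h0 > 0"
    and bil: "\<And>z y. z \<in> S \<inter> ball y0 \<delta> \<Longrightarrow> y \<in> S \<inter> ball y0 \<delta> \<Longrightarrow> norm (z - y) \<le> (1 + e) * norm (P z - P y)"
    and off: "\<And>z t z' t'. z \<in> S \<inter> ball y0 \<delta> \<Longrightarrow> z' \<in> S \<inter> ball y0 \<delta> \<Longrightarrow> 0 < t' \<Longrightarrow> t' \<le> h0 \<Longrightarrow>
       \<bar>dist (offset (z, t)) (offset (z', t')) - dist (P z, t) (P z', t')\<bar> \<le> 5 * e * dist (P z, t) (P z', t')"
    using offset_bilipschitz[OF e] by blast
  show ?thesis
  proof (rule that[of "\<delta> / 2" h0])
    show "\<delta> / 2 > 0" "h0 > 0" using \<delta> by auto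
    fix E h assume E: "E \<in> sets borel" "E \<subseteq> S \<inter> ball y0 (\<delta> / 2)" and h: "0 < h" "h \<le> h0"
    define C where "C = S \<inter> cball y0 (\<delta> / 2)"
    have Cb: "C \<subseteq> S \<inter> ball y0 \<delta>" using \<delta> by (auto simp: C_def)
    have Eb: "E \<subseteq> S \<inter> ball y0 \<delta>" "E \<subseteq> C" using E(2) \<delta> by (auto simp: C_def)
    have Cc: "compact C" unfolding C_def by (intro compact_Int compact_frontier compact_cball)
    have "inj_on P C"
    proof (rule inj_onI)
      fix a b assume ab: "a \<in> C" "b \<in> C" "P a = P b"
      show "a = b" using bil[OF subsetD[OF Cb ab(1)] subsetD[OF Cb ab(2)]] ab(3) by simp
    qed
    then have PE: "P ` E \<in> sets borel"
      by (intro injective_continuous_image_borel[OF Cc continuous_PPsi(1)] E(1) Eb(2))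
    define c where "c = (1 + \<epsilon>) ^ CARD('n)"
    have c1: "c \<ge> 1" using \<epsilon> by (simp add: c_def)
    define HE where "HE = hausdorff_outer CARD('m) E"
    define HP where "HP = hausdorff_outer CARD('m) (P ` E)"
    have "hausdorff_outer CARD('m) (P ` E) \<le> ennreal (1 ^ CARD('m)) * hausdorff_outer CARD('m) E"
      by (rule hausdorff_outer_lipschitz_image) (auto simp: dist_norm linear_diff[OF linP, symmetric] normP_le)
    then have HPE: "HP \<le> HE" by (simp add: HP_def HE_def)
    have HEP: "HE \<le> ennreal c * HP"
    proof -
      have "hausdorff_outer CARD('m) ((\<lambda>z. z) ` E) \<le> ennreal ((1 + e) ^ CARD('m)) * hausdorff_outer CARD('m) (P ` E)"
      proof (rule hausdorff_outer_compare)
        fix z w assume zw: "z \<in> E" "w \<in> E"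
        show "dist z w \<le> (1 + e) * dist (P z) (P w)"
          using bil[OF subsetD[OF Eb(1) zw(1)] subsetD[OF Eb(1) zw(2)]] by (simp add: dist_norm)
      qed (use e in simp)
      also have "\<dots> \<le> ennreal c * hausdorff_outer CARD('m) (P ` E)"
      proof (intro mult_right_mono ennreal_leI)
        have "(1 + e) ^ CARD('m) \<le> (1 + \<epsilon>) ^ CARD('m)" using e e5 by (intro power_mono) auto
        also have "\<dots> \<le> c" unfolding c_def using \<epsilon> card_frame by (intro power_increasing) auto
        finally show "(1 + e) ^ CARD('m) \<le> c" .
      qed simp
      finally show ?thesis by (simp add: HE_def HP_def)
    qed
    let ?Y = "E \<times> {0<..h}"
    let ?Q = "\<lambda>a. (P (fst a), snd a)"
    have HL: "HP = emeasure lborel (P ` E)"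
    proof -
      have "hausdorff_outer DIM(real^'m) (P ` E) = emeasure lborel (P ` E)" by (rule hausdorff_outer_eq_lborel[OF PE])
      then show ?thesis by (simp add: HP_def)
    qed
    have Q: "hausdorff_outer CARD('n) (?Q ` ?Y) = ennreal h * HP"
    proof -
      have img: "?Q ` ?Y = (P ` E) \<times> {0<..h}" by force
      have "(P ` E) \<times> {0<..h} \<in> sets (borel :: ((real^'m) \<times> real) measure)" using PE by (intro borel_Times) auto
      then have "hausdorff_outer DIM((real^'m) \<times> real) ((P ` E) \<times> {0<..h}) = emeasure lborel ((P ` E) \<times> {0<..h})"
        by (rule hausdorff_outer_eq_lborel)
      also have "\<dots> = emeasure (lborel \<Otimes>\<^sub>M lborel) ((P ` E) \<times> {0<..h})" by (simp add: lborel_prod)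
      also have "\<dots> = emeasure lborel (P ` E) * emeasure lborel {0<..h}"
        using PE by (intro lborel.emeasure_pair_measure_Times) auto
      also have "\<dots> = ennreal h * HP" using h by (simp add: HL mult.commute)
      finally show ?thesis unfolding img using card_frame by simp
    qed
    define T where "T = hausdorff_outer CARD('n) (offset ` ?Y)"
    have bnd: "\<bar>dist (offset a) (offset b) - dist (?Q a) (?Q b)\<bar> \<le> 5 * e * dist (?Q a) (?Q b)" if "a \<in> ?Y" "b \<in> ?Y" for a b
      using off[of "fst a" "fst b" "snd b" "snd a"] that Eb h by (auto simp: subset_iff)
    have T1: "T \<le> ennreal c * (ennreal h * HP)"
      unfolding T_def c_def Q[symmetric]
    proof (rule hausdorff_outer_compare)
      fix a b assume ab: "a \<in> ?Y" "b \<in> ?Y"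
      have "dist (offset a) (offset b) \<le> (1 + 5 * e) * dist (?Q a) (?Q b)" using bnd[OF ab] by (simp add: algebra_simps abs_le_iff)
      also have "\<dots> \<le> (1 + \<epsilon>) * dist (?Q a) (?Q b)" using e5 by (intro mult_right_mono) auto
      finally show "dist (offset a) (offset b) \<le> (1 + \<epsilon>) * dist (?Q a) (?Q b)" .
    qed (use \<epsilon> in simp)
    have T2: "ennreal h * HP \<le> ennreal c * T"
      unfolding T_def c_def Q[symmetric]
    proof (rule hausdorff_outer_compare)
      fix a b assume ab: "a \<in> ?Y" "b \<in> ?Y"
      have "(1 - 5 * e) * dist (?Q a) (?Q b) \<le> dist (offset a) (offset b)" using bnd[OF ab] by (simp add: algebra_simps abs_le_iff)
      then have "(1 + \<epsilon>) * ((1 - 5 * e) * dist (?Q a) (?Q b)) \<le> (1 + \<epsilon>) * dist (offset a) (offset b)"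
        using \<epsilon> by (intro mult_left_mono) auto
      moreover have "1 * dist (?Q a) (?Q b) \<le> (1 + \<epsilon>) * (1 - 5 * e) * dist (?Q a) (?Q b)"
        using e5 by (intro mult_right_mono) auto
      ultimately show "dist (?Q a) (?Q b) \<le> (1 + \<epsilon>) * dist (offset a) (offset b)" by (simp add: mult.assoc)
    qed (use \<epsilon> in simp)
    have cc: "ennreal ((1 + \<epsilon>) ^ (2 * CARD('n))) = ennreal c * ennreal c"
      using \<epsilon> by (simp add: c_def ennreal_mult[symmetric] power_mult power2_eq_square power_add[symmetric] mult_2)
    have one: "x \<le> ennreal c * x" for x
      using mult_right_mono[of 1 "ennreal c" x] c1 by simp
    have "T \<le> ennreal c * (ennreal h * HE)"
      by (rule order_trans[OF T1]) (intro mult_left_mono HPE; simp)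
    also have "\<dots> \<le> ennreal c * ennreal c * (ennreal h * HE)" using one by (simp add: mult.assoc)
    finally have R1: "T \<le> ennreal c * ennreal c * (ennreal h * HE)" .
    have "ennreal h * HE \<le> ennreal h * (ennreal c * HP)" by (intro mult_left_mono HEP) simp
    also have "\<dots> = ennreal c * (ennreal h * HP)" by (simp add: mult.left_commute)
    also have "\<dots> \<le> ennreal c * (ennreal c * T)" by (intro mult_left_mono T2) simp
    finally have R2: "ennreal h * HE \<le> ennreal c * ennreal c * T" by (simp add: mult.assoc)
    have "HP < \<infinity>"
    proof -
      have "bounded (P ` E)"
        using compact_imp_bounded[OF compact_continuous_image[OF continuous_PPsi(1) Cc]] Eb(2) by (meson bounded_subset image_mono)
      then show ?thesis unfolding HL by (rule emeasure_bounded_finite)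
    qed
    then have "ennreal c * HP < \<infinity>" by (simp add: ennreal_mult_less_top)
    then have R3: "HE < \<infinity>" using HEP by (rule le_less_trans[rotated])
    show "hausdorff_outer CARD('n) (offset ` ?Y) \<le> ennreal ((1 + \<epsilon>) ^ (2 * CARD('n))) * (ennreal h * hausdorff_outer (CARD('n) - 1) E) \<and>
       ennreal h * hausdorff_outer (CARD('n) - 1) E \<le> ennreal ((1 + \<epsilon>) ^ (2 * CARD('n))) * hausdorff_outer CARD('n) (offset ` ?Y) \<and>
       hausdorff_outer (CARD('n) - 1) E < \<infinity>"
      using R1 R2 R3 unfolding cc d_eq HE_def T_def by blast
  qed
qed

end

section \<open>From local to global by compactness of the boundary\<close>

context C2_convex_body
begin

lemma frontier_finite_cover:
  assumes "\<And>y. y \<in> S \<Longrightarrow> (\<delta> y :: real) > 0"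
  obtains I where "finite I" "I \<subseteq> S" "S \<subseteq> (\<Union>y\<in>I. ball y (\<delta> y))"
proof -
  have "S \<subseteq> (\<Union>y\<in>S. ball y (\<delta> y))" using assms by force
  then show ?thesis
    using compactE_image[OF compact_frontier, of S "\<lambda>y. ball y (\<delta> y)"] that by (metis open_ball)
qed

lemma S_nonempty: "S \<noteq> {}"
proof
  assume "S = {}"
  then have "K = {} \<or> K = UNIV" using frontier_eq_empty by blast
  then show False using K_nonempty compact_imp_bounded[OF compactK] not_bounded_UNIV by blast
qed

lemma choice_pos2:
  assumes "\<And>y. y \<in> A \<Longrightarrow> \<exists>\<delta> h. (\<delta> :: real) > 0 \<and> (h :: real) > 0 \<and> Q y \<delta> h"
  obtains \<delta> h where "\<And>y. y \<in> A \<Longrightarrow> \<delta> y > 0" "\<And>y. y \<in> A \<Longrightarrow> h y > 0" "\<And>y. y \<in> A \<Longrightarrow> Q y (\<delta> y) (h y)"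
  using assms by metis

text \<open>Finitely many neighbourhoods from the local estimate cover the boundary; the closest
  point of \<open>x\<close> lies in one of them, and the least of their \<open>h0\<close> serves for
  all.\<close>

theorem visible_measure:
  assumes g: "\<And>x. x \<in> S \<Longrightarrow> g x = sqrt (\<kappa> x)" and \<epsilon>: "0 < \<epsilon>" "\<epsilon> < 1"
  obtains h0 where "h0 > 0"
    "\<And>x. x \<notin> K \<Longrightarrow> infdist x K \<le> h0 \<Longrightarrow>
       ennreal (unit_ball_vol (real (CARD('n) - 1)) * ((1 - \<epsilon>) * sqrt (2 * infdist x K)) ^ (CARD('n) - 1))
         \<le> emeasure (weighted_surface_measure K g) (visible x) \<and>
       emeasure (weighted_surface_measure K g) (visible x)
         \<le> ennreal (unit_ball_vol (real (CARD('n) - 1)) * ((1 + \<epsilon>) * sqrt (2 * infdist x K)) ^ (CARD('n) - 1))"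
proof -
  let ?Q = "\<lambda>x. ennreal (unit_ball_vol (real (CARD('n) - 1)) * ((1 - \<epsilon>) * sqrt (2 * infdist x K)) ^ (CARD('n) - 1))
         \<le> emeasure (weighted_surface_measure K g) (visible x) \<and>
       emeasure (weighted_surface_measure K g) (visible x)
         \<le> ennreal (unit_ball_vol (real (CARD('n) - 1)) * ((1 + \<epsilon>) * sqrt (2 * infdist x K)) ^ (CARD('n) - 1))"
  define L where "L y \<delta> h \<longleftrightarrow> (\<forall>x. x \<notin> K \<longrightarrow> closest_point K x \<in> ball y \<delta> \<longrightarrow> infdist x K \<le> h \<longrightarrow> ?Q x)" for y \<delta> h
  have "\<exists>\<delta> h0. \<delta> > 0 \<and> h0 > 0 \<and> L y \<delta> h0" if y: "y \<in> S" for y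
  proof -
    obtain J :: "real^'n pred_index \<Rightarrow> real^'n" and P \<delta>0 \<rho> G H B where lf: "local_frame K J P y \<delta>0 \<rho> G H B"
      using local_frame_exists[OF y card_pred_index[OF card_ge_2]] by blast
    interpret lf: local_frame K J P y \<delta>0 \<rho> G H B by fact
    obtain \<delta> h0 where "\<delta> > 0" "h0 > 0"
      "\<And>x. x \<notin> K \<Longrightarrow> closest_point K x \<in> ball y \<delta> \<Longrightarrow> infdist x K \<le> h0 \<Longrightarrow> ?Q x"
      using lf.visible_measure_local[OF g \<epsilon>, folded lf.d_eq] by blast
    then show ?thesis unfolding L_def by blast
  qed
  then obtain \<delta> h where \<delta>: "\<And>y. y \<in> S \<Longrightarrow> \<delta> y > 0" "\<And>y. y \<in> S \<Longrightarrow> h y > 0" "\<And>y. y \<in> S \<Longrightarrow> L y (\<delta> y) (h y)"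
    using choice_pos2[of S L] by blast
  obtain I where I: "finite I" "I \<subseteq> S" "S \<subseteq> (\<Union>y\<in>I. ball y (\<delta> y))" by (rule frontier_finite_cover[OF \<delta>(1)])
  have "I \<noteq> {}" using I(3) S_nonempty by auto
  define h0 where "h0 = Min (h ` I)"
  show ?thesis
  proof (rule that[of h0])
    show "h0 > 0" unfolding h0_def using I \<delta>(2) \<open>I \<noteq> {}\<close> by (subst Min_gr_iff) auto
    fix x assume x: "x \<notin> K" "infdist x K \<le> h0"
    obtain y where y: "y \<in> I" "closest_point K x \<in> ball y (\<delta> y)" using closest_point_normal(1)[OF x(1)] I(3) by blast
    have "infdist x K \<le> h y" using x(2) I(1) y(1) unfolding h0_def by (meson Min_le finite_imageI imageI order_trans)
    moreover have "L y (\<delta> y) (h y)" using \<delta>(3) y(1) I(2) by blast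
    ultimately show "?Q x" using y(2) x(1) unfolding L_def by blast
  qed
qed

text \<open>The local estimate holds for every Borel piece of the boundary, so it can be summed once
  the volume of the shell is regarded as a measure on the boundary.\<close>

theorem minkowski_content:
  assumes \<epsilon>: "0 < \<epsilon>" "\<epsilon> < 1"
  obtains h0 where "h0 > 0"
    "\<And>h. 0 < h \<Longrightarrow> h \<le> h0 \<Longrightarrow>
       emeasure lborel (annulus h) \<le> ennreal ((1 + \<epsilon>) ^ (2 * CARD('n))) * (ennreal h * hausdorff_outer (CARD('n) - 1) S) \<and>
       ennreal h * hausdorff_outer (CARD('n) - 1) S \<le> ennreal ((1 + \<epsilon>) ^ (2 * CARD('n))) * emeasure lborel (annulus h)"
proof -
  let ?c = "ennreal ((1 + \<epsilon>) ^ (2 * CARD('n)))"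
  define L where "L y \<delta> h0 \<longleftrightarrow> (\<forall>E h. E \<in> sets borel \<longrightarrow> E \<subseteq> S \<inter> ball y \<delta> \<longrightarrow> 0 < h \<longrightarrow> h \<le> h0 \<longrightarrow>
       hausdorff_outer CARD('n) (offset ` (E \<times> {0<..h})) \<le> ?c * (ennreal h * hausdorff_outer (CARD('n) - 1) E) \<and>
       ennreal h * hausdorff_outer (CARD('n) - 1) E \<le> ?c * hausdorff_outer CARD('n) (offset ` (E \<times> {0<..h})) \<and>
       hausdorff_outer (CARD('n) - 1) E < \<infinity>)" for y \<delta> h0
  have "\<exists>\<delta> h0. \<delta> > 0 \<and> h0 > 0 \<and> L y \<delta> h0" if y: "y \<in> S" for y
  proof -
    obtain J :: "real^'n pred_index \<Rightarrow> real^'n" and P \<delta>0 \<rho> G H B where lf: "local_frame K J P y \<delta>0 \<rho> G H B"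
      using local_frame_exists[OF y card_pred_index[OF card_ge_2]] by blast
    interpret lf: local_frame K J P y \<delta>0 \<rho> G H B by fact
    show ?thesis
    proof (rule lf.minkowski_local[OF \<epsilon>])
      fix \<delta> h0 :: real
      assume h: "\<delta> > 0" "h0 > 0" and l: "\<And>E h. E \<in> sets borel \<Longrightarrow> E \<subseteq> S \<inter> ball y \<delta> \<Longrightarrow> 0 < h \<Longrightarrow> h \<le> h0 \<Longrightarrow>
       hausdorff_outer CARD('n) (offset ` (E \<times> {0<..h})) \<le> ?c * (ennreal h * hausdorff_outer (CARD('n) - 1) E) \<and>
       ennreal h * hausdorff_outer (CARD('n) - 1) E \<le> ?c * hausdorff_outer CARD('n) (offset ` (E \<times> {0<..h})) \<and>
       hausdorff_outer (CARD('n) - 1) E < \<infinity>"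
      have "L y \<delta> h0" unfolding L_def by (intro allI impI l)
      then show ?thesis using h by blast
    qed
  qed
  then obtain \<delta> h where \<delta>: "\<And>y. y \<in> S \<Longrightarrow> \<delta> y > 0" "\<And>y. y \<in> S \<Longrightarrow> h y > 0" "\<And>y. y \<in> S \<Longrightarrow> L y (\<delta> y) (h y)"
    using choice_pos2[of S L] by blast
  obtain I where I: "finite I" "I \<subseteq> S" "S \<subseteq> (\<Union>y\<in>I. ball y (\<delta> y))" by (rule frontier_finite_cover[OF \<delta>(1)])
  have "I \<noteq> {}" using I(3) S_nonempty by auto
  define h0 where "h0 = Min (h ` I)"
  show ?thesis
  proof (rule that[of h0])
    show "h0 > 0" unfolding h0_def using I \<delta>(2) \<open>I \<noteq> {}\<close> by (subst Min_gr_iff) auto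
    fix t assume t: "0 < t" "t \<le> h0"
    \<comment> \<open>The volume of the shell transported to the boundary along closest points; it
      gives \<open>E\<close> the volume of the part of the shell over \<open>E\<close>.\<close>
    define M where "M = distr (restrict_space lborel (annulus t)) borel (closest_point K)"
    define N where "N = (hausdorff_measure (CARD('n) - 1) :: (real^'n) measure)"
    have cm: "closest_point K \<in> borel_measurable borel"
      using continuous_on_closest_point[OF convexK closedK K_nonempty] by (rule borel_measurable_continuous_onI)
    then have cm': "closest_point K \<in> measurable (restrict_space lborel (annulus t)) borel"
      by (intro measurable_restrict_space1) simp
    have sets: "sets M = sets borel" "sets N = sets borel" by (auto simp: M_def N_def)
    have ME: "emeasure M E = emeasure lborel {x \<in> annulus t. closest_point K x \<in> E}" if "E \<in> sets borel" for E
    proof -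
      have "emeasure M E = emeasure (restrict_space lborel (annulus t)) (closest_point K -` E \<inter> space (restrict_space lborel (annulus t)))"
        unfolding M_def using that cm' by (intro emeasure_distr)
      also have "closest_point K -` E \<inter> space (restrict_space lborel (annulus t)) = {x \<in> annulus t. closest_point K x \<in> E}"
        by (auto simp: space_restrict_space)
      also have "emeasure (restrict_space lborel (annulus t)) \<dots> = emeasure lborel {x \<in> annulus t. closest_point K x \<in> E}"
        using annulus_borel by (intro emeasure_restrict_space) auto
      finally show ?thesis .
    qed
    have NE: "emeasure N E = hausdorff_outer (CARD('n) - 1) E" if "E \<in> sets borel" for E
      unfolding N_def by (rule emeasure_hausdorff_measure[OF d_pos that])
    have MH: "emeasure M E = hausdorff_outer CARD('n) (offset ` (E \<times> {0<..t}))" if "E \<in> sets borel" "E \<subseteq> S" for E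
    proof -
      have "{x \<in> annulus t. closest_point K x \<in> E} = annulus t \<inter> closest_point K -` E" by auto
      also have "\<dots> \<in> sets borel" using annulus_borel measurable_sets_borel[OF cm that(1)] by (intro sets.Int) auto
      finally have b: "{x \<in> annulus t. closest_point K x \<in> E} \<in> sets borel" .
      have "hausdorff_outer DIM(real^'n) {x \<in> annulus t. closest_point K x \<in> E} = emeasure lborel {x \<in> annulus t. closest_point K x \<in> E}"
        by (rule hausdorff_outer_eq_lborel[OF b])
      then show ?thesis using ME[OF that(1)] annulus_closest_point[OF that(2), of t] by simp
    qed
    have loc: "emeasure M E \<le> ?c * (ennreal t * emeasure N E) \<and> ennreal t * emeasure N E \<le> ?c * emeasure M E"
      if "y \<in> I" "E \<in> sets borel" "E \<subseteq> S \<inter> ball y (\<delta> y)" for y E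
    proof -
      have "t \<le> h y" using t(2) I(1) that(1) unfolding h0_def by (meson Min_le finite_imageI imageI order_trans)
      moreover have "L y (\<delta> y) (h y)" using \<delta>(3) that(1) I(2) by blast
      moreover have "E \<subseteq> S" using that(3) by blast
      ultimately show ?thesis unfolding MH[OF that(2) \<open>E \<subseteq> S\<close>] NE[OF that(2)]
        using that(2,3) t(1) unfolding L_def by blast
    qed
    have "1 * emeasure M S \<le> (?c * ennreal t) * emeasure N S"
      by (rule emeasure_le_locally[OF sets I(1) _ S_borel I(3)]) (use loc in \<open>auto simp: mult.assoc\<close>)
    moreover have "ennreal t * emeasure N S \<le> ?c * emeasure M S"
      by (rule emeasure_le_locally[OF sets(2,1) I(1) _ S_borel I(3)]) (use loc in auto)
    moreover have "emeasure M S = emeasure lborel (annulus t)"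
    proof -
      have "{x \<in> annulus t. closest_point K x \<in> S} = annulus t"
        using closest_point_normal(1) by (auto simp: annulus_def)
      then show ?thesis using ME[OF S_borel] by simp
    qed
    ultimately show "emeasure lborel (annulus t) \<le> ?c * (ennreal t * hausdorff_outer (CARD('n) - 1) S) \<and>
       ennreal t * hausdorff_outer (CARD('n) - 1) S \<le> ?c * emeasure lborel (annulus t)"
      using NE[OF S_borel] by (simp add: mult.assoc)
  qed
qed

end

subsection \<open>The volume of the illumination body\<close>

text \<open>A set star-shaped with respect to a whole ball meets each ray from the centre in at most
  one frontier point, so its frontier is negligible and the set differs from its interior by a null
  set.\<close>

lemma sets_lebesgue_if_star:
  fixes B :: "'a::euclidean_space set"
  assumes r: "r > 0"
    and star: "\<And>x y c. x \<in> B \<Longrightarrow> y \<in> ball a r \<Longrightarrow> 0 \<le> c \<Longrightarrow> c \<le> 1 \<Longrightarrow> (1 - c) *\<^sub>R y + c *\<^sub>R x \<in> B"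
  shows "B \<in> sets lebesgue"
proof -
  have "negligible (frontier B)"
  proof (rule starlike_negligible_strong[where a = a])
    fix c :: real and x assume c: "0 \<le> c" "c < 1" and p: "a + x \<in> frontier B"
    define e where "e = (1 - c) * r"
    have e: "e > 0" using c r by (simp add: e_def)
    from p obtain p' where p': "p' \<in> B" "dist p' (a + x) < e"
      unfolding frontier_def using e by (auto simp: closure_approachable)
    \<comment> \<open>This ball is the image of \<open>ball a r\<close> under the contraction
      towards \<open>p'\<close> by the factor \<open>1 - c\<close>. It contains the shrunk frontier
      point, which is thus interior.\<close>
    have "ball ((1 - c) *\<^sub>R a + c *\<^sub>R p') e \<subseteq> B"
    proof
      fix q assume q: "q \<in> ball ((1 - c) *\<^sub>R a + c *\<^sub>R p') e"
      define y where "y = (1 / (1 - c)) *\<^sub>R (q - c *\<^sub>R p')"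
      have qy: "(1 - c) *\<^sub>R y + c *\<^sub>R p' = q" using c by (simp add: y_def)
      have "(1 - c) * norm (a - y) = norm ((1 - c) *\<^sub>R (a - y))" using c by simp
      also have "(1 - c) *\<^sub>R (a - y) = (1 - c) *\<^sub>R a + c *\<^sub>R p' - q"
        by (subst qy[symmetric]) (simp add: scaleR_right_diff_distrib)
      also have "norm \<dots> < (1 - c) * r" using q by (simp add: dist_norm e_def)
      finally have "y \<in> ball a r" using c by (simp add: dist_norm)
      then show "q \<in> B" using star[OF p'(1), of y c] c qy by simp
    qed
    moreover have "a + c *\<^sub>R x \<in> ball ((1 - c) *\<^sub>R a + c *\<^sub>R p') e"
    proof -
      have "(1 - c) *\<^sub>R a + c *\<^sub>R p' - (a + c *\<^sub>R x) = c *\<^sub>R (p' - (a + x))" by (simp add: algebra_simps)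
      then have "dist ((1 - c) *\<^sub>R a + c *\<^sub>R p') (a + c *\<^sub>R x) = c * dist p' (a + x)" using c by (simp add: dist_norm)
      also have "\<dots> \<le> 1 * dist p' (a + x)" using c by (intro mult_right_mono) auto
      finally show ?thesis using p'(2) by simp
    qed
    ultimately have "a + c *\<^sub>R x \<in> interior B" by (meson interiorI open_ball)
    then show "a + c *\<^sub>R x \<notin> frontier B" by (simp add: frontier_def)
  qed auto
  then have "B \<inter> frontier B \<in> sets lebesgue" by (intro negligible_imp_sets) (rule negligible_subset, auto)
  moreover have "interior B \<in> sets lebesgue" by simp
  moreover have "B = interior B \<union> (B \<inter> frontier B)" using interior_subset[of B] closure_subset[of B] unfolding frontier_def by blast
  ultimately show ?thesis by (metis sets.Un)
qed

text \<open>For fixed \<epsilon> the bounds need not meet; they close up only when \<epsilon> tends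
  to 0 after the limit along \<open>X\<close>.\<close>

lemma tendsto_family_sandwich:
  fixes F :: "'a \<Rightarrow> real"
  assumes "\<And>\<epsilon>. 0 < \<epsilon> \<Longrightarrow> \<epsilon> < 1 \<Longrightarrow> eventually (\<lambda>s. a \<epsilon> \<le> F s \<and> F s \<le> b \<epsilon>) X"
    and a: "(a \<longlongrightarrow> l) (at_right (0::real))" and b: "(b \<longlongrightarrow> l) (at_right 0)"
  shows "(F \<longlongrightarrow> l) X"
proof (rule order_tendstoI)
  have e01: "eventually (\<lambda>\<epsilon>. 0 < \<epsilon> \<and> \<epsilon> < 1) (at_right (0::real))" by (rule eventually_at_right_real[of 0 1, simplified])
  { fix u assume "u < l"
    with a have "eventually (\<lambda>\<epsilon>. u < a \<epsilon>) (at_right 0)" by (rule order_tendstoD)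
    with e01 have "eventually (\<lambda>\<epsilon>. u < a \<epsilon> \<and> 0 < \<epsilon> \<and> \<epsilon> < 1) (at_right 0)" by eventually_elim auto
    then obtain \<epsilon> where "u < a \<epsilon>" "0 < \<epsilon>" "\<epsilon> < 1" using eventually_happens trivial_limit_at_right_real by blast
    with assms(1)[of \<epsilon>] show "eventually (\<lambda>s. u < F s) X" by (auto elim!: eventually_mono) }
  { fix u assume "l < u"
    with b have "eventually (\<lambda>\<epsilon>. b \<epsilon> < u) (at_right 0)" by (rule order_tendstoD)
    with e01 have "eventually (\<lambda>\<epsilon>. b \<epsilon> < u \<and> 0 < \<epsilon> \<and> \<epsilon> < 1) (at_right 0)" by eventually_elim auto
    then obtain \<epsilon> where "b \<epsilon> < u" "0 < \<epsilon>" "\<epsilon> < 1" using eventually_happens trivial_limit_at_right_real by blast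
    with assms(1)[of \<epsilon>] show "eventually (\<lambda>s. F s < u) X" by (auto elim!: eventually_mono) }
qed

text \<open>Inverts the formula for the visible measure. The factor \<open>a\<close> multiplies the
  radius, so it appears squared in front of the distance \<open>t\<close>.\<close>

lemma power_radius_le_iff:
  assumes "\<omega> > 0" "s > 0" "a > 0" "t \<ge> 0" "d \<ge> 1"
  shows "\<omega> * (a * sqrt (2 * t)) ^ d \<le> s \<longleftrightarrow> a\<^sup>2 * t \<le> (s / \<omega>) powr (2 / real d) / 2"
proof -
  define r where "r = (s / \<omega>) powr (1 / real d)"
  have r: "r > 0" using assms by (simp add: r_def)
  have rd: "r ^ d = s / \<omega>" using assms r by (simp add: powr_realpow[symmetric] r_def powr_powr)
  have "r\<^sup>2 = (s / \<omega>) powr (1 / real d * 2)" using assms unfolding r_def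
    by (simp add: powr_power)
  then have r2: "r\<^sup>2 = (s / \<omega>) powr (2 / real d)" by simp
  have "\<omega> * (a * sqrt (2 * t)) ^ d \<le> s \<longleftrightarrow> (a * sqrt (2 * t)) ^ d \<le> r ^ d"
    using assms by (simp add: rd field_simps)
  also have "\<dots> \<longleftrightarrow> a * sqrt (2 * t) \<le> r" using assms r by (intro power_mono_iff) auto
  also have "\<dots> \<longleftrightarrow> (a * sqrt (2 * t))\<^sup>2 \<le> r\<^sup>2" using assms r by (intro power_mono_iff[symmetric]) auto
  also have "\<dots> \<longleftrightarrow> a\<^sup>2 * t \<le> r\<^sup>2 / 2" using assms by (simp add: power_mult_distrib mult_ac)
  finally show ?thesis by (simp add: r2)
qed

context C2_convex_body
begin

lemma visible_empty: "x \<in> K \<Longrightarrow> visible x = {}"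
  using convex_hull_eq[of K] convexK by (simp add: visible_def insert_absorb)

lemma illumination_surface_body_visible:
  "illumination_surface_body K g s = {x. emeasure (weighted_surface_measure K g) (visible x) \<le> ennreal s}"
  by (simp add: illumination_surface_body_def visible_def)

text \<open>Used twice: for star-shapedness, which gives measurability, and to move a far point of
  the body to a distance where the visible measure is known.\<close>

lemma illumination_surface_body_mono:
  assumes "x \<in> illumination_surface_body K g s" "x' \<in> convex hull (insert x K)"
  shows "x' \<in> illumination_surface_body K g s"
proof -
  have "visible x \<in> sets (weighted_surface_measure K g)" unfolding weighted_surface_measure_def sets_density
    by (rule sets_surface[OF borel_closed[OF closed_visible] visible_subset])
  then have "emeasure (weighted_surface_measure K g) (visible x') \<le> emeasure (weighted_surface_measure K g) (visible x)"
    by (rule emeasure_mono[OF visible_mono[OF assms(2)]])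
  then show ?thesis using assms(1) unfolding illumination_surface_body_visible by simp
qed

lemma body_subset_illumination: "K \<subseteq> illumination_surface_body K g s"
  by (auto simp: illumination_surface_body_visible visible_empty)

lemma illumination_surface_body_lebesgue: "illumination_surface_body K g s \<in> sets lebesgue"
proof -
  obtain a r where ar: "r > 0" "ball a r \<subseteq> K"
    using interiorK by (auto simp: mem_interior)
  show ?thesis
  proof (rule sets_lebesgue_if_star[OF ar(1), of _ a])
    fix x y c assume x: "x \<in> illumination_surface_body K g s" and y: "y \<in> ball a r" and c: "0 \<le> (c::real)" "c \<le> 1"
    have "(1 - c) *\<^sub>R y + c *\<^sub>R x \<in> convex hull (insert x K)"
      using y ar(2) c by (intro convexD[OF convex_convex_hull]) (auto intro: hull_inc)
    then show "(1 - c) *\<^sub>R y + c *\<^sub>R x \<in> illumination_surface_body K g s"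
      by (rule illumination_surface_body_mono[OF x])
  qed
qed

lemma bounded_annulus: "bounded (annulus h)"
proof -
  obtain b where b: "\<And>x. x \<in> K \<Longrightarrow> norm x \<le> b" using compact_imp_bounded[OF compactK] by (auto simp: bounded_iff)
  have "norm x \<le> b + h" if "x \<in> annulus h" for x
  proof -
    from that have x: "x \<notin> K" "infdist x K \<le> h" by (auto simp: annulus_def)
    have "norm (closest_point K x) \<le> b" using b closest_point_in_set[OF closedK K_nonempty] by blast
    moreover have "norm (x - closest_point K x) \<le> h" using closest_point_normal(3)[OF x(1)] x(2) by simp
    ultimately show ?thesis using norm_triangle_sub[of x "closest_point K x"] by simp
  qed
  then show ?thesis by (auto simp: bounded_iff)
qed

lemma annulus_lmeasurable: "annulus h \<in> lmeasurable"
  using annulus_borel bounded_annulus by (intro bounded_set_imp_lmeasurable) auto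

lemma K_lmeasurable: "K \<in> lmeasurable" using compactK by (rule lmeasurable_compact)

lemma measure_K_Un_annulus:
  "K \<union> annulus h \<in> lmeasurable"
  "measure lebesgue (K \<union> annulus h) = measure lebesgue K + measure lborel (annulus h)"
proof -
  show "K \<union> annulus h \<in> lmeasurable" using K_lmeasurable annulus_lmeasurable by (rule fmeasurable.Un)
  have "measure lebesgue (K \<union> annulus h) = measure lebesgue K + measure lebesgue (annulus h)"
    by (rule measure_Un_AE[OF _ K_lmeasurable annulus_lmeasurable]) (auto simp: annulus_def)
  then show "measure lebesgue (K \<union> annulus h) = measure lebesgue K + measure lborel (annulus h)"
    using annulus_borel by simp
qed

section \<open>The illumination body between two parallel bodies\<close>

text \<open>\<open>\<eta> s\<close> is the distance at which the formula without error terms gives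
  visible measure exactly \<open>s\<close>. Errors \<open>1 + \<epsilon>\<close> and
  \<open>1 - \<epsilon>\<close> in the radius become squares in the distance.\<close>

lemma illumination_surface_body_bounds:
  assumes g: "\<And>x. x \<in> S \<Longrightarrow> g x = sqrt (\<kappa> x)" and \<epsilon>: "0 < \<epsilon>" "\<epsilon> < 1"
  defines "\<omega> \<equiv> unit_ball_vol (real (CARD('n) - 1))"
  defines "\<eta> \<equiv> \<lambda>s. (s / \<omega>) powr (2 / real (CARD('n) - 1)) / 2"
  obtains s0 where "s0 > 0"
    "\<And>s. 0 < s \<Longrightarrow> s < s0 \<Longrightarrow> K \<union> annulus (\<eta> s / (1 + \<epsilon>)\<^sup>2) \<subseteq> illumination_surface_body K g s"
    "\<And>s. 0 < s \<Longrightarrow> s < s0 \<Longrightarrow> illumination_surface_body K g s \<subseteq> K \<union> annulus (\<eta> s / (1 - \<epsilon>)\<^sup>2)"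
proof -
  let ?W = "weighted_surface_measure K g"
  obtain h0 where h0: "h0 > 0" and vm: "\<And>x. x \<notin> K \<Longrightarrow> infdist x K \<le> h0 \<Longrightarrow>
       ennreal (\<omega> * ((1 - \<epsilon>) * sqrt (2 * infdist x K)) ^ (CARD('n) - 1)) \<le> emeasure ?W (visible x) \<and>
       emeasure ?W (visible x) \<le> ennreal (\<omega> * ((1 + \<epsilon>) * sqrt (2 * infdist x K)) ^ (CARD('n) - 1))"
    using visible_measure[OF g \<epsilon>, folded \<omega>_def] by (rule; (assumption | blast))
  have \<omega>: "\<omega> > 0" by (simp add: \<omega>_def)
  have thr: "\<omega> * (a * sqrt (2 * t)) ^ (CARD('n) - 1) \<le> s \<longleftrightarrow> a\<^sup>2 * t \<le> \<eta> s" if "s > 0" "a > 0" "t \<ge> 0" for a t s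
    unfolding \<eta>_def by (rule power_radius_le_iff[OF \<omega> that d_pos])
  \<comment> \<open>The guaranteed visible measure at distance \<open>h0\<close>. For smaller
    \<open>s\<close> both threshold distances stay below \<open>h0\<close>, where the estimate is
    valid.\<close>
  define s0 where "s0 = \<omega> * ((1 - \<epsilon>) * sqrt (2 * h0)) ^ (CARD('n) - 1)"
  have small: "\<eta> s < (1 - \<epsilon>)\<^sup>2 * h0" if "0 < s" "s < s0" for s
    using thr[of s "1 - \<epsilon>" h0] that \<epsilon> h0 by (simp add: s0_def not_le[symmetric])
  show ?thesis
  proof (rule that[of s0])
    show "s0 > 0" using \<omega> \<epsilon> h0 by (simp add: s0_def)
    fix s assume s: "0 < s" "s < s0"
    have \<eta>0: "\<eta> s \<ge> 0" by (simp add: \<eta>_def)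
    show "K \<union> annulus (\<eta> s / (1 + \<epsilon>)\<^sup>2) \<subseteq> illumination_surface_body K g s"
    proof
      fix x assume x: "x \<in> K \<union> annulus (\<eta> s / (1 + \<epsilon>)\<^sup>2)"
      show "x \<in> illumination_surface_body K g s"
      proof (cases "x \<in> K")
        case True then show ?thesis using body_subset_illumination by blast
      next
        case False
        with x have t: "infdist x K \<le> \<eta> s / (1 + \<epsilon>)\<^sup>2" by (auto simp: annulus_def)
        then have t2: "(1 + \<epsilon>)\<^sup>2 * infdist x K \<le> \<eta> s" using \<epsilon> by (simp add: field_simps)
        have "1 * infdist x K \<le> (1 + \<epsilon>)\<^sup>2 * infdist x K" using \<epsilon> by (intro mult_right_mono infdist_nonneg one_le_power) auto
        moreover have "(1 - \<epsilon>)\<^sup>2 * h0 \<le> 1 * h0" using \<epsilon> h0 by (intro mult_right_mono power_le_one) auto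
        ultimately have "infdist x K \<le> h0" using t2 small[OF s] by linarith
        from vm[OF False this] have "emeasure ?W (visible x) \<le> ennreal (\<omega> * ((1 + \<epsilon>) * sqrt (2 * infdist x K)) ^ (CARD('n) - 1))" ..
        also have "\<dots> \<le> ennreal s" using thr[of s "1 + \<epsilon>" "infdist x K"] t2 s \<epsilon> infdist_nonneg by (intro ennreal_leI) auto
        finally show ?thesis by (simp add: illumination_surface_body_visible)
      qed
    qed
    show "illumination_surface_body K g s \<subseteq> K \<union> annulus (\<eta> s / (1 - \<epsilon>)\<^sup>2)"
    proof
      fix x assume xB: "x \<in> illumination_surface_body K g s"
      show "x \<in> K \<union> annulus (\<eta> s / (1 - \<epsilon>)\<^sup>2)"
      proof (rule ccontr)
        assume "x \<notin> K \<union> annulus (\<eta> s / (1 - \<epsilon>)\<^sup>2)"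
        then have x: "x \<notin> K" "infdist x K > \<eta> s / (1 - \<epsilon>)\<^sup>2" by (auto simp: annulus_def)
        \<comment> \<open>\<open>x\<close> may be far from \<open>K\<close>. It is moved along its
          normal to distance \<open>t\<close>, which is within range of the estimate yet still
          beyond the threshold, and the moved point remains in the body.\<close>
        define t where "t = min (infdist x K) h0"
        have "\<eta> s / (1 - \<epsilon>)\<^sup>2 < h0" using small[OF s] \<epsilon> by (simp add: field_simps)
        then have t1: "t > \<eta> s / (1 - \<epsilon>)\<^sup>2" using x by (simp add: t_def)
        have "0 \<le> \<eta> s / (1 - \<epsilon>)\<^sup>2" using \<eta>0 by simp
        then have t0: "t > 0" using t1 by linarith
        define y where "y = closest_point K x"
        note cp = closest_point_normal[OF x(1), folded y_def]
        define x' where "x' = y + t *\<^sub>R \<nu> y"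
        note co = closest_point_offset[OF cp(1) t0, folded x'_def]
        define l where "l = t / norm (x - y)"
        have l: "0 \<le> l" "l \<le> 1" using t0 cp(3,4) by (auto simp: l_def t_def field_simps)
        have "x - y = norm (x - y) *\<^sub>R \<nu> y" using cp(2) by (metis add_diff_cancel_left')
        then have "l *\<^sub>R (x - y) = t *\<^sub>R \<nu> y" using cp(4) by (metis l_def less_irrefl nonzero_eq_divide_eq scaleR_scaleR)
        then have x'l: "x' = (1 - l) *\<^sub>R y + l *\<^sub>R x" by (simp add: x'_def algebra_simps)
        have "y \<in> K" using cp(1) frontier_subset by blast
        then have "x' \<in> convex hull (insert x K)"
          unfolding x'l using l by (intro convexD[OF convex_convex_hull]) (auto intro: hull_inc)
        then have "x' \<in> illumination_surface_body K g s" by (rule illumination_surface_body_mono[OF xB])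
        moreover have "ennreal (\<omega> * ((1 - \<epsilon>) * sqrt (2 * t)) ^ (CARD('n) - 1)) \<le> emeasure ?W (visible x')"
          using vm[OF co(1)] unfolding co(3) by (simp add: t_def)
        ultimately have "ennreal (\<omega> * ((1 - \<epsilon>) * sqrt (2 * t)) ^ (CARD('n) - 1)) \<le> ennreal s"
          unfolding illumination_surface_body_visible by (auto intro: order_trans)
        then have "\<omega> * ((1 - \<epsilon>) * sqrt (2 * t)) ^ (CARD('n) - 1) \<le> s" using s by (simp add: ennreal_le_iff)
        then have "(1 - \<epsilon>)\<^sup>2 * t \<le> \<eta> s" using thr[of s "1 - \<epsilon>" t] s \<epsilon> t0 by simp
        then show False using t1 \<epsilon> by (simp add: field_simps)
      qed
    qed
  qed
qed

lemma minkowski_content_real: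
  assumes \<epsilon>: "0 < \<epsilon>" "\<epsilon> < 1"
  defines "\<mu> \<equiv> measure (surface_area_measure K) S"
  obtains h0 where "h0 > 0"
    "\<And>h. 0 < h \<Longrightarrow> h \<le> h0 \<Longrightarrow> measure lborel (annulus h) \<le> (1 + \<epsilon>) ^ (2 * CARD('n)) * (h * \<mu>)"
    "\<And>h. 0 < h \<Longrightarrow> h \<le> h0 \<Longrightarrow> h * \<mu> \<le> (1 + \<epsilon>) ^ (2 * CARD('n)) * measure lborel (annulus h)"
proof -
  define C where "C = (1 + \<epsilon>) ^ (2 * CARD('n))"
  have C: "C > 0" using \<epsilon> by (simp add: C_def)
  define HS where "HS = hausdorff_outer (CARD('n) - 1) S"
  obtain h0 where h0: "h0 > 0" and mc: "\<And>h. 0 < h \<Longrightarrow> h \<le> h0 \<Longrightarrow>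
       emeasure lborel (annulus h) \<le> ennreal C * (ennreal h * HS) \<and> ennreal h * HS \<le> ennreal C * emeasure lborel (annulus h)"
    using minkowski_content[OF \<epsilon>, folded C_def HS_def] by (rule; (assumption | blast))
  have fin: "emeasure lborel (annulus h) < \<infinity>" for h using bounded_annulus by (rule emeasure_bounded_finite)
  \<comment> \<open>\<open>measure\<close> would be 0 for infinite surface area, so finiteness has
    to be shown; it follows from the finite volume of one bounded shell.\<close>
  have "ennreal h0 * HS < \<infinity>"
    using le_less_trans[of "ennreal h0 * HS" "ennreal C * emeasure lborel (annulus h0)" \<infinity>] mc[of h0] h0 fin[of h0]
    by (simp add: ennreal_mult_less_top)
  then have "HS < \<infinity>" using h0 by (auto simp: ennreal_mult_less_top)
  moreover have "\<mu> = enn2real HS" using emeasure_surface[OF S_borel order_refl] by (simp add: \<mu>_def HS_def measure_def)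
  ultimately have HS: "HS = ennreal \<mu>" by simp
  have \<mu>: "\<mu> \<ge> 0" by (simp add: \<mu>_def)
  have eA: "emeasure lborel (annulus h) = ennreal (measure lborel (annulus h))" for h
    using fin[of h] by (intro emeasure_eq_ennreal_measure) auto
  show ?thesis
  proof (rule that[OF h0], unfold C_def[symmetric])
    fix h assume h: "0 < h" "h \<le> h0"
    have "ennreal (measure lborel (annulus h)) \<le> ennreal (C * (h * \<mu>))"
      using mc[OF h] h C \<mu> unfolding HS eA by (simp add: ennreal_mult[symmetric])
    then show "measure lborel (annulus h) \<le> C * (h * \<mu>)" using h C \<mu> by (simp add: ennreal_le_iff)
    have "ennreal (h * \<mu>) \<le> ennreal (C * measure lborel (annulus h))"
      using mc[OF h] h C \<mu> unfolding HS eA by (simp add: ennreal_mult[symmetric])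
    then show "h * \<mu> \<le> C * measure lborel (annulus h)" using C by (simp add: ennreal_le_iff)
  qed
qed

text \<open>Two errors multiply: the square from the threshold distance and the power
  \<open>2 * CARD('n)\<close> from the volume of the shell.\<close>

lemma illumination_volume_bounds:
  assumes g: "\<And>x. x \<in> S \<Longrightarrow> g x = sqrt (\<kappa> x)" and \<epsilon>: "0 < \<epsilon>" "\<epsilon> < 1"
  defines "\<eta> \<equiv> \<lambda>s. (s / unit_ball_vol (real (CARD('n) - 1))) powr (2 / real (CARD('n) - 1)) / 2"
    and "\<mu> \<equiv> measure (surface_area_measure K) S"
    and "V \<equiv> \<lambda>s. measure lebesgue (illumination_surface_body K g s) - measure lebesgue K"
  shows "eventually (\<lambda>s. \<mu> / ((1 + \<epsilon>)\<^sup>2 * (1 + \<epsilon>) ^ (2 * CARD('n))) \<le> V s / \<eta> s \<and>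
    V s / \<eta> s \<le> (1 + \<epsilon>) ^ (2 * CARD('n)) / (1 - \<epsilon>)\<^sup>2 * \<mu>) (at_right 0)"
proof -
  define C where "C = (1 + \<epsilon>) ^ (2 * CARD('n))"
  have C: "C > 0" using \<epsilon> by (simp add: C_def)
  have \<eta>_app: "(s / unit_ball_vol (real (CARD('n) - 1))) powr (2 / real (CARD('n) - 1)) / 2 = \<eta> s" for s
    unfolding \<eta>_def ..
  obtain s0 where s0: "s0 > 0"
    "\<And>s. 0 < s \<Longrightarrow> s < s0 \<Longrightarrow> K \<union> annulus (\<eta> s / (1 + \<epsilon>)\<^sup>2) \<subseteq> illumination_surface_body K g s"
    "\<And>s. 0 < s \<Longrightarrow> s < s0 \<Longrightarrow> illumination_surface_body K g s \<subseteq> K \<union> annulus (\<eta> s / (1 - \<epsilon>)\<^sup>2)"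
    using illumination_surface_body_bounds[OF g \<epsilon>, unfolded \<eta>_app] by (rule; (assumption | blast))
  obtain h0 where h0: "h0 > 0"
    "\<And>h. 0 < h \<Longrightarrow> h \<le> h0 \<Longrightarrow> measure lborel (annulus h) \<le> C * (h * \<mu>)"
    "\<And>h. 0 < h \<Longrightarrow> h \<le> h0 \<Longrightarrow> h * \<mu> \<le> C * measure lborel (annulus h)"
    using minkowski_content_real[OF \<epsilon>, folded C_def \<mu>_def] by (rule; (assumption | blast))
  define \<omega> where "\<omega> = unit_ball_vol (real (CARD('n) - 1))"
  have \<omega>: "\<omega> > 0" by (simp add: \<omega>_def)
  have \<eta>\<omega>: "\<eta> = (\<lambda>s. (s / \<omega>) powr (2 / real (CARD('n) - 1)) / 2)" by (simp add: \<eta>_def \<omega>_def)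
  have "((\<lambda>s. (s / \<omega>) powr (2 / real (CARD('n) - 1))) \<longlongrightarrow> (0 / \<omega>) powr (2 / real (CARD('n) - 1))) (at_right 0)"
  proof (rule tendsto_powr2)
    show "((\<lambda>s. s / \<omega>) \<longlongrightarrow> 0 / \<omega>) (at_right 0)" using \<omega> by (intro tendsto_intros) auto
    have "eventually (\<lambda>s::real. 0 < s) (at_right 0)" by (rule eventually_at_right_less)
    then show "eventually (\<lambda>s. 0 \<le> s / \<omega>) (at_right 0)" by eventually_elim (use \<omega> in auto)
    show "0 < 2 / real (CARD('n) - 1)" using d_pos by (intro divide_pos_pos) linarith+
  qed simp
  from tendsto_divide[OF this tendsto_const[of 2]] have "(\<eta> \<longlongrightarrow> 0) (at_right 0)" by (simp add: \<eta>\<omega>)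
  moreover have "(1 - \<epsilon>)\<^sup>2 * h0 > 0" using \<epsilon> h0 by simp
  ultimately have "eventually (\<lambda>s. \<eta> s < (1 - \<epsilon>)\<^sup>2 * h0) (at_right 0)" by (rule order_tendstoD)
  moreover have "eventually (\<lambda>s. 0 < s \<and> s < s0) (at_right 0)" using s0(1) eventually_at_right_real[of 0 s0] by simp
  ultimately show ?thesis
  proof eventually_elim
    fix s assume \<eta>s: "\<eta> s < (1 - \<epsilon>)\<^sup>2 * h0" and s: "0 < s \<and> s < s0"
    have \<eta>0: "\<eta> s > 0" using s \<omega> by (simp add: \<eta>\<omega>)
    let ?B = "illumination_surface_body K g s"
    have up: "\<eta> s / (1 - \<epsilon>)\<^sup>2 \<le> h0" using \<eta>s \<epsilon> by (simp add: field_simps)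
    have "(1 - \<epsilon>)\<^sup>2 \<le> (1 + \<epsilon>)\<^sup>2" using \<epsilon> by (intro power_mono) auto
    then have "\<eta> s / (1 + \<epsilon>)\<^sup>2 \<le> \<eta> s / (1 - \<epsilon>)\<^sup>2" using \<eta>0 \<epsilon> by (intro divide_left_mono) auto
    then have lo: "\<eta> s / (1 + \<epsilon>)\<^sup>2 \<le> h0" using up by linarith
    have pos: "0 < \<eta> s / (1 + \<epsilon>)\<^sup>2" "0 < \<eta> s / (1 - \<epsilon>)\<^sup>2" using \<eta>0 \<epsilon> by auto
    have B: "?B \<in> lmeasurable"
    proof (rule bounded_set_imp_lmeasurable[OF _ illumination_surface_body_lebesgue])
      show "bounded ?B" using s0(3)[of s] s compact_imp_bounded[OF compactK] bounded_annulus
        by (meson bounded_Un bounded_subset)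
    qed
    have "measure lebesgue K + measure lborel (annulus (\<eta> s / (1 + \<epsilon>)\<^sup>2)) \<le> measure lebesgue ?B"
      unfolding measure_K_Un_annulus(2)[symmetric]
      using s0(2)[of s] s measure_K_Un_annulus(1) B by (intro measure_mono_fmeasurable) (auto dest: fmeasurableD)
    then have V1: "measure lborel (annulus (\<eta> s / (1 + \<epsilon>)\<^sup>2)) \<le> V s" by (simp add: V_def)
    have "measure lebesgue ?B \<le> measure lebesgue K + measure lborel (annulus (\<eta> s / (1 - \<epsilon>)\<^sup>2))"
      unfolding measure_K_Un_annulus(2)[symmetric]
      using s0(3)[of s] s measure_K_Un_annulus(1) B by (intro measure_mono_fmeasurable) (auto dest: fmeasurableD)
    then have V2: "V s \<le> measure lborel (annulus (\<eta> s / (1 - \<epsilon>)\<^sup>2))" by (simp add: V_def)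
    have "\<eta> s / (1 + \<epsilon>)\<^sup>2 * \<mu> \<le> C * V s"
      using h0(3)[OF pos(1) lo] mult_left_mono[OF V1, of C] C by linarith
    then have "\<mu> / ((1 + \<epsilon>)\<^sup>2 * C) \<le> V s / \<eta> s" using C \<eta>0 \<epsilon> by (simp add: field_simps)
    moreover have "V s \<le> C * (\<eta> s / (1 - \<epsilon>)\<^sup>2 * \<mu>)" using V2 h0(2)[OF pos(2) up] by linarith
    then have "V s / \<eta> s \<le> C / (1 - \<epsilon>)\<^sup>2 * \<mu>" using \<eta>0 \<epsilon> by (simp add: field_simps)
    ultimately show "\<mu> / ((1 + \<epsilon>)\<^sup>2 * (1 + \<epsilon>) ^ (2 * CARD('n))) \<le> V s / \<eta> s \<and>
      V s / \<eta> s \<le> (1 + \<epsilon>) ^ (2 * CARD('n)) / (1 - \<epsilon>)\<^sup>2 * \<mu>" by (simp add: C_def)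
  qed
qed

end

theorem corollary4p2:
  fixes K :: "(real^'n) set" and g :: "real^'n \<Rightarrow> real" and c :: real
  assumes "CARD('n) \<ge> 2"
    and "convex_body K"
    and "C2_plus K"
    and "centroid K = 0"
    and "\<And>x. x \<in> frontier K \<Longrightarrow> g x = sqrt (gauss_curvature K x)"
    and "c = 2 * unit_ball_vol (real (CARD('n) - 1)) powr (2 / real (CARD('n) - 1))"
  shows "((\<lambda>s. c * ((measure lebesgue (illumination_surface_body K g s) - measure lebesgue K)
                    / s powr (2 / real (CARD('n) - 1))))
          \<longlongrightarrow> measure (surface_area_measure K) (frontier K)) (at_right 0)"
proof -
  have "C2_convex_body K" using assms(1-3) by (rule C2_convex_body.intro)
  then interpret C2_convex_body K .
  let ?\<omega> = "unit_ball_vol (real (CARD('n) - 1))" and ?p = "2 / real (CARD('n) - 1)"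
  let ?V = "\<lambda>s. measure lebesgue (illumination_surface_body K g s) - measure lebesgue K"
  let ?\<mu> = "measure (surface_area_measure K) (frontier K)"
  have "((\<lambda>s. ?V s / ((s / ?\<omega>) powr ?p / 2)) \<longlongrightarrow> ?\<mu>) (at_right 0)"
  proof (rule tendsto_family_sandwich[OF illumination_volume_bounds[OF assms(5)]])
    show "((\<lambda>\<epsilon>. ?\<mu> / ((1 + \<epsilon>)\<^sup>2 * (1 + \<epsilon>) ^ (2 * CARD('n)))) \<longlongrightarrow> ?\<mu>) (at_right 0)"
      by (auto intro!: tendsto_eq_intros)
    show "((\<lambda>\<epsilon>. (1 + \<epsilon>) ^ (2 * CARD('n)) / (1 - \<epsilon>)\<^sup>2 * ?\<mu>) \<longlongrightarrow> ?\<mu>) (at_right 0)"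
      by (auto intro!: tendsto_eq_intros)
  qed
  moreover have "eventually (\<lambda>s. ?V s / ((s / ?\<omega>) powr ?p / 2) = c * (?V s / s powr ?p)) (at_right 0)"
    using eventually_at_right_less[of "0::real"]
  proof eventually_elim
    fix s :: real assume s: "0 < s"
    have "(s / ?\<omega>) powr ?p = s powr ?p / ?\<omega> powr ?p" by (rule powr_divide)
    then show "?V s / ((s / ?\<omega>) powr ?p / 2) = c * (?V s / s powr ?p)"
      unfolding assms(6) by (simp add: field_simps)
  qed
  ultimately show ?thesis by (rule Lim_transform_eventually)
qed

end
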